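(* Let $T>0$ and let $V$ be a probability vector field with $V:\mathcal P_c(\mathbb R^d)\to\mathcal P_c(T\mathbb R^d)$ satisfying: (H1) there is $C>0$ such that for all $\mu\in\mathcal P_c(\mathbb R^d)$, $\sup_{(x,v)\in\operatorname{supp}V[\mu]}|v|\le C\bigl(1+\sup_{x\in\operatorname{supp}\mu}|x|\bigr)$; (H3) for every $R>0$ there is $L=L(R)>0$ such that $\mathcal W(V[\mu],V[\nu])\le L\,W^{\mathbb R^d}(\mu,\nu)$ for all $\mu,\nu\in\mathcal P_c(\mathbb R^d)$ with $\operatorname{supp}\mu,\operatorname{supp}\nu\subset B(0,R)$. Let $\mu_0\in\mathcal P_c(\mathbb R^d)$. Then the semi-discrete Lagrangian scheme $\bar{\boldsymbol\mu}^N=\{\bar\mu^N_t\}_{t\in[0,T]}$ with initial datum $\mu_0$ converges, up to a subsequence, to a solution of $\dot\mu_t=V[\mu_t]$ on $(0,T)$, $\mu_{t=0}=\mu_0$. Moreover, if there is a sequence $\{N_k\}_{k\in\mathbb N}$ (with $N_k\to\infty$) along which both the semi-discrete Lagrangian scheme $\bar{\boldsymbol\mu}^{N_k}$ and the Lattice Approximate Solutions $\boldsymbol\mu^{N_k}$ with initial datum $\mu_0$ converge, then they converge to the same solution of this Cauchy problem.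
   Context: Notation: $\mathcal P(X)$ (resp. $\mathcal P_c(X)$) is the set of Borel probability measures on $X$ (resp. with compact support); $W^X$ is the 1-Wasserstein distance; $T\mathbb R^d=\mathbb R^d\times\mathbb R^d$ with elements $(x,v)$; $\pi_1(x,v)=x$; $\sharp$ is push-forward; $B(0,R)$ is the open ball. Convergence of a scheme means convergence of the curves uniformly in $t\in[0,T]$ in $W^{\mathbb R^d}$. A probability vector field (PVF) is a map $V$ from probability measures on $\mathbb R^d$ to probability measures on $T\mathbb R^d$ with $\pi_1\sharp V[\mu]=\mu$; $V[\mu]=\mu\otimes\nu_x[\mu]$ denotes its disintegration w.r.t. $\pi_1$. For $V_1,V_2\in\mathcal P_c(T\mathbb R^d)$ with $\mu_i=\pi_1\sharp V_i$, $$\mathcal W(V_1,V_2)=\inf\Bigl\{\int|v-w|\,dT(x,v,y,w):T\in\Pi(V_1,V_2),\ \pi_{13}\sharp T\in\Pi_{opt}(\mu_1,\mu_2)\Bigr\},$$ where $\Pi(V_1,V_2)$ is the set of transference plans (couplings), $\Pi_{opt}(\mu_1,\mu_2)$ the set of optimal plans for $W^{\mathbb R^d}(\mu_1,\mu_2)$ (cost $|x-y|$), and $\pi_{13}(x,v,y,w)=(x,y)$. Solution of $\dot\mu_t=V[\mu_t]$, $\mu_{t=0}=\mu_0$: a map $t\mapsto\mu_t\in\mathcal P(\mathbb R^d)$ with $\mu_{t=0}=\mu_0$ such that for every $f\in C_c^\infty(\mathbb R^d)$, $\int_{T\mathbb R^d}\nabla f(x)\cdot v\,dV[\mu_t](x,v)$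 is defined for a.e. $t$ and in $L^1([0,T])$, $t\mapsto\int f\,d\mu_t$ is absolutely continuous, and $\frac{d}{dt}\int f\,d\mu_t=\int_{T\mathbb R^d}\nabla f(x)\cdot v\,dV[\mu_t](x,v)$ for a.e. $t$. Semi-discrete Lagrangian scheme: for $N\ge1$ let $\Delta t=T/N$, $t_k=k\Delta t$. Set $\bar\mu^N_{0}=\mu_0$ and, recursively for $k=0,\dots,N-1$ and $t\in(t_k,t_{k+1}]$, $$\bar\mu^N_t=\int_{T\mathbb R^d}\delta_{x+(t-t_k)v}\,dV[\bar\mu^N_{t_k}](x,v),$$ i.e. the push-forward of $V[\bar\mu^N_{t_k}]$ by $(x,v)\mapsto x+(t-t_k)v$. Lattice Approximate Solutions (LAS): with $\Delta_N=T/N$, let $x_i$ be the points of $\frac{T}{N^2}\mathbb Z^d\cap[-TN,TN]^d$ and $v_j$ those of $\frac1N\mathbb Z^d\cap[-N,N]^d$; $Q=[0,\frac{T}{N^2})^d$, $Q'=[0,\frac1N)^d$; $m^x_i(\mu)=\mu(x_i+Q)$, $m^v_{ij}(V[\mu])=V[\mu](\{(x_i,v):v\in v_j+Q'\})$. Set $\mu^N_0=\sum_im^x_i(\mu_0)\delta_{x_i}$ and, recursively for $k=0,\dots,N-1$, $t\in[0,\Delta_N]$, $\mu^N_{k\Delta_N+t}=\sum_{i,j}m^v_{ij}(V[\mu^N_{k\Delta_N}])\,\delta_{x_i+tv_j}$. Here $N$ is taken large enough (depending on $\mu_0$, $C$, $T$) that no mass leaves the grids, so that these are probability measures. *)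

theory Defs
  imports "HOL-Probability.Probability"
begin

section \<open>Borel probability measures and their supports\<close>

abbreviation prob_measures :: "'a::topological_space measure set" where
  "prob_measures \<equiv> space (prob_algebra borel)"

lemma prob_measures_iff: "\<mu> \<in> prob_measures \<longleftrightarrow> sets \<mu> = sets borel \<and> prob_space \<mu>"
  by (simp add: space_prob_algebra)

definition supp :: "'a::topological_space measure \<Rightarrow> 'a set" where
  "supp \<mu> = {x. \<forall>U. open U \<and> x \<in> U \<longrightarrow> emeasure \<mu> U > 0}"

definition prob_measures_c :: "'a::topological_space measure set" where
  "prob_measures_c = {\<mu> \<in> prob_measures. compact (supp \<mu>)}"


section \<open>Wasserstein distance and optimal plans\<close>

definition plans :: "'a::topological_space measure \<Rightarrow> 'b::topological_space measure \<Rightarrow> ('a \<times> 'b) measure set" where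
  "plans \<mu> \<nu> = {\<pi> \<in> prob_measures. distr \<pi> borel fst = \<mu> \<and> distr \<pi> borel snd = \<nu>}"

definition transport_cost :: "('a::metric_space \<times> 'a) measure \<Rightarrow> ennreal" where
  "transport_cost \<pi> = (\<integral>\<^sup>+ (x, y). ennreal (dist x y) \<partial>\<pi>)"

text \<open>The distance is extended-valued, since first moments need not be finite; the infimum over
  the empty set (when an argument is not a Borel probability measure) is infinite.\<close>

definition wasserstein :: "'a::metric_space measure \<Rightarrow> 'a measure \<Rightarrow> ennreal" where
  "wasserstein \<mu> \<nu> = (INF \<pi>\<in>plans \<mu> \<nu>. transport_cost \<pi>)"

definition optimal_plans :: "'a::metric_space measure \<Rightarrow> 'a measure \<Rightarrow> ('a \<times> 'a) measure set" where
  "optimal_plans \<mu> \<nu> = {\<pi> \<in> plans \<mu> \<nu>. transport_cost \<pi> = wasserstein \<mu> \<nu>}"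


section \<open>Probability vector fields\<close>

type_synonym 'd pvf = "(real ^ 'd) measure \<Rightarrow> ((real ^ 'd) \<times> (real ^ 'd)) measure"

definition is_pvf :: "'d::finite pvf \<Rightarrow> bool" where
  "is_pvf V \<longleftrightarrow> (\<forall>\<mu>\<in>prob_measures. V \<mu> \<in> prob_measures \<and> distr (V \<mu>) borel fst = \<mu>)"

definition fibre_wasserstein ::
  "((real ^ 'd::finite) \<times> (real ^ 'd)) measure \<Rightarrow> ((real ^ 'd) \<times> (real ^ 'd)) measure \<Rightarrow> ennreal" where
  "fibre_wasserstein V\<^sub>1 V\<^sub>2 =
    (INF P \<in> {P \<in> plans V\<^sub>1 V\<^sub>2. distr P borel (\<lambda>((x, v), (y, w)). (x, y))
                 \<in> optimal_plans (distr V\<^sub>1 borel fst) (distr V\<^sub>2 borel fst)}.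
       \<integral>\<^sup>+ ((x, v), (y, w)). ennreal (norm (v - w)) \<partial>P)"

definition H1 :: "'d::finite pvf \<Rightarrow> bool" where
  "H1 V \<longleftrightarrow> (\<exists>C>0. \<forall>\<mu>\<in>prob_measures_c.
     (SUP (x, v)\<in>supp (V \<mu>). norm v) \<le> C * (1 + (SUP x\<in>supp \<mu>. norm x)))"

definition H3 :: "'d::finite pvf \<Rightarrow> bool" where
  "H3 V \<longleftrightarrow> (\<forall>R>0. \<exists>L>0. \<forall>\<mu>\<in>prob_measures_c. \<forall>\<nu>\<in>prob_measures_c.
     supp \<mu> \<subseteq> ball 0 R \<and> supp \<nu> \<subseteq> ball 0 R \<longrightarrow>
     fibre_wasserstein (V \<mu>) (V \<nu>) \<le> ennreal L * wasserstein \<mu> \<nu>)"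


section \<open>Solutions\<close>

definition partial_deriv :: "'d \<Rightarrow> (real ^ 'd::finite \<Rightarrow> real) \<Rightarrow> real ^ 'd \<Rightarrow> real" where
  "partial_deriv i f x = frechet_derivative f (at x) (axis i 1)"

definition grad :: "(real ^ 'd::finite \<Rightarrow> real) \<Rightarrow> real ^ 'd \<Rightarrow> real ^ 'd" where
  "grad f x = (\<chi> i. partial_deriv i f x)"

primrec C_k :: "nat \<Rightarrow> (real ^ 'd::finite \<Rightarrow> real) \<Rightarrow> bool" where
  "C_k 0 f \<longleftrightarrow> continuous_on UNIV f"
| "C_k (Suc k) f \<longleftrightarrow> f differentiable_on UNIV \<and> (\<forall>i. C_k k (partial_deriv i f))"

definition test_functions :: "(real ^ 'd::finite \<Rightarrow> real) set" where
  "test_functions = {f. (\<forall>k. C_k k f) \<and> compact (closure {x. f x \<noteq> 0})}"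

text \<open>Intervals are encoded by their pairs of endpoints.\<close>

definition abs_continuous_on_interval :: "real \<Rightarrow> real \<Rightarrow> (real \<Rightarrow> real) \<Rightarrow> bool" where
  "abs_continuous_on_interval a b g \<longleftrightarrow>
    (\<forall>\<epsilon>>0. \<exists>\<delta>>0. \<forall>D. finite D \<and> (\<forall>(u, v)\<in>D. a \<le> u \<and> u \<le> v \<and> v \<le> b) \<and>
       pairwise (\<lambda>(u, v) (u', v'). {u<..<v} \<inter> {u'<..<v'} = {}) D \<and> (\<Sum>(u, v)\<in>D. v - u) < \<delta>
       \<longrightarrow> (\<Sum>(u, v)\<in>D. \<bar>g v - g u\<bar>) < \<epsilon>)"

definition is_solution ::
  "'d::finite pvf \<Rightarrow> real \<Rightarrow> (real ^ 'd) measure \<Rightarrow> (real \<Rightarrow> (real ^ 'd) measure) \<Rightarrow> bool" where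
  "is_solution V T \<mu>\<^sub>0 \<mu> \<longleftrightarrow>
    (\<forall>t\<in>{0..T}. \<mu> t \<in> prob_measures) \<and> \<mu> 0 = \<mu>\<^sub>0 \<and>
    (\<forall>f\<in>test_functions.
      (AE t in lebesgue. t \<in> {0..T} \<longrightarrow> integrable (V (\<mu> t)) (\<lambda>(x, v). grad f x \<bullet> v)) \<and>
      set_integrable lebesgue {0..T} (\<lambda>t. \<integral>(x, v). grad f x \<bullet> v \<partial>V (\<mu> t)) \<and>
      abs_continuous_on_interval 0 T (\<lambda>t. \<integral>x. f x \<partial>\<mu> t) \<and>
      (AE t in lebesgue. t \<in> {0<..<T} \<longrightarrow>
        ((\<lambda>t. \<integral>x. f x \<partial>\<mu> t) has_real_derivative (\<integral>(x, v). grad f x \<bullet> v \<partial>V (\<mu> t))) (at t)))"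


section \<open>Approximation schemes\<close>

text \<open>Both schemes iterate a one-step map \<^term>\<open>S\<close>, where \<^term>\<open>S s m\<close> is the state reached from
  the node \<^term>\<open>m\<close> after time \<^term>\<open>s\<close>; the curve at a time \<^term>\<open>t\<close> with
  \<open>k * \<Delta> < t \<le> (k + 1) * \<Delta>\<close> is computed from the \<open>k\<close>-th node.\<close>

primrec node :: "(real \<Rightarrow> 'm \<Rightarrow> 'm) \<Rightarrow> real \<Rightarrow> 'm \<Rightarrow> nat \<Rightarrow> 'm" where
  "node S \<Delta> m 0 = m"
| "node S \<Delta> m (Suc k) = S \<Delta> (node S \<Delta> m k)"

definition scheme :: "(real \<Rightarrow> 'm \<Rightarrow> 'm) \<Rightarrow> real \<Rightarrow> 'm \<Rightarrow> real \<Rightarrow> 'm" where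
  "scheme S \<Delta> m t =
    (if t \<le> 0 then m
     else let k = nat (\<lceil>t / \<Delta>\<rceil> - 1) in S (t - real k * \<Delta>) (node S \<Delta> m k))"

lemma scheme_0: "scheme S \<Delta> m 0 = m"
  by (simp add: scheme_def)

lemma scheme_eq_node_step:
  assumes "\<Delta> > 0" and "real k * \<Delta> < t" and "t \<le> (real k + 1) * \<Delta>"
  shows "scheme S \<Delta> m t = S (t - real k * \<Delta>) (node S \<Delta> m k)"
proof -
  have "t > 0"
    using assms by (smt (verit) mult_nonneg_nonneg of_nat_0_le_iff)
  moreover have "\<lceil>t / \<Delta>\<rceil> = int k + 1"
    using assms by (intro ceiling_unique) (simp_all add: field_simps)
  ultimately show ?thesis
    by (simp add: scheme_def)
qed

lemma scheme_node: "\<Delta> > 0 \<Longrightarrow> scheme S \<Delta> m (real k * \<Delta>) = node S \<Delta> m k"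
proof (cases k)
  case (Suc j)
  assume "\<Delta> > 0"
  then show ?thesis
    using scheme_eq_node_step[of \<Delta> j "real k * \<Delta>" S m] Suc by (simp add: algebra_simps)
qed (simp add: scheme_0)

theorem scheme_recursion:
  assumes "\<Delta> > 0" and "real k * \<Delta> < t" and "t \<le> (real k + 1) * \<Delta>"
  shows "scheme S \<Delta> m t = S (t - real k * \<Delta>) (scheme S \<Delta> m (real k * \<Delta>))"
  using assms by (simp add: scheme_eq_node_step scheme_node)

definition lagrangian_step ::
  "'d::finite pvf \<Rightarrow> real \<Rightarrow> (real ^ 'd) measure \<Rightarrow> (real ^ 'd) measure" where
  "lagrangian_step V s \<mu> = distr (V \<mu>) borel (\<lambda>(x, v). x + s *\<^sub>R v)"

definition lagrangian_scheme ::
  "'d::finite pvf \<Rightarrow> real \<Rightarrow> (real ^ 'd) measure \<Rightarrow> nat \<Rightarrow> real \<Rightarrow> (real ^ 'd) measure" where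
  "lagrangian_scheme V T \<mu>\<^sub>0 N = scheme (lagrangian_step V) (T / real N) \<mu>\<^sub>0"

definition lattice_box :: "real \<Rightarrow> real \<Rightarrow> (real ^ 'd::finite) set" where
  "lattice_box h r = {x. \<forall>i. (\<exists>z::int. x $ i = h * of_int z) \<and> \<bar>x $ i\<bar> \<le> r}"

definition cell :: "real \<Rightarrow> real ^ 'd::finite \<Rightarrow> (real ^ 'd) set" where
  "cell h x = {y. \<forall>i. x $ i \<le> y $ i \<and> y $ i < x $ i + h}"

definition las_space_grid :: "real \<Rightarrow> nat \<Rightarrow> (real ^ 'd::finite) set" where
  "las_space_grid T N = lattice_box (T / (real N)\<^sup>2) (T * real N)"

definition las_velocity_grid :: "nat \<Rightarrow> (real ^ 'd::finite) set" where
  "las_velocity_grid N = lattice_box (1 / real N) (real N)"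

text \<open>A finite combination of Dirac masses is the image in the Borel sets of a
  \<^const>\<open>point_measure\<close> on the indices.  For \<open>N\<close> too small for the grids to carry all the mass,
  the measures below may have total mass less than 1; this does not affect limits as \<open>N\<close>
  tends to infinity.\<close>

definition las_initial :: "real \<Rightarrow> nat \<Rightarrow> (real ^ 'd::finite) measure \<Rightarrow> (real ^ 'd) measure" where
  "las_initial T N \<mu> =
    distr (point_measure (las_space_grid T N) (\<lambda>x. emeasure \<mu> (cell (T / (real N)\<^sup>2) x)))
      borel (\<lambda>x. x)"

definition las_step ::
  "'d::finite pvf \<Rightarrow> real \<Rightarrow> nat \<Rightarrow> real \<Rightarrow> (real ^ 'd) measure \<Rightarrow> (real ^ 'd) measure" where
  "las_step V T N s \<mu> =
    distr (point_measure (las_space_grid T N \<times> las_velocity_grid N)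
        (\<lambda>(x, v). emeasure (V \<mu>) ({x} \<times> cell (1 / real N) v)))
      borel (\<lambda>(x, v). x + s *\<^sub>R v)"

definition las ::
  "'d::finite pvf \<Rightarrow> real \<Rightarrow> (real ^ 'd) measure \<Rightarrow> nat \<Rightarrow> real \<Rightarrow> (real ^ 'd) measure" where
  "las V T \<mu>\<^sub>0 N = scheme (las_step V T N) (T / real N) (las_initial T N \<mu>\<^sub>0)"

definition curves_converge ::
  "real \<Rightarrow> (nat \<Rightarrow> real \<Rightarrow> 'a::metric_space measure) \<Rightarrow> (real \<Rightarrow> 'a measure) \<Rightarrow> bool" where
  "curves_converge T \<mu>s \<mu> \<longleftrightarrow> (\<lambda>k. SUP t\<in>{0..T}. wasserstein (\<mu>s k t) (\<mu> t)) \<longlonglongrightarrow> 0"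

end

(*
  On measures supported in a fixed ball, both schemes stay in a compact set of the Wasserstein
  space, and the Lagrangian scheme is Lipschitz in time by (H1); so Ascoli's theorem gives
  uniformly convergent subsequences.  By (H3), mu |-> int grad f . v dV[mu] is Lipschitz for the
  Wasserstein distance, so the Taylor expansion of a test function f over one step
  can be summed and passed to the limit, which gives the integrated form of the equation.
  When a lattice approximate solution has full mass, one of its steps is a Lagrangian step with
  velocities rounded by O(1/N); pushing the plan of (H3) through both steps and using Gronwall's
  inequality shows that the two schemes are O(1/N) apart.
*)

theory Submission
  imports Defs
begin

section \<open>The Wasserstein distance\<close>

text \<open>That both limits solve the same Cauchy problem does not by itself identify them, so they
  are matched through a bound between the schemes at each finite \<open>N\<close>. Lattice sums can
  lose mass for small \<open>N\<close>, yet no threshold for \<open>N\<close> is computed: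
  \<open>wasserstein\<close> is infinite unless both arguments are Borel probability measures, so
  closeness to the limit already forces full mass. Full mass means that almost every point lies in a
  cell of the grid, where a sum of Dirac masses is the push-forward under rounding. What makes (H3)
  usable for schemes is that one plan couples positions and velocities at once: moving along
  \<open>x + s v\<close> raises a cost \<open>w\<close> to at most \<open>w + s * L * w\<close>, up
  to a slack. The slack \<open>e\<close> appears because \<open>fibre_wasserstein\<close> is an
  infimum, and it is removed after each estimate. The constant of (H3) depends on a radius, so one
  radius independent of \<open>N\<close> is fixed beforehand: by (H1) a step of length
  \<open>s\<close> multiplies one plus the radius by at most \<open>1 + s * C\<close>, up to
  rounding, which keeps it below an exponential in \<open>T\<close>.\<close>

lemma prob_measuresD:
  assumes "\<mu> \<in> prob_measures"
  shows "prob_space \<mu>" "sets \<mu> = sets borel" "space \<mu> = UNIV"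
  using assms sets_eq_imp_space_eq[of \<mu> borel] by (auto simp: prob_measures_iff)

lemma distr_in_prob_measures:
  "prob_space M \<Longrightarrow> f \<in> borel_measurable M \<Longrightarrow> distr M borel f \<in> prob_measures"
  by (simp add: prob_measures_iff prob_space.prob_space_distr)

lemma plansD:
  assumes "\<pi> \<in> plans \<mu> \<nu>"
  shows "prob_space \<pi>" "sets \<pi> = sets borel" "space \<pi> = UNIV"
    "distr \<pi> borel fst = \<mu>" "distr \<pi> borel snd = \<nu>"
  using assms prob_measuresD[of \<pi>] by (auto simp: plans_def)

lemma borel_measurable_fst_snd:
  assumes "sets \<pi> = sets (borel :: ('a::second_countable_topology \<times> 'b::second_countable_topology) measure)"
  shows "fst \<in> borel_measurable \<pi>" "snd \<in> borel_measurable \<pi>"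
  unfolding measurable_cong_sets[OF assms refl] by (simp_all add: borel_prod[symmetric])

lemma plans_prob_measures:
  fixes \<mu> :: "'a::second_countable_topology measure" and \<nu> :: "'b::second_countable_topology measure"
  assumes "\<pi> \<in> plans \<mu> \<nu>"
  shows "\<mu> \<in> prob_measures" "\<nu> \<in> prob_measures"
  using plansD[OF assms] borel_measurable_fst_snd[of \<pi>]
    distr_in_prob_measures[of \<pi> fst] distr_in_prob_measures[of \<pi> snd] by auto

lemma wasserstein_less_imp_plan:
  "wasserstein \<mu> \<nu> < c \<Longrightarrow> \<exists>\<pi>\<in>plans \<mu> \<nu>. transport_cost \<pi> < c"
  by (auto simp: wasserstein_def INF_less_iff)

text \<open>The infimum over an empty set of plans is infinite, so a finite distance certifies both
  arguments as Borel probability measures. This is how convergence of the lattice scheme later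
  yields that no mass has left the grids.\<close>

lemma wasserstein_finite_prob_measures:
  fixes \<mu> \<nu> :: "'a::{metric_space,second_countable_topology} measure"
  assumes "wasserstein \<mu> \<nu> < \<infinity>"
  shows "\<mu> \<in> prob_measures" "\<nu> \<in> prob_measures"
  using wasserstein_less_imp_plan[OF assms] plans_prob_measures by blast+

section \<open>Couplings and the axioms of a metric\<close>

lemma coupling_in_plans:
  fixes X :: "'b \<Rightarrow> 'a::second_countable_topology" and Y :: "'b \<Rightarrow> 'c::second_countable_topology"
  assumes "prob_space M" and [measurable]: "X \<in> borel_measurable M" "Y \<in> borel_measurable M"
  shows "distr M borel (\<lambda>\<omega>. (X \<omega>, Y \<omega>)) \<in> plans (distr M borel X) (distr M borel Y)"
proof -
  have [measurable]: "(\<lambda>\<omega>. (X \<omega>, Y \<omega>)) \<in> borel_measurable M"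
    unfolding borel_prod[symmetric] by measurable
  show ?thesis
    using assms(1) borel_measurable_fst_snd[where ?'a='a and ?'b='c]
    by (auto simp: plans_def distr_in_prob_measures distr_distr comp_def)
qed

text \<open>The form in which upper bounds on the distance are proved: two random variables on one
  probability space define a plan between their laws. Symmetry, the triangle inequality and the
  estimates for the schemes are all instances.\<close>

lemma wasserstein_coupling_le:
  fixes X Y :: "'b \<Rightarrow> 'a::{metric_space,second_countable_topology}"
  assumes "prob_space M" and [measurable]: "X \<in> borel_measurable M" "Y \<in> borel_measurable M"
  shows "wasserstein (distr M borel X) (distr M borel Y) \<le> (\<integral>\<^sup>+\<omega>. ennreal (dist (X \<omega>) (Y \<omega>)) \<partial>M)"
proof -
  have [measurable]: "(\<lambda>\<omega>. (X \<omega>, Y \<omega>)) \<in> borel_measurable M"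
    unfolding borel_prod[symmetric] by measurable
  have [measurable]: "(\<lambda>(x::'a, y). ennreal (dist x y)) \<in> borel_measurable borel"
    by (simp add: borel_prod[symmetric])
  have "transport_cost (distr M borel (\<lambda>\<omega>. (X \<omega>, Y \<omega>))) = (\<integral>\<^sup>+\<omega>. ennreal (dist (X \<omega>) (Y \<omega>)) \<partial>M)"
    unfolding transport_cost_def by (subst nn_integral_distr) auto
  then show ?thesis
    using INF_lower[OF coupling_in_plans[OF assms], of transport_cost] by (simp add: wasserstein_def)
qed

lemma transport_cost_nn_integral:
  fixes \<pi> :: "('a::metric_space \<times> 'a) measure"
  shows "transport_cost \<pi> = (\<integral>\<^sup>+p. ennreal (dist (fst p) (snd p)) \<partial>\<pi>)"
  by (simp add: transport_cost_def split_beta')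

lemma wasserstein_refl:
  fixes \<mu> :: "'a::{metric_space,second_countable_topology} measure"
  assumes "\<mu> \<in> prob_measures"
  shows "wasserstein \<mu> \<mu> = 0"
  using wasserstein_coupling_le[of \<mu> "\<lambda>x. x" "\<lambda>x. x"] prob_measuresD[OF assms]
  by (simp add: distr_id2 measurable_ident_sets)

lemma wasserstein_sym_le:
  fixes \<mu> \<nu> :: "'a::{metric_space,second_countable_topology} measure"
  shows "wasserstein \<nu> \<mu> \<le> wasserstein \<mu> \<nu>"
  unfolding wasserstein_def[of \<mu>]
proof (rule INF_greatest)
  fix \<pi> assume "\<pi> \<in> plans \<mu> \<nu>"
  note p = plansD[OF this]
  show "wasserstein \<nu> \<mu> \<le> transport_cost \<pi>"
    using wasserstein_coupling_le[OF p(1) borel_measurable_fst_snd(2,1)[OF p(2)]] p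
    by (simp add: transport_cost_nn_integral dist_commute)
qed

lemma wasserstein_sym:
  fixes \<mu> \<nu> :: "'a::{metric_space,second_countable_topology} measure"
  shows "wasserstein \<nu> \<mu> = wasserstein \<mu> \<nu>"
  by (intro antisym wasserstein_sym_le)

text \<open>Disintegration is avoided by gluing only up to an error: the middle space is cut into
  countably many small cells (the fibres of \<open>c\<close>), and the product of the two plans is
  reweighted so that both middle points lie in the same cell.\<close>

lemma glue_cells:
  fixes \<gamma> :: "('a::second_countable_topology \<times> 'b::second_countable_topology) measure"
    and \<gamma>' :: "('b \<times> 'c::second_countable_topology) measure" and c :: "'b \<Rightarrow> nat"
  assumes \<gamma>: "\<gamma> \<in> plans \<mu> \<nu>" and \<gamma>': "\<gamma>' \<in> plans \<nu> \<rho>"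
    and c: "c \<in> measurable borel (count_space UNIV)"
  obtains P where "prob_space P" "sets P = sets (\<gamma> \<Otimes>\<^sub>M \<gamma>')" "distr P \<gamma> fst = \<gamma>" "distr P \<gamma>' snd = \<gamma>'"
    "AE p in P. c (snd (fst p)) = c (fst (snd p))"
proof -
  note g = plansD[OF \<gamma>] and g' = plansD[OF \<gamma>']
  interpret g: prob_space \<gamma> by fact
  interpret g': prob_space \<gamma>' by fact
  interpret pair_sigma_finite \<gamma> \<gamma>' ..
  interpret n: prob_space \<nu>
    using plans_prob_measures[OF \<gamma>] prob_measuresD by blast
  note [measurable] = c borel_measurable_fst_snd[OF g(2)] borel_measurable_fst_snd[OF g'(2)]
  have sn: "sets \<nu> = sets borel" "space \<nu> = UNIV"
    using prob_measuresD plans_prob_measures[OF \<gamma>] by blast+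
  \<comment> \<open>For a null cell this weight is infinite; \<open>nn\<close> shows that almost no
    point lies in such a cell, so it does not affect the marginals.\<close>
  define w where "w n = inverse (emeasure \<nu> {y. c y = n})" for n
  have cell [measurable]: "{y. c y = n} \<in> sets borel" for n
    using measurable_sets[OF c, of "{n}"] by (simp add: vimage_def)
  define k where "k p = (if c (snd (fst p)) = c (fst (snd p)) then w (c (snd (fst p))) else 0)"
    for p :: "('a \<times> 'b) \<times> ('b \<times> 'c)"
  define a where "a p = c (snd (fst p))" for p :: "('a \<times> 'b) \<times> ('b \<times> 'c)"
  define b where "b p = c (fst (snd p))" for p :: "('a \<times> 'b) \<times> ('b \<times> 'c)"
  have [measurable]: "a \<in> measurable (\<gamma> \<Otimes>\<^sub>M \<gamma>') (count_space UNIV)"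
    "b \<in> measurable (\<gamma> \<Otimes>\<^sub>M \<gamma>') (count_space UNIV)"
    using measurable_compose[OF measurable_fst measurable_compose[OF borel_measurable_fst_snd(2)[OF g(2)] c], of \<gamma>']
      measurable_compose[OF measurable_snd measurable_compose[OF borel_measurable_fst_snd(1)[OF g'(2)] c], of \<gamma>]
    by (simp_all add: a_def[abs_def] b_def[abs_def])
  have k_ab: "k = (\<lambda>p. if a p = b p then w (a p) else 0)"
    by (simp add: fun_eq_iff k_def a_def b_def)
  have [measurable]: "k \<in> borel_measurable (\<gamma> \<Otimes>\<^sub>M \<gamma>')"
  proof -
    have [measurable]: "(\<lambda>p. w (a p)) \<in> borel_measurable (\<gamma> \<Otimes>\<^sub>M \<gamma>')"
      by (rule measurable_compose[of a _ "count_space UNIV"]) simp_all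
    have "(\<lambda>p. real (a p)) \<in> borel_measurable (\<gamma> \<Otimes>\<^sub>M \<gamma>')" "(\<lambda>p. real (b p)) \<in> borel_measurable (\<gamma> \<Otimes>\<^sub>M \<gamma>')"
      by (auto intro!: measurable_compose[of _ _ "count_space UNIV"])
    then have "Measurable.pred (\<gamma> \<Otimes>\<^sub>M \<gamma>') (\<lambda>p. real (a p) = real (b p))"
      by measurable
    then have [measurable]: "Measurable.pred (\<gamma> \<Otimes>\<^sub>M \<gamma>') (\<lambda>p. a p = b p)"
      by simp
    show ?thesis
      unfolding k_ab by measurable
  qed
  have w1: "w n * emeasure \<nu> {y. c y = n} = 1" if "emeasure \<nu> {y. c y = n} \<noteq> 0" for n
  proof -
    have "emeasure \<nu> {y. c y = n} < top"
      using n.emeasure_finite[of "{y. c y = n}"] by (metis infinity_ennreal_def top.not_eq_extremum)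
    from ennreal_divide_self[OF that this] show ?thesis
      by (simp add: w_def divide_ennreal_def mult.commute)
  qed
  have nn: "AE y in \<nu>. emeasure \<nu> {y'. c y' = c y} \<noteq> 0"
  proof -
    have "AE y in \<nu>. c y \<noteq> n" if "emeasure \<nu> {y. c y = n} = 0" for n
      using that by (intro AE_I[where N="{y. c y = n}"]) (auto simp: sn)
    then have "AE y in \<nu>. \<forall>n. emeasure \<nu> {y. c y = n} = 0 \<longrightarrow> c y \<noteq> n"
      by (subst AE_all_countable) auto
    then show ?thesis by (rule AE_mp) auto
  qed
  \<comment> \<open>Integrating the density over the second plan sees only the marginal
    \<open>\<nu>\<close>, so the result is weight times mass of the cell, that is 1 outside null
    cells. Hence reweighting keeps the first plan as a marginal; \<open>k2\<close> is the mirror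
    image.\<close>
  have k1: "AE p in \<gamma>. (\<integral>\<^sup>+q. k (p, q) \<partial>\<gamma>') = 1"
  proof -
    have "(\<integral>\<^sup>+q. k (p, q) \<partial>\<gamma>') = w (c (snd p)) * emeasure \<nu> {y. c y = c (snd p)}" for p
    proof -
      have "(\<integral>\<^sup>+q. k (p, q) \<partial>\<gamma>') = (\<integral>\<^sup>+q. w (c (snd p)) * indicator {y. c y = c (snd p)} (fst q) \<partial>\<gamma>')"
        by (intro nn_integral_cong) (auto simp: k_def indicator_def)
      also have "\<dots> = (\<integral>\<^sup>+y. w (c (snd p)) * indicator {y. c y = c (snd p)} y \<partial>distr \<gamma>' borel fst)"
        by (subst nn_integral_distr) auto
      finally show ?thesis
        unfolding g'(4) by (simp add: nn_integral_cmult_indicator sn)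
    qed
    moreover have "AE p in \<gamma>. emeasure \<nu> {y'. c y' = c (snd p)} \<noteq> 0"
      using nn unfolding g(5)[symmetric] by (subst (asm) AE_distr_iff) auto
    ultimately show ?thesis using w1 by (auto elim: AE_mp)
  qed
  have k2: "AE q in \<gamma>'. (\<integral>\<^sup>+p. k (p, q) \<partial>\<gamma>) = 1"
  proof -
    have "(\<integral>\<^sup>+p. k (p, q) \<partial>\<gamma>) = w (c (fst q)) * emeasure \<nu> {y. c y = c (fst q)}" for q
    proof -
      have "(\<integral>\<^sup>+p. k (p, q) \<partial>\<gamma>) = (\<integral>\<^sup>+p. w (c (fst q)) * indicator {y. c y = c (fst q)} (snd p) \<partial>\<gamma>)"
        by (intro nn_integral_cong) (auto simp: k_def indicator_def)
      also have "\<dots> = (\<integral>\<^sup>+y. w (c (fst q)) * indicator {y. c y = c (fst q)} y \<partial>distr \<gamma> borel snd)"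
        by (subst nn_integral_distr) auto
      finally show ?thesis
        unfolding g(5) by (simp add: nn_integral_cmult_indicator sn)
    qed
    moreover have "AE p in \<gamma>'. emeasure \<nu> {y'. c y' = c (fst p)} \<noteq> 0"
      using nn unfolding g'(4)[symmetric] by (subst (asm) AE_distr_iff) auto
    ultimately show ?thesis using w1 by (auto elim: AE_mp)
  qed
  define P where "P = density (\<gamma> \<Otimes>\<^sub>M \<gamma>') k"
  have sP [simp]: "sets P = sets (\<gamma> \<Otimes>\<^sub>M \<gamma>')" and spP: "space P = UNIV"
    using g(3) g'(3) by (auto simp: P_def space_pair_measure)
  have mfs [measurable]: "fst \<in> measurable P \<gamma>" "snd \<in> measurable P \<gamma>'"
    by (auto simp: measurable_cong_sets[OF sP refl])
  have d1: "distr P \<gamma> fst = \<gamma>"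
  proof (rule measure_eqI)
    fix A assume "A \<in> sets (distr P \<gamma> fst)"
    then have [measurable]: "A \<in> sets \<gamma>" by simp
    have "emeasure (distr P \<gamma> fst) A = emeasure P (fst -` A)"
      by (simp add: emeasure_distr spP)
    also have "\<dots> = (\<integral>\<^sup>+p. k p * indicator (fst -` A) p \<partial>(\<gamma> \<Otimes>\<^sub>M \<gamma>'))"
      using measurable_sets[OF mfs(1), of A] unfolding P_def
      by (subst emeasure_density) (auto simp: space_pair_measure g(3) g'(3))
    also have "\<dots> = (\<integral>\<^sup>+p. k p * indicator A (fst p) \<partial>(\<gamma> \<Otimes>\<^sub>M \<gamma>'))"
      by (intro nn_integral_cong) (auto simp: indicator_def)
    also have "\<dots> = (\<integral>\<^sup>+p. (\<integral>\<^sup>+q. k (p, q) * indicator A p \<partial>\<gamma>') \<partial>\<gamma>)"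
      by (subst g'.nn_integral_fst[symmetric]) auto
    also have "\<dots> = (\<integral>\<^sup>+p. (\<integral>\<^sup>+q. k (p, q) \<partial>\<gamma>') * indicator A p \<partial>\<gamma>)"
      by (intro nn_integral_cong nn_integral_multc) measurable
    also have "\<dots> = (\<integral>\<^sup>+p. indicator A p \<partial>\<gamma>)"
      using k1 by (intro nn_integral_cong_AE) auto
    finally show "emeasure (distr P \<gamma> fst) A = emeasure \<gamma> A" by simp
  qed simp
  have d2: "distr P \<gamma>' snd = \<gamma>'"
  proof (rule measure_eqI)
    fix A assume "A \<in> sets (distr P \<gamma>' snd)"
    then have [measurable]: "A \<in> sets \<gamma>'" by simp
    have "emeasure (distr P \<gamma>' snd) A = emeasure P (snd -` A)"
      by (simp add: emeasure_distr spP)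
    also have "\<dots> = (\<integral>\<^sup>+p. k p * indicator (snd -` A) p \<partial>(\<gamma> \<Otimes>\<^sub>M \<gamma>'))"
      using measurable_sets[OF mfs(2), of A] unfolding P_def
      by (subst emeasure_density) (auto simp: space_pair_measure g(3) g'(3))
    also have "\<dots> = (\<integral>\<^sup>+p. k p * indicator A (snd p) \<partial>(\<gamma> \<Otimes>\<^sub>M \<gamma>'))"
      by (intro nn_integral_cong) (auto simp: indicator_def)
    also have "\<dots> = (\<integral>\<^sup>+q. (\<integral>\<^sup>+p. k (p, q) * indicator A q \<partial>\<gamma>) \<partial>\<gamma>')"
      by (subst nn_integral_snd[symmetric]) auto
    also have "\<dots> = (\<integral>\<^sup>+q. (\<integral>\<^sup>+p. k (p, q) \<partial>\<gamma>) * indicator A q \<partial>\<gamma>')"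
      by (intro nn_integral_cong nn_integral_multc) measurable
    also have "\<dots> = (\<integral>\<^sup>+p. indicator A p \<partial>\<gamma>')"
      using k2 by (intro nn_integral_cong_AE) auto
    finally show "emeasure (distr P \<gamma>' snd) A = emeasure \<gamma>' A" by simp
  qed simp
  have "prob_space P"
    using d1 mfs(1) g.prob_space_axioms by (metis prob_space_distrD)
  moreover have "AE p in P. c (snd (fst p)) = c (fst (snd p))"
    unfolding P_def by (subst AE_density) (auto simp: k_def)
  ultimately show ?thesis
    using that[of P] sP d1 d2 by simp
qed

text \<open>The cell of a point is the index of the first member of a dense sequence within
  \<open>h / 2\<close> of it; two points of one cell share this neighbour.\<close>

lemma countable_small_cells:
  assumes "h > 0"
  obtains c :: "'a::{metric_space,second_countable_topology} \<Rightarrow> nat"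
  where "c \<in> measurable borel (count_space UNIV)" "\<And>x y. c x = c y \<Longrightarrow> dist x y < h"
proof -
  obtain D :: "'a set" where D: "countable D" "\<And>U. open U \<Longrightarrow> U \<noteq> {} \<Longrightarrow> \<exists>d\<in>D. d \<in> U"
    using countable_dense_setE by metis
  have near: "\<exists>d\<in>D. dist d x < h / 2" for x
    using D(2)[of "ball x (h/2)"] assms by (auto simp: dist_commute)
  then have ne: "D \<noteq> {}" by auto
  define e where "e = from_nat_into D"
  have ex: "\<exists>n. dist (e n) x < h / 2" for x
    using near[of x] D(1) ne unfolding e_def by (metis from_nat_into_surj)
  define c where "c x = (LEAST n. dist (e n) x < h / 2)" for x
  have "c \<in> measurable borel (count_space UNIV)"
    unfolding c_def by measurable
  moreover have "dist x y < h" if "c x = c y" for x y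
    using LeastI_ex[OF ex[of x]] LeastI_ex[OF ex[of y]] that dist_triangle_half_r[of "e (c x)" x h y]
    unfolding c_def by metis
  ultimately show ?thesis using that by blast
qed

text \<open>After gluing, the two middle points differ by less than \<open>h\<close>, so composing
  two plans costs at most \<open>h\<close> more than the sum of their costs, for every
  \<open>h\<close>. A second slack, \<open>e/2\<close> for each plan, then replaces the costs by the
  infima.\<close>

lemma wasserstein_triangle:
  fixes \<mu> \<nu> \<rho> :: "'a::{metric_space,second_countable_topology} measure"
  shows "wasserstein \<mu> \<rho> \<le> wasserstein \<mu> \<nu> + wasserstein \<nu> \<rho>"
proof -
  have "wasserstein \<mu> \<rho> \<le> transport_cost \<gamma> + transport_cost \<gamma>'"
    if \<gamma>: "\<gamma> \<in> plans \<mu> \<nu>" and \<gamma>': "\<gamma>' \<in> plans \<nu> \<rho>" for \<gamma> \<gamma>'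
  proof (rule ennreal_le_epsilon)
    fix h :: real assume h: "h > 0"
    note g = plansD[OF \<gamma>] and g' = plansD[OF \<gamma>']
    note [measurable] = borel_measurable_fst_snd[OF g(2)] borel_measurable_fst_snd[OF g'(2)]
    obtain c :: "'a \<Rightarrow> nat" where c: "c \<in> measurable borel (count_space UNIV)" "\<And>x y. c x = c y \<Longrightarrow> dist x y < h"
      using countable_small_cells[OF h] by blast
    obtain P where P: "prob_space P" "sets P = sets (\<gamma> \<Otimes>\<^sub>M \<gamma>')" "distr P \<gamma> fst = \<gamma>" "distr P \<gamma>' snd = \<gamma>'"
      "AE p in P. c (snd (fst p)) = c (fst (snd p))"
      using glue_cells[OF \<gamma> \<gamma>' c(1)] by blast
    interpret P: prob_space P by fact
    have [measurable]: "fst \<in> measurable P \<gamma>" "snd \<in> measurable P \<gamma>'"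
      by (auto simp: measurable_cong_sets[OF P(2) refl])
    have m1: "distr P borel (\<lambda>p. fst (fst p)) = \<mu>"
      using g(4) P(3) distr_distr[of fst \<gamma> borel fst P] by (simp add: comp_def)
    have m2: "distr P borel (\<lambda>p. snd (snd p)) = \<rho>"
      using g'(5) P(4) distr_distr[of snd \<gamma>' borel snd P] by (simp add: comp_def)
    have "wasserstein \<mu> \<rho> \<le> (\<integral>\<^sup>+p. ennreal (dist (fst (fst p)) (snd (snd p))) \<partial>P)"
      using wasserstein_coupling_le[OF P(1), of "\<lambda>p. fst (fst p)" "\<lambda>p. snd (snd p)"] m1 m2 by simp
    also have "\<dots> \<le> (\<integral>\<^sup>+p. (ennreal (dist (fst (fst p)) (snd (fst p))) + ennreal h)
        + ennreal (dist (fst (snd p)) (snd (snd p))) \<partial>P)"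
    proof (rule nn_integral_mono_AE, rule AE_mp[OF P(5)], rule AE_I2, rule impI)
      fix p :: "('a \<times> 'a) \<times> ('a \<times> 'a)" assume "c (snd (fst p)) = c (fst (snd p))"
      then have "dist (snd (fst p)) (fst (snd p)) < h" by (rule c(2))
      then have "dist (fst (fst p)) (snd (snd p)) \<le> dist (fst (fst p)) (snd (fst p)) + h + dist (fst (snd p)) (snd (snd p))"
        by metric
      then show "ennreal (dist (fst (fst p)) (snd (snd p))) \<le> ennreal (dist (fst (fst p)) (snd (fst p))) + ennreal h
        + ennreal (dist (fst (snd p)) (snd (snd p)))"
        using h by (simp flip: ennreal_plus)
    qed
    also have "\<dots> = (\<integral>\<^sup>+p. ennreal (dist (fst (fst p)) (snd (fst p))) \<partial>P) + ennreal h
        + (\<integral>\<^sup>+p. ennreal (dist (fst (snd p)) (snd (snd p))) \<partial>P)"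
      by (simp add: nn_integral_add P.emeasure_space_1)
    also have "(\<integral>\<^sup>+p. ennreal (dist (fst (fst p)) (snd (fst p))) \<partial>P) = transport_cost \<gamma>"
      using nn_integral_distr[of fst P \<gamma> "\<lambda>p. ennreal (dist (fst p) (snd p))"]
      by (simp add: transport_cost_nn_integral P(3))
    also have "(\<integral>\<^sup>+p. ennreal (dist (fst (snd p)) (snd (snd p))) \<partial>P) = transport_cost \<gamma>'"
      using nn_integral_distr[of snd P \<gamma>' "\<lambda>p. ennreal (dist (fst p) (snd p))"]
      by (simp add: transport_cost_nn_integral P(4))
    finally show "wasserstein \<mu> \<rho> \<le> transport_cost \<gamma> + transport_cost \<gamma>' + ennreal h"
      by (simp add: ac_simps)
  qed
  note * = this
  show ?thesis
  proof (rule ennreal_le_epsilon)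
    fix e :: real assume e: "e > 0" and fin: "wasserstein \<mu> \<nu> + wasserstein \<nu> \<rho> < top"
    have "wasserstein \<mu> \<nu> < wasserstein \<mu> \<nu> + ennreal (e/2)" "wasserstein \<nu> \<rho> < wasserstein \<nu> \<rho> + ennreal (e/2)"
      using e fin ennreal_add_left_cancel_less[of "wasserstein \<mu> \<nu>" 0 "ennreal (e/2)"]
        ennreal_add_left_cancel_less[of "wasserstein \<nu> \<rho>" 0 "ennreal (e/2)"] by auto
    then obtain \<gamma> \<gamma>' where p: "\<gamma> \<in> plans \<mu> \<nu>" "\<gamma>' \<in> plans \<nu> \<rho>"
      and l: "transport_cost \<gamma> < wasserstein \<mu> \<nu> + ennreal (e/2)" "transport_cost \<gamma>' < wasserstein \<nu> \<rho> + ennreal (e/2)"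
      using wasserstein_less_imp_plan by metis
    have "wasserstein \<mu> \<rho> \<le> transport_cost \<gamma> + transport_cost \<gamma>'"
      by (rule *[OF p])
    also have "\<dots> \<le> (wasserstein \<mu> \<nu> + ennreal (e/2)) + (wasserstein \<nu> \<rho> + ennreal (e/2))"
      using l by (intro add_mono) auto
    also have "\<dots> = wasserstein \<mu> \<nu> + wasserstein \<nu> \<rho> + ennreal (e/2 + e/2)"
      using e by (subst ennreal_plus) (auto simp: ac_simps)
    finally show "wasserstein \<mu> \<rho> \<le> wasserstein \<mu> \<nu> + wasserstein \<nu> \<rho> + ennreal e" by simp
  qed
qed

section \<open>Lipschitz test functions and separation of measures\<close>

lemma abs_integral_le_nn_integral:
  fixes f :: "'a \<Rightarrow> real"
  assumes "integrable M f" "(\<integral>\<^sup>+x. ennreal \<bar>f x\<bar> \<partial>M) \<le> ennreal c" "0 \<le> c"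
  shows "\<bar>integral\<^sup>L M f\<bar> \<le> c"
proof -
  have "ennreal (norm (integral\<^sup>L M f)) \<le> (\<integral>\<^sup>+x. ennreal (norm (f x)) \<partial>M)"
    by (rule integral_norm_bound_ennreal[OF assms(1)])
  also have "\<dots> \<le> ennreal c" using assms by simp
  finally show ?thesis using assms(3) by simp
qed

lemma (in prob_space) integrable_bounded:
  fixes f :: "'a \<Rightarrow> real"
  assumes "f \<in> borel_measurable M" "\<And>x. \<bar>f x\<bar> \<le> B"
  shows "integrable M f"
  using assms by (intro integrable_const_bound[of f B]) auto

text \<open>The easy half of Kantorovich-Rubinstein duality: under any plan the difference of the
  integrals is the integral of \<open>f x - f y\<close>. Boundedness of \<open>f\<close> supplies
  integrability, since first moments may be infinite.\<close>

lemma wasserstein_integral_diff_le: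
  fixes \<mu> \<nu> :: "'a::{metric_space,second_countable_topology} measure" and f :: "'a \<Rightarrow> real"
  assumes W: "wasserstein \<mu> \<nu> \<le> ennreal w" "0 \<le> w"
    and lip: "\<And>x y. \<bar>f x - f y\<bar> \<le> K * dist x y" "0 \<le> K" and bd: "\<And>x. \<bar>f x\<bar> \<le> B"
  shows "\<bar>integral\<^sup>L \<mu> f - integral\<^sup>L \<nu> f\<bar> \<le> K * w"
proof -
  have "continuous_on UNIV f"
    using lip by (intro lipschitz_on_continuous_on[of K] lipschitz_onI) (auto simp: dist_real_def)
  then have [measurable]: "f \<in> borel_measurable borel"
    by (rule borel_measurable_continuous_onI)
  have *: "\<bar>integral\<^sup>L \<mu> f - integral\<^sup>L \<nu> f\<bar> \<le> K * (w + e)" if e: "e > 0" for e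
  proof -
    have "wasserstein \<mu> \<nu> < ennreal (w + e)"
      using W e by (metis add.commute ennreal_lessI le_less_trans less_add_same_cancel2 add_pos_nonneg)
    then obtain \<pi> where \<pi>: "\<pi> \<in> plans \<mu> \<nu>" and c: "transport_cost \<pi> < ennreal (w + e)"
      using wasserstein_less_imp_plan by blast
    note p = plansD[OF \<pi>]
    interpret prob_space \<pi> by fact
    note m [measurable] = borel_measurable_fst_snd[OF p(2)]
    have i: "integrable \<pi> (\<lambda>p. f (fst p))" "integrable \<pi> (\<lambda>p. f (snd p))"
      by (intro integrable_bounded[of _ B]; use bd in simp)+
    have "integral\<^sup>L \<mu> f - integral\<^sup>L \<nu> f = (\<integral>p. f (fst p) - f (snd p) \<partial>\<pi>)"
      using i integral_distr[OF m(1), of f] integral_distr[OF m(2), of f] by (simp add: p)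
    moreover have "\<bar>\<integral>p. f (fst p) - f (snd p) \<partial>\<pi>\<bar> \<le> K * (w + e)"
    proof (rule abs_integral_le_nn_integral)
      have "(\<integral>\<^sup>+p. ennreal \<bar>f (fst p) - f (snd p)\<bar> \<partial>\<pi>) \<le> (\<integral>\<^sup>+p. ennreal K * ennreal (dist (fst p) (snd p)) \<partial>\<pi>)"
        using lip by (intro nn_integral_mono) (simp flip: ennreal_mult)
      also have "\<dots> = ennreal K * transport_cost \<pi>"
        by (subst nn_integral_cmult) (auto simp: transport_cost_nn_integral)
      also have "\<dots> \<le> ennreal K * ennreal (w + e)"
        using c by (intro mult_left_mono) auto
      finally show "(\<integral>\<^sup>+p. ennreal \<bar>f (fst p) - f (snd p)\<bar> \<partial>\<pi>) \<le> ennreal (K * (w + e))"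
        using lip(2) W(2) e by (simp add: ennreal_mult)
    qed (use i lip(2) W(2) e in auto)
    ultimately show ?thesis by simp
  qed
  show ?thesis
  proof (rule field_le_epsilon)
    fix e :: real assume e: "e > 0"
    \<comment> \<open>Dividing by \<open>K + 1\<close> instead of \<open>K\<close> keeps the slack
      defined when \<open>K = 0\<close>; the same device recurs in later estimates.\<close>
    have "K * (w + e / (K + 1)) \<le> K * w + e"
      using lip(2) e by (simp add: field_simps)
    with *[of "e / (K + 1)"] e lip(2) show "\<bar>integral\<^sup>L \<mu> f - integral\<^sup>L \<nu> f\<bar> \<le> K * w + e" by simp
  qed
qed

lemma prob_measures_eqI_open:
  fixes \<mu> \<nu> :: "'a::topological_space measure"
  assumes \<mu>: "\<mu> \<in> prob_measures" and \<nu>: "\<nu> \<in> prob_measures"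
    and eq: "\<And>U. open U \<Longrightarrow> emeasure \<mu> U = emeasure \<nu> U"
  shows "\<mu> = \<nu>"
proof (rule measure_eqI_generator_eq[where E="{U. open U}" and \<Omega>=UNIV and A="\<lambda>_. UNIV"])
  interpret \<mu>: prob_space \<mu> using prob_measuresD[OF \<mu>] by blast
  show "emeasure \<mu> UNIV \<noteq> \<infinity>" for i :: nat by simp
qed (use prob_measuresD[OF \<mu>] prob_measuresD[OF \<nu>] eq in \<open>auto simp: Int_stable_def borel_def\<close>)

text \<open>Distance zero equates the integrals of bounded Lipschitz functions. Truncated multiples
  of the distance to the complement increase to the indicator of an open set, and open sets
  determine the measure.\<close>

lemma wasserstein_eq_0_imp_eq:
  fixes \<mu> \<nu> :: "'a::{metric_space,second_countable_topology} measure"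
  assumes W: "wasserstein \<mu> \<nu> = 0"
  shows "\<mu> = \<nu>"
proof (rule prob_measures_eqI_open)
  show \<mu>: "\<mu> \<in> prob_measures" and \<nu>: "\<nu> \<in> prob_measures"
    using wasserstein_finite_prob_measures[of \<mu> \<nu>] W by auto
  fix U :: "'a set" assume U: "open U"
  show "emeasure \<mu> U = emeasure \<nu> U"
  \<comment> \<open>\<open>infdist\<close> to the empty set is 0 by convention, so for
    \<open>U = UNIV\<close> the functions \<open>f n\<close> below would vanish instead of
    approaching the indicator.\<close>
  proof (cases "U = UNIV")
    case True
    then show ?thesis
      using prob_measuresD[OF \<mu>] prob_measuresD[OF \<nu>] prob_space.emeasure_space_1 by metis
  next
    case False
    define f where "f n x = min 1 (real n * infdist x (- U))" for n x
    have f01: "0 \<le> f n x" "f n x \<le> 1" for n x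
      by (auto simp: f_def infdist_nonneg)
    have m [measurable]: "f n \<in> borel_measurable borel" for n
      unfolding f_def by (intro borel_measurable_continuous_onI continuous_intros)
    have lip: "\<bar>f n x - f n y\<bar> \<le> real n * dist x y" for n x y
    proof -
      have "\<bar>f n x - f n y\<bar> \<le> \<bar>real n * infdist x (- U) - real n * infdist y (- U)\<bar>"
        unfolding f_def by linarith
      also have "\<dots> = real n * \<bar>infdist x (- U) - infdist y (- U)\<bar>"
        by (simp add: right_diff_distrib[symmetric] abs_mult)
      also have "\<dots> \<le> real n * dist x y"
        by (intro mult_left_mono infdist_triangle_abs) auto
      finally show ?thesis .
    qed
    have lim: "(\<lambda>n. f n x) \<longlonglongrightarrow> indicator U x" for x
    proof (cases "x \<in> U")
      case True
      then have "infdist x (- U) > 0"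
        using in_closed_iff_infdist_zero[of "- U" x] U False infdist_nonneg[of x "- U"] by (auto simp: less_le)
      then obtain k where k: "1 < real k * infdist x (- U)"
        using reals_Archimedean3 by blast
      have "f n x = 1" if "n \<ge> k" for n
      proof -
        have "real k * infdist x (- U) \<le> real n * infdist x (- U)"
          using that by (intro mult_right_mono) (auto simp: infdist_nonneg)
        with k show ?thesis by (simp add: f_def)
      qed
      then have "eventually (\<lambda>n. f n x = 1) sequentially"
        by (auto simp: eventually_sequentially)
      then show ?thesis using True by (auto intro: tendsto_eventually)
    qed (simp add: f_def)
    have conv: "(\<lambda>n. integral\<^sup>L \<rho> (f n)) \<longlonglongrightarrow> measure \<rho> U" if \<rho>: "\<rho> \<in> prob_measures" for \<rho>
    proof -
      interpret prob_space \<rho> using prob_measuresD[OF \<rho>] by blast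
      have [simp]: "sets \<rho> = sets borel" using prob_measuresD[OF \<rho>] by blast
      have [measurable]: "f n \<in> borel_measurable \<rho>" for n
        by (simp add: measurable_cong_sets[of \<rho> borel])
      have [measurable]: "U \<in> sets \<rho>" using U by simp
      have "(\<lambda>n. integral\<^sup>L \<rho> (f n)) \<longlonglongrightarrow> integral\<^sup>L \<rho> (indicator U)"
        using lim f01 by (intro integral_dominated_convergence[where w="\<lambda>_. 1"]) (auto simp: abs_le_iff)
      then show ?thesis by (simp add: prob_measuresD[OF \<rho>])
    qed
    have "integral\<^sup>L \<mu> (f n) = integral\<^sup>L \<nu> (f n)" for n
      using wasserstein_integral_diff_le[of \<mu> \<nu> 0 "f n" "real n" 1] lip f01 W by (simp add: abs_le_iff)
    then have "measure \<mu> U = measure \<nu> U"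
      using conv[OF \<mu>] conv[OF \<nu>] LIMSEQ_unique by simp
    then show ?thesis
      using prob_measuresD[OF \<mu>] prob_measuresD[OF \<nu>] by (metis finite_measure.emeasure_eq_measure prob_space.finite_measure)
  qed
qed

section \<open>Measures carried by a fixed ball\<close>

text \<open>Stated almost surely rather than through \<open>supp\<close>, so that a push-forward
  inherits the bound pointwise and no closure of an image has to be taken.\<close>

definition ball_measures :: "real \<Rightarrow> 'a::real_normed_vector measure set" where
  "ball_measures R = {\<mu> \<in> prob_measures. AE x in \<mu>. norm x \<le> R}"

lemma ball_measuresD:
  assumes "\<mu> \<in> ball_measures R"
  shows "\<mu> \<in> prob_measures" "AE x in \<mu>. norm x \<le> R" "prob_space \<mu>" "sets \<mu> = sets borel" "space \<mu> = UNIV"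
  using assms prob_measuresD[of \<mu>] by (auto simp: ball_measures_def)

lemma ball_measures_mono: "\<mu> \<in> ball_measures R \<Longrightarrow> R \<le> R' \<Longrightarrow> \<mu> \<in> ball_measures R'"
  by (auto simp: ball_measures_def elim!: AE_mp)

lemma distr_in_ball_measures:
  fixes f :: "'b \<Rightarrow> 'a::{real_normed_vector,second_countable_topology}"
  assumes "prob_space M" "f \<in> borel_measurable M" "AE x in M. norm (f x) \<le> R"
  shows "distr M borel f \<in> ball_measures R"
  using assms by (simp add: ball_measures_def distr_in_prob_measures AE_distr_iff)

text \<open>The truncated excess of the norm over \<open>R\<close> is bounded, 1-Lipschitz and zero
  exactly on the closed ball; its integral vanishes along the sequence and hence in the
  limit.\<close>

lemma ball_measures_wasserstein_closed:
  fixes \<mu> :: "'a::{real_normed_vector,second_countable_topology} measure"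
  assumes mem: "\<And>n. \<mu>s n \<in> ball_measures R" and lim: "(\<lambda>n. wasserstein (\<mu>s n) \<mu>) \<longlonglongrightarrow> 0"
  shows "\<mu> \<in> ball_measures R"
proof -
  have small: "\<exists>n. wasserstein (\<mu>s n) \<mu> < ennreal e" if "e > 0" for e
    using order_tendstoD(2)[OF lim, of "ennreal e"] that by (auto simp: eventually_sequentially)
  from small[of 1] have \<mu>: "\<mu> \<in> prob_measures"
    using wasserstein_finite_prob_measures(2)[of "\<mu>s _" \<mu>] by (metis ennreal_less_top infinity_ennreal_def less_trans zero_less_one)
  interpret prob_space \<mu> using prob_measuresD[OF \<mu>] by blast
  define f :: "'a \<Rightarrow> real" where "f x = min 1 (max 0 (norm x - R))" for x
  have f01: "0 \<le> f x" "f x \<le> 1" for x by (auto simp: f_def)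
  have lip: "\<bar>f x - f y\<bar> \<le> 1 * dist x y" for x y
    using norm_triangle_ineq3[of x y] unfolding f_def dist_norm by linarith
  have [measurable]: "f \<in> borel_measurable \<mu>"
    unfolding measurable_cong_sets[OF prob_measuresD(2)[OF \<mu>] refl] f_def by measurable
  have z: "integral\<^sup>L (\<mu>s n) f = 0" for n
    using ball_measuresD[OF mem[of n]] by (intro integral_eq_zero_AE) (auto simp: f_def elim!: AE_mp)
  have "\<bar>integral\<^sup>L \<mu> f\<bar> \<le> e" if e: "e > 0" for e
  proof -
    obtain n where "wasserstein (\<mu>s n) \<mu> < ennreal e" using small[OF e] by blast
    then show ?thesis
      using wasserstein_integral_diff_le[of "\<mu>s n" \<mu> e f 1 1] e lip f01 z by (simp add: abs_le_iff)
  qed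
  then have "integral\<^sup>L \<mu> f = 0"
    using field_le_epsilon[of "\<bar>integral\<^sup>L \<mu> f\<bar>" 0] by simp
  moreover have "integrable \<mu> f"
    by (rule integrable_bounded[of f 1]) (use f01 in \<open>auto simp: abs_le_iff intro: order_trans[of _ 0]\<close>)
  ultimately have "AE x in \<mu>. f x = 0"
    using integral_nonneg_eq_0_iff_AE[of \<mu> f] f01(1) by blast
  then have "AE x in \<mu>. norm x \<le> R"
    by (rule AE_mp) (auto simp: f_def min_def max_def split: if_splits)
  then show ?thesis using \<mu> by (simp add: ball_measures_def)
qed

section \<open>Compactness\<close>

text \<open>A coordinate of Schoenberg's curve is built from \<open>wave\<close>, which reads off the ternary
  digits of points of the Cantor set.  The curve is a continuous left inverse of a Borel map of
  the cube into the line, so that Helly's and Skorohod's theorems on the line transfer to the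
  cube.\<close>

definition wave :: "real \<Rightarrow> real" where
  "wave x = max 0 (min 1 (1/2 - cos (pi * x)))"

lemma wave_periodic: "wave (2 * of_int z + x) = wave x"
proof -
  have "cos (pi * (2 * of_int z + x)) = cos ((2 * pi) * of_int z + pi * x)"
    by (simp add: algebra_simps)
  also have "\<dots> = cos (pi * x)"
    by (simp only: cos_add cos_int_2pin sin_int_2pin)
  finally show ?thesis by (simp add: wave_def)
qed

text \<open>The shift 1/2 in \<open>wave\<close> is matched to the values 1/2 and -1/2 of the cosine
  at pi/3 and 2 pi/3: \<open>wave\<close> is constant on the two outer thirds of the unit interval,
  where the leading ternary digit of a point of the Cantor set is decided.\<close>

lemma wave_0:
  assumes "0 \<le> x" "x \<le> 1/3"
  shows "wave x = 0"
proof -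
  have "cos (pi/3) \<le> cos (pi * x)"
    using assms by (intro cos_monotone_0_pi_le) (auto simp: field_simps)
  then show ?thesis by (simp add: wave_def cos_60)
qed

lemma wave_1:
  assumes "2/3 \<le> x" "x \<le> 1"
  shows "wave x = 1"
proof -
  have "cos (pi * x) \<le> cos (2 * pi/3)"
    using assms by (intro cos_monotone_0_pi_le) (auto simp: field_simps)
  then show ?thesis by (simp add: wave_def cos_120)
qed

text \<open>The point of the Cantor set with ternary digits \<open>2 * a m\<close>. Avoiding the
  digit 1 leaves the middle third free for the transition of \<open>wave\<close> from 0 to
  1.\<close>

definition cantor_point :: "(nat \<Rightarrow> real) \<Rightarrow> real" where
  "cantor_point a = (\<Sum>m. 2 * a m / 3 ^ Suc m)"

context
  fixes a :: "nat \<Rightarrow> real" assumes a01: "\<And>m. a m = 0 \<or> a m = 1"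
begin

lemma summable_cantor_point: "summable (\<lambda>m. 2 * a (m + k) / 3 ^ Suc m)"
proof (rule summable_comparison_test')
  show "summable (\<lambda>m. 2/3 * (1/3::real) ^ m)" by (intro summable_mult summable_geometric) simp
  show "norm (2 * a (m + k) / 3 ^ Suc m) \<le> 2/3 * (1/3) ^ m" if "m \<ge> 0" for m
    using a01[of "m + k"] by (auto simp: power_divide)
qed

lemma cantor_point_bounds: "0 \<le> cantor_point (\<lambda>m. a (m + k))" "cantor_point (\<lambda>m. a (m + k)) \<le> 1"
proof -
  show "0 \<le> cantor_point (\<lambda>m. a (m + k))"
    unfolding cantor_point_def using a01
    by (intro suminf_nonneg summable_cantor_point) (metis divide_nonneg_nonneg mult_nonneg_nonneg order.refl zero_le_numeral zero_le_one zero_le_power)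
  have s: "(\<lambda>m. 2/3 * (1/3::real) ^ m) sums (2/3 * (1 / (1 - 1/3)))"
    by (intro sums_mult geometric_sums) simp
  have "cantor_point (\<lambda>m. a (m + k)) \<le> (\<Sum>m. 2/3 * (1/3::real) ^ m)"
    unfolding cantor_point_def
  proof (intro suminf_le summable_cantor_point sums_summable[OF s])
    show "2 * a (m + k) / 3 ^ Suc m \<le> 2/3 * (1/3) ^ m" for m
      using a01[of "m + k"] by (auto simp: power_divide)
  qed
  also have "\<dots> = 1" using sums_unique[OF s] by simp
  finally show "cantor_point (\<lambda>m. a (m + k)) \<le> 1" .
qed

lemma cantor_point_shift:
  "3 * cantor_point (\<lambda>m. a (m + k)) = 2 * a k + cantor_point (\<lambda>m. a (m + Suc k))"
proof -
  have "(\<Sum>m. 2 * a (Suc m + k) / 3 ^ Suc (Suc m)) = cantor_point (\<lambda>m. a (m + k)) - 2 * a k / 3"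
    using suminf_split_head[OF summable_cantor_point[of k]] by (simp add: cantor_point_def)
  moreover have "(\<Sum>m. 2 * a (Suc m + k) / 3 ^ Suc (Suc m)) = 1/3 * cantor_point (\<lambda>m. a (m + Suc k))"
    unfolding cantor_point_def
    by (subst suminf_mult[OF summable_cantor_point, symmetric]) (simp add: field_simps)
  ultimately show ?thesis by simp
qed

text \<open>Multiplication by \<open>3 ^ k\<close> moves the first \<open>k\<close> digits into an
  integer part that is even because every digit is, and \<open>wave\<close> has period 2. The digit
  that comes next decides in which outer third the remainder lies.\<close>

lemma wave_cantor_point: "wave (3 ^ k * cantor_point a) = a k"
proof -
  have "\<exists>z::int. 3 ^ k * cantor_point a = 2 * of_int z + cantor_point (\<lambda>m. a (m + k))" for k
  proof (induction k)
    case 0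
    show ?case by (intro exI[of _ 0]) simp
  next
    case (Suc k)
    then obtain z :: int where z: "3 ^ k * cantor_point a = 2 * of_int z + cantor_point (\<lambda>m. a (m + k))" by blast
    obtain j :: int where j: "a k = of_int j" using a01[of k] by (metis of_int_0 of_int_1)
    have "3 ^ Suc k * cantor_point a = 3 * (2 * of_int z + cantor_point (\<lambda>m. a (m + k)))"
      by (simp flip: z)
    then have "3 ^ Suc k * cantor_point a = 2 * of_int (3 * z + j) + cantor_point (\<lambda>m. a (m + Suc k))"
      using cantor_point_shift[of k] j by (simp add: algebra_simps)
    then show ?case by blast
  qed
  then have "wave (3 ^ k * cantor_point a) = wave (cantor_point (\<lambda>m. a (m + k)))"
    by (metis wave_periodic)
  also have "\<dots> = a k"
    using a01[of k] cantor_point_shift[of k] cantor_point_bounds[of "Suc k"] wave_0 wave_1 by fastforce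
  finally show ?thesis .
qed

end

section \<open>Binary digits and the space-filling curve\<close>

definition binary_digit :: "nat \<Rightarrow> real \<Rightarrow> real" where
  "binary_digit m u = of_int (\<lfloor>2 ^ Suc m * u\<rfloor> mod 2)"

lemma binary_digit_01: "binary_digit m u = 0 \<or> binary_digit m u = 1"
proof -
  have "\<lfloor>2 ^ Suc m * u\<rfloor> mod 2 \<in> {0, 1}" by auto
  then show ?thesis unfolding binary_digit_def by force
qed

text \<open>The partial sums are the dyadic truncations of \<open>u\<close>; the bounds on
  \<open>u\<close> make the truncation at level 0 vanish, which starts the induction.\<close>

lemma binary_digits_sums:
  assumes "0 \<le> u" "u < 1"
  shows "(\<lambda>m. binary_digit m u / 2 ^ Suc m) sums u"
proof -
  have ps: "(\<Sum>m<n. binary_digit m u / 2 ^ Suc m) = of_int \<lfloor>2 ^ n * u\<rfloor> / 2 ^ n" for n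
  proof (induction n)
    case 0
    show ?case using assms by simp linarith
  next
    case (Suc n)
    have "\<lfloor>2 ^ Suc n * u\<rfloor> div 2 = \<lfloor>2 ^ Suc n * u / 2\<rfloor>"
      using floor_divide_real_eq_div[of 2 "2 ^ Suc n * u"] by simp
    also have "\<dots> = \<lfloor>2 ^ n * u\<rfloor>" by simp
    finally have "\<lfloor>2 ^ Suc n * u\<rfloor> = 2 * \<lfloor>2 ^ n * u\<rfloor> + \<lfloor>2 ^ Suc n * u\<rfloor> mod 2"
      using mult_div_mod_eq[of 2 "\<lfloor>2 ^ Suc n * u\<rfloor>"] by simp
    then have "real_of_int \<lfloor>2 ^ Suc n * u\<rfloor> = 2 * of_int \<lfloor>2 ^ n * u\<rfloor> + binary_digit n u"
      unfolding binary_digit_def by (metis of_int_add of_int_mult of_int_numeral)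
    then have "of_int \<lfloor>2 ^ Suc n * u\<rfloor> / 2 ^ Suc n = of_int \<lfloor>2 ^ n * u\<rfloor> / 2 ^ n + binary_digit n u / 2 ^ Suc n"
      by (simp only: add_divide_distrib) simp
    then show ?case using Suc by simp
  qed
  have "(\<lambda>n. of_int \<lfloor>2 ^ n * u\<rfloor> / 2 ^ n) \<longlonglongrightarrow> u"
  proof (rule tendsto_sandwich)
    have "(\<lambda>n. (1/2::real) ^ n) \<longlonglongrightarrow> 0" by (intro LIMSEQ_power_zero) simp
    then have "(\<lambda>n. u - (1/2::real) ^ n) \<longlonglongrightarrow> u - 0" by (intro tendsto_diff tendsto_const)
    then show "(\<lambda>n. u - (1/2::real) ^ n) \<longlonglongrightarrow> u" by simp
    show "\<forall>\<^sub>F n in sequentially. u - (1/2) ^ n \<le> of_int \<lfloor>2 ^ n * u\<rfloor> / 2 ^ n"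
    proof (intro always_eventually allI)
      fix n :: nat
      have "2 ^ n * u - 1 \<le> of_int \<lfloor>2 ^ n * u\<rfloor>" by linarith
      then have "(2 ^ n * u - 1) / 2 ^ n \<le> of_int \<lfloor>2 ^ n * u\<rfloor> / 2 ^ n" by (intro divide_right_mono) auto
      then show "u - (1/2) ^ n \<le> of_int \<lfloor>2 ^ n * u\<rfloor> / 2 ^ n" by (simp add: diff_divide_distrib power_divide)
    qed
    show "\<forall>\<^sub>F n in sequentially. of_int \<lfloor>2 ^ n * u\<rfloor> / 2 ^ n \<le> u"
      by (intro always_eventually allI) (simp add: divide_le_eq mult.commute[of u])
  qed (rule tendsto_const)
  then show ?thesis unfolding sums_def ps .
qed

definition curve :: "real \<Rightarrow> real ^ 'd::finite" where
  "curve y = (\<chi> j. \<Sum>i. wave (3 ^ prod_encode (i, to_nat j) * y) / 2 ^ Suc i)"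

text \<open>The binary digits of all coordinates are interleaved into one digit sequence. A number
  \<open>k\<close> that is not the code of a coordinate also stores a digit, which
  \<open>curve\<close> does not read.\<close>

definition curve_inverse :: "real ^ 'd::finite \<Rightarrow> real" where
  "curve_inverse x = cantor_point (\<lambda>m. case prod_decode m of (i, k) \<Rightarrow> binary_digit i (x $ from_nat k))"

lemma curve_curve_inverse:
  assumes "\<And>j. 0 \<le> x $ j" "\<And>j. x $ j < 1"
  shows "curve (curve_inverse x) = x"
proof -
  define a where "a m = (case prod_decode m of (i, k) \<Rightarrow> binary_digit i (x $ from_nat k))" for m
  have a01: "a m = 0 \<or> a m = 1" for m
    using binary_digit_01 by (auto simp: a_def split: prod.split)
  from wave_cantor_point[of a, OF a01]
  have "wave (3 ^ prod_encode (i, to_nat j) * cantor_point a) = binary_digit i (x $ j)" for i j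
    by (simp add: a_def)
  then show ?thesis
    using sums_unique[OF binary_digits_sums, of "x $ _"] assms
    by (simp add: curve_def curve_inverse_def a_def[abs_def, symmetric] vec_eq_iff)
qed

lemma curve_inverse_measurable [measurable]: "(curve_inverse :: real ^ 'd::finite \<Rightarrow> real) \<in> borel_measurable borel"
proof -
  have "(\<lambda>x::real^'d. binary_digit i (x $ j)) \<in> borel_measurable borel" for i and j :: 'd
    unfolding binary_digit_def by measurable
  then have [measurable]: "(\<lambda>x::real^'d. case prod_decode m of (i, k) \<Rightarrow> binary_digit i (x $ from_nat k)) \<in> borel_measurable borel" for m
    by (cases "prod_decode m") auto
  show ?thesis
    unfolding curve_inverse_def[abs_def] cantor_point_def by measurable
qed

lemma curve_inverse_bounds: "0 \<le> curve_inverse x" "curve_inverse x \<le> 1"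
  using cantor_point_bounds[of "\<lambda>m. case prod_decode m of (i, k) \<Rightarrow> binary_digit i (x $ from_nat k)" 0] binary_digit_01
  by (auto simp: curve_inverse_def split: prod.split)

lemma continuous_curve: "continuous_on UNIV (curve :: real \<Rightarrow> real ^ 'd::finite)"
proof -
  have "continuous_on UNIV (\<lambda>y. \<Sum>i. wave (3 ^ prod_encode (i, to_nat j) * y) / 2 ^ Suc i)" for j :: 'd
  proof (rule uniform_limit_theorem[where F=sequentially])
    show "uniform_limit UNIV (\<lambda>n y. \<Sum>i<n. wave (3 ^ prod_encode (i, to_nat j) * y) / 2 ^ Suc i)
        (\<lambda>y. \<Sum>i. wave (3 ^ prod_encode (i, to_nat j) * y) / 2 ^ Suc i) sequentially"
    proof (rule Weierstrass_m_test)
      show "norm (wave (3 ^ prod_encode (i, to_nat j) * y) / 2 ^ Suc i) \<le> (1/2) ^ Suc i" for i y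
        by (auto simp: wave_def power_divide field_simps)
      show "summable (\<lambda>i. (1/2::real) ^ Suc i)" by (subst summable_Suc_iff) (simp add: summable_geometric)
    qed
    show "\<forall>\<^sub>F n in sequentially. continuous_on UNIV (\<lambda>y. \<Sum>i<n. wave (3 ^ prod_encode (i, to_nat j) * y) / 2 ^ Suc i)"
      unfolding wave_def by (intro always_eventually allI continuous_intros) auto
  qed simp
  then show ?thesis
    unfolding curve_def[abs_def] by (intro continuous_on_vec_lambda)
qed

lemma curve_bounded: "norm (curve y :: real ^ 'd::finite) \<le> real CARD('d)"
proof -
  have w: "\<bar>wave x\<bar> \<le> 1" for x by (simp add: wave_def)
  have s: "(\<lambda>i. (1/2::real) ^ Suc i) sums 1"
    using power_half_series by simp
  have "\<bar>curve y $ j\<bar> \<le> 1" for j :: 'd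
  proof -
    have le: "norm (wave (3 ^ prod_encode (i, to_nat j) * y) / 2 ^ Suc i) \<le> (1/2) ^ Suc i" for i
      using w by (simp add: power_divide divide_right_mono)
    have "norm (\<Sum>i. wave (3 ^ prod_encode (i, to_nat j) * y) / 2 ^ Suc i) \<le> (\<Sum>i. (1/2::real) ^ Suc i)"
      by (rule norm_suminf_le[OF le sums_summable[OF s]])
    then show ?thesis using sums_unique[OF s] by (simp add: curve_def)
  qed
  then have "(\<Sum>j\<in>UNIV. \<bar>(curve y :: real ^ 'd) $ j\<bar>) \<le> (\<Sum>j\<in>(UNIV::'d set). 1)"
    by (intro sum_mono) auto
  then show ?thesis
    using norm_le_l1_cart[of "curve y :: real ^ 'd"] by simp
qed

text \<open>Skorohod's representation turns weak convergence on the line into pointwise convergence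
  of random variables. The limit is only ever taken inside \<open>\<phi>\<close>, which is
  continuous and bounded, so dominated convergence gives convergence in the Wasserstein distance
  directly, although \<open>\<psi>\<close> is merely Borel.\<close>

theorem ball_measures_seq_compact:
  fixes \<mu> :: "nat \<Rightarrow> (real ^ 'd::finite) measure"
  assumes mem: "\<And>n. \<mu> n \<in> ball_measures R"
  obtains r \<nu> where "strict_mono r" "\<nu> \<in> ball_measures R" "(\<lambda>n. wasserstein (\<mu> (r n)) \<nu>) \<longlonglongrightarrow> 0"
proof -
  \<comment> \<open>The summand 1 keeps the rescaled coordinates strictly below 1: the digits of 1
    as computed by \<open>binary_digit\<close> are all 0.\<close>
  define h where "h = 2 * \<bar>R\<bar> + 1"
  have h: "h > 0" by (simp add: h_def)
  define \<psi> where "\<psi> x = curve_inverse ((1/h) *\<^sub>R (x + (\<chi> j. \<bar>R\<bar>)))" for x :: "real ^ 'd"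
  define \<phi> :: "real \<Rightarrow> real ^ 'd" where "\<phi> y = h *\<^sub>R curve y - (\<chi> j. \<bar>R\<bar>)" for y :: real
  have inv: "\<phi> (\<psi> x) = x" if "norm x \<le> R" for x :: "real ^ 'd"
  proof -
    have "\<bar>x $ j\<bar> \<le> \<bar>R\<bar>" for j
      using component_le_norm_cart[of x j] that by linarith
    then have "- \<bar>R\<bar> \<le> x $ j" "x $ j \<le> \<bar>R\<bar>" for j
      by (auto simp: abs_le_iff minus_le_iff)
    then have "0 \<le> (x $ j + \<bar>R\<bar>) / h" "(x $ j + \<bar>R\<bar>) / h < 1" for j
      using h by (auto simp: h_def divide_less_eq intro!: divide_nonneg_pos) (smt (verit))+
    then have "curve (\<psi> x) = (1/h) *\<^sub>R (x + (\<chi> j. \<bar>R\<bar>))"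
      unfolding \<psi>_def by (intro curve_curve_inverse) auto
    then show ?thesis using h by (simp add: \<phi>_def)
  qed
  have [measurable]: "\<psi> \<in> borel_measurable borel" unfolding \<psi>_def by measurable
  have c\<phi>: "continuous_on UNIV (\<phi> :: real \<Rightarrow> real ^ 'd)"
    unfolding \<phi>_def by (intro continuous_intros continuous_curve)
  then have [measurable]: "(\<phi> :: real \<Rightarrow> real ^ 'd) \<in> borel_measurable borel"
    by (rule borel_measurable_continuous_onI)
  define B where "B = h * real CARD('d) + norm (\<chi> j::'d. \<bar>R\<bar>)"
  have bd: "norm (\<phi> y :: real ^ 'd) \<le> B" for y
  proof -
    have "norm (\<phi> y :: real ^ 'd) \<le> norm (h *\<^sub>R (curve y :: real ^ 'd)) + norm (\<chi> j::'d. \<bar>R\<bar>)"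
      unfolding \<phi>_def by (rule norm_triangle_ineq4)
    then show ?thesis using h curve_bounded[of y, where 'd='d] mult_left_mono[of _ _ h]
      unfolding B_def by (smt (verit) norm_scaleR)
  qed
  define \<rho> where "\<rho> n = distr (\<mu> n) borel \<psi>" for n
  have m\<psi> [measurable]: "\<psi> \<in> borel_measurable (\<mu> n)" for n
    by (simp add: measurable_cong_sets[OF ball_measuresD(4)[OF mem] refl])
  have \<rho>: "real_distribution (\<rho> n)" for n
    unfolding \<rho>_def by (intro prob_space.real_distribution_distr ball_measuresD[OF mem] m\<psi>)
  \<comment> \<open>The lower bound is weakened from 0 to -1 because tightness is phrased with
    intervals that are open on the left.\<close>
  have \<psi>01: "-1 < \<psi> x" "\<psi> x \<le> 1" for x
    using curve_inverse_bounds[of "(1/h) *\<^sub>R (x + (\<chi> j. \<bar>R\<bar>))"] by (auto simp: \<psi>_def)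
  have "tight \<rho>"
    unfolding tight_def
  proof (intro conjI allI impI \<rho>)
    fix \<epsilon> :: real assume "\<epsilon> > 0"
    have "measure (\<rho> n) {-1<..1} = 1" for n
    proof -
      have "measure (\<rho> n) {-1<..1} = measure (\<mu> n) (\<psi> -` {-1<..1} \<inter> space (\<mu> n))"
        unfolding \<rho>_def by (rule measure_distr) auto
      also have "\<psi> -` {-1<..1} = UNIV"
        using \<psi>01 by force
      finally show ?thesis
        using prob_space.prob_space[OF ball_measuresD(3)[OF mem]] by simp
    qed
    with \<open>\<epsilon> > 0\<close> show "\<exists>a b. a < b \<and> (\<forall>n. 1 - \<epsilon> < measure (\<rho> n) {a<..b})"
      by (intro exI[of _ "-1"] exI[of _ 1]) simp
  qed
  from tight_imp_convergent_subsubsequence[OF this, of "\<lambda>x. x"]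
  obtain r M where r: "strict_mono r" and M: "real_distribution M" and w: "weak_conv_m (\<lambda>n. \<rho> (r n)) M"
    by (auto simp: strict_mono_def comp_def)
  from Skorohod[of "\<lambda>n. \<rho> (r n)" M, OF \<rho> M w] obtain \<Omega> :: "real measure" and Ys Y where
    \<Omega>: "prob_space \<Omega>" and [measurable]: "\<And>n. Ys n \<in> borel_measurable \<Omega>" "Y \<in> measurable \<Omega> lborel"
    and d: "\<And>n. distr \<Omega> borel (Ys n) = \<rho> (r n)" and lim: "\<And>x. x \<in> space \<Omega> \<Longrightarrow> (\<lambda>n. Ys n x) \<longlonglongrightarrow> Y x"
    by blast
  interpret \<Omega>: prob_space \<Omega> by fact
  have [measurable]: "Y \<in> borel_measurable \<Omega>"
    using \<open>Y \<in> measurable \<Omega> lborel\<close> by (simp add: measurable_cong_sets[OF refl sets_lborel])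
  define \<nu> where "\<nu> = distr \<Omega> borel (\<lambda>x. \<phi> (Y x) :: real ^ 'd)"
  \<comment> \<open>\<open>\<phi>\<close> inverts \<open>\<psi>\<close> only on the ball of radius
    \<open>R\<close>, which carries the measure; hence the almost-everywhere form of the
    congruence.\<close>
  have \<mu>r: "\<mu> (r n) = distr \<Omega> borel (\<lambda>x. \<phi> (Ys n x))" for n
  proof -
    note \<mu> = ball_measuresD[OF mem[of "r n"]]
    have "distr \<Omega> borel (\<lambda>x. \<phi> (Ys n x) :: real ^ 'd) = distr (distr \<Omega> borel (Ys n)) borel \<phi>"
      by (subst distr_distr) (auto simp: comp_def)
    also have "\<dots> = distr (\<mu> (r n)) borel (\<lambda>x. \<phi> (\<psi> x))"
      unfolding d \<rho>_def by (subst distr_distr) (auto simp: comp_def)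
    also have "\<dots> = distr (\<mu> (r n)) borel (\<lambda>x. x)"
    proof (rule distr_cong_AE)
      show "AE x in \<mu> (r n). \<phi> (\<psi> x) = x" using \<mu>(2) by (rule AE_mp) (auto simp: inv)
      show "(\<lambda>x. \<phi> (\<psi> x)) \<in> borel_measurable (\<mu> (r n))" by measurable
      show "(\<lambda>x. x) \<in> borel_measurable (\<mu> (r n))" by (rule measurable_ident_sets[OF \<mu>(4)])
    qed simp_all
    also have "\<dots> = \<mu> (r n)" by (rule distr_id2) (simp add: \<mu>(4))
    finally show ?thesis by simp
  qed
  have le: "wasserstein (\<mu> (r n)) \<nu> \<le> (\<integral>\<^sup>+x. ennreal (norm (\<phi> (Y x) - \<phi> (Ys n x))) \<partial>\<Omega>)" for n
    unfolding \<mu>r \<nu>_def dist_norm[symmetric] dist_commute[of "\<phi> (Y _)"]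
    by (rule wasserstein_coupling_le[OF \<Omega>]) auto
  have conv0: "(\<lambda>n. \<integral>\<^sup>+x. ennreal (norm (\<phi> (Y x) - \<phi> (Ys n x))) \<partial>\<Omega>) \<longlonglongrightarrow> 0"
  proof (rule nn_integral_dominated_convergence_norm[where w="\<lambda>_. B"])
    show "AE x in \<Omega>. (\<lambda>j. \<phi> (Ys j x)) \<longlonglongrightarrow> \<phi> (Y x)"
      using lim c\<phi> by (intro AE_I2) (auto simp: continuous_on_eq_continuous_at intro: isCont_tendsto_compose)
  qed (use bd in \<open>auto simp: \<Omega>.emeasure_space_1\<close>)
  have conv: "(\<lambda>n. wasserstein (\<mu> (r n)) \<nu>) \<longlonglongrightarrow> 0"
    by (rule tendsto_sandwich[OF always_eventually always_eventually tendsto_const conv0]) (simp_all add: le)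
  show ?thesis
    by (rule that[OF r _ conv]) (rule ball_measures_wasserstein_closed[OF mem conv])
qed

section \<open>Ascoli's theorem for curves of measures\<close>

lemma ennreal_tendsto_0I:
  fixes f :: "'a \<Rightarrow> ennreal"
  assumes "\<And>e::real. e > 0 \<Longrightarrow> eventually (\<lambda>x. f x \<le> ennreal e) F"
  shows "(f \<longlongrightarrow> 0) F"
proof (rule order_tendstoI)
  fix a :: ennreal assume "0 < a"
  then obtain b where b: "0 < b" "b < a" using dense by blast
  then obtain e where e: "b = ennreal e" "e > 0" by (cases b) (auto simp: top_unique)
  show "\<forall>\<^sub>F x in F. f x < a"
    using assms[OF e(2)] by (rule eventually_mono) (use b e in auto)
qed simp

lemma ennreal_tendsto_0D:
  fixes f :: "'a \<Rightarrow> ennreal"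
  assumes "(f \<longlongrightarrow> 0) F" "e > 0"
  shows "eventually (\<lambda>x. f x < ennreal e) F"
  using order_tendstoD(2)[OF assms(1), of "ennreal e"] assms(2) by simp

lemma wasserstein_triangle_real:
  fixes \<mu> \<nu> \<rho> :: "'a::{metric_space,second_countable_topology} measure"
  assumes "wasserstein \<mu> \<nu> \<le> ennreal a" "wasserstein \<nu> \<rho> \<le> ennreal b" "0 \<le> a" "0 \<le> b"
  shows "wasserstein \<mu> \<rho> \<le> ennreal (a + b)"
  using wasserstein_triangle[of \<mu> \<rho> \<nu>] add_mono[OF assms(1,2)] assms(3,4)
  by (simp add: ennreal_plus order_trans)

text \<open>A diagonal subsequence converges at a countable dense set of times; the common Lipschitz
  constant makes it Cauchy uniformly in time, and only then is the limit curve chosen.\<close>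

lemma wasserstein_equi_Lipschitz_subseq:
  fixes c :: "nat \<Rightarrow> real \<Rightarrow> (real ^ 'd::finite) measure"
  assumes T: "T > 0" and M: "0 \<le> M"
    and mem: "\<And>n t. t \<in> {0..T} \<Longrightarrow> c n t \<in> ball_measures R"
    and lip: "\<And>n s t. s \<in> {0..T} \<Longrightarrow> t \<in> {0..T} \<Longrightarrow> wasserstein (c n s) (c n t) \<le> ennreal (M * \<bar>s - t\<bar>)"
  obtains r \<mu> where "strict_mono (r :: nat \<Rightarrow> nat)" "\<And>t. t \<in> {0..T} \<Longrightarrow> \<mu> t \<in> ball_measures R"
    "(\<lambda>k. SUP t\<in>{0..T}. wasserstein (c (r k) t) (\<mu> t)) \<longlonglongrightarrow> 0"
proof -
  \<comment> \<open>Enumerates all fractions of \<open>T\<close> through pairs; the denominator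
    \<open>Suc j\<close> cannot vanish, and \<open>min 1\<close> keeps the times within
    \<open>{0..T}\<close>.\<close>
  define q where "q k = T * (case prod_decode k of (i, j) \<Rightarrow> min 1 (real i / real (Suc j)))" for k
  have q: "q k \<in> {0..T}" for k
    using T by (auto simp: q_def mult_le_cancel_left split: prod.split)
  define P where "P n s \<longleftrightarrow> (\<exists>\<nu>. (\<lambda>k. wasserstein (c (s k) (q n)) \<nu>) \<longlonglongrightarrow> 0)" for n and s :: "nat \<Rightarrow> nat"
  interpret subseqs P
  proof
    fix n and s :: "nat \<Rightarrow> nat"
    obtain r \<nu> where "strict_mono r" "(\<lambda>k. wasserstein (c (s (r k)) (q n)) \<nu>) \<longlonglongrightarrow> 0"
      using ball_measures_seq_compact[of "\<lambda>k. c (s k) (q n)" R] mem[OF q] by metis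
    then show "\<exists>r'. strict_mono r' \<and> P n (s \<circ> r')" by (auto simp: P_def)
  qed
  define r where "r = diagseq"
  have r: "strict_mono r" unfolding r_def by (rule subseq_diagseq)
  have "P k (diagseq \<circ> ((+) (Suc k)))" for k
  proof (rule diagseq_holds)
    fix r s :: "nat \<Rightarrow> nat" and n assume "strict_mono r" "P n s"
    then show "P n (s \<circ> r)"
      unfolding P_def using LIMSEQ_subseq_LIMSEQ[of "\<lambda>k. wasserstein (c (s k) (q n)) _" 0 r]
      by (auto simp: comp_def)
  qed
  \<comment> \<open>The diagonal sequence is a subsequence of the \<open>n\<close>-th one only from
    index \<open>Suc n\<close> on; the next step removes this offset.\<close>
  then have *: "\<exists>\<nu>. (\<lambda>k. wasserstein (c (r (Suc n + k)) (q n)) \<nu>) \<longlonglongrightarrow> 0" for n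
    by (simp add: P_def r_def comp_def)
  have "\<exists>\<nu>. (\<lambda>k. wasserstein (c (r k) (q n)) \<nu>) \<longlonglongrightarrow> 0" for n
  proof -
    from *[of n] obtain \<nu> where "(\<lambda>k. wasserstein (c (r (Suc n + k)) (q n)) \<nu>) \<longlonglongrightarrow> 0"
      by blast
    then have "(\<lambda>k. wasserstein (c (r (k + Suc n)) (q n)) \<nu>) \<longlonglongrightarrow> 0"
      by (simp only: add.commute[of "Suc n"])
    then show ?thesis by (blast intro: LIMSEQ_offset)
  qed
  then obtain \<nu> where \<nu>: "\<And>n. (\<lambda>k. wasserstein (c (r k) (q n)) (\<nu> n)) \<longlonglongrightarrow> 0" by metis
  \<comment> \<open>Each of the two curves costs \<open>e\<close> for moving from \<open>t\<close>
    to a nearby time \<open>q k\<close> and \<open>e\<close> for convergence at that time, hence the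
    factor 4.\<close>
  have cauchy: "\<exists>N. \<forall>n\<ge>N. \<forall>m\<ge>N. \<forall>t\<in>{0..T}. wasserstein (c (r n) t) (c (r m) t) \<le> ennreal (4 * e)"
    if e: "e > 0" for e
  proof -
    \<comment> \<open>The finite net \<open>I\<close> has mesh \<open>T / real (Suc j)\<close>; this
      choice makes \<open>M\<close> times the mesh at most \<open>e\<close>.\<close>
    obtain j where j: "M * T / e < real j" using reals_Archimedean2 by blast
    define I where "I = (\<lambda>i. prod_encode (i, j)) ` {..Suc j}"
    have "\<forall>\<^sub>F k in sequentially. \<forall>n\<in>I. wasserstein (c (r k) (q n)) (\<nu> n) < ennreal e"
      by (intro eventually_ball_finite ballI ennreal_tendsto_0D \<nu> e) (simp add: I_def)
    then obtain N where N: "\<And>k n. k \<ge> N \<Longrightarrow> n \<in> I \<Longrightarrow> wasserstein (c (r k) (q n)) (\<nu> n) < ennreal e"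
      by (auto simp: eventually_sequentially)
    have near: "\<exists>n\<in>I. M * \<bar>t - q n\<bar> \<le> e" if t: "t \<in> {0..T}" for t
    proof -
      define i where "i = nat \<lfloor>t / T * real (Suc j)\<rfloor>"
      have t0: "0 \<le> t / T * real (Suc j)" "t / T * real (Suc j) \<le> real (Suc j)"
        using t T by (auto simp: divide_le_eq mult_left_le_one_le)
      then have i: "real i \<le> t / T * real (Suc j)" "t / T * real (Suc j) < real i + 1"
        unfolding i_def by linarith+
      then have ij: "i \<le> Suc j" using t0 by linarith
      have "real i / real (Suc j) \<le> 1"
        using ij by (simp add: divide_le_eq del: of_nat_Suc)
      then have qn: "q (prod_encode (i, j)) = T * (real i / real (Suc j))"
        by (simp add: q_def min_absorb2 del: of_nat_Suc)
      have "real i / real (Suc j) \<le> t / T" "t / T < (real i + 1) / real (Suc j)"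
        using i by (simp_all add: divide_le_eq less_divide_eq del: of_nat_Suc)
      then have "T * (real i / real (Suc j)) \<le> T * (t / T)" "T * (t / T) \<le> T * ((real i + 1) / real (Suc j))"
        using T by (blast intro: mult_left_mono less_imp_le)+
      then have "\<bar>t - q (prod_encode (i, j))\<bar> \<le> T / real (Suc j)"
        unfolding qn using T by (simp add: add_divide_distrib distrib_left del: of_nat_Suc)
      then have "M * \<bar>t - q (prod_encode (i, j))\<bar> \<le> M * (T / real (Suc j))"
        using M by (rule mult_left_mono)
      also have "\<dots> \<le> e"
        using j e by (simp add: field_simps)
      finally show ?thesis using ij by (auto simp: I_def)
    qed
    show ?thesis
    proof (intro exI allI impI ballI)
      fix n m t assume nm: "n \<ge> N" "m \<ge> N" and t: "t \<in> {0..T}"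
      from near[OF t] obtain k where k: "k \<in> I" "M * \<bar>t - q k\<bar> \<le> e" by blast
      have 1: "wasserstein (c (r i) t) (c (r i) (q k)) \<le> ennreal e" for i
        using lip[OF t q] k(2) ennreal_leI order_trans by blast
      have "wasserstein (c (r i) t) (\<nu> k) \<le> ennreal (e + e)" if "i \<ge> N" for i
        using wasserstein_triangle_real[OF 1 less_imp_le[OF N[OF that k(1)]]] e by simp
      then have "wasserstein (c (r n) t) (\<nu> k) \<le> ennreal (e + e)" "wasserstein (\<nu> k) (c (r m) t) \<le> ennreal (e + e)"
        using nm by (simp_all add: wasserstein_sym[of "\<nu> k"])
      from wasserstein_triangle_real[OF this] e
      show "wasserstein (c (r n) t) (c (r m) t) \<le> ennreal (4 * e)" by simp
    qed
  qed
  \<comment> \<open>Compactness takes the place of completeness: at each \<open>t\<close> a further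
    subsequence converges, and the uniform Cauchy property makes the whole sequence follow it even
    though \<open>s t\<close> varies with \<open>t\<close>.\<close>
  have "\<exists>\<nu> s. strict_mono s \<and> \<nu> \<in> ball_measures R \<and> (\<lambda>k. wasserstein (c (r (s k)) t) \<nu>) \<longlonglongrightarrow> 0"
    if "t \<in> {0..T}" for t
    using ball_measures_seq_compact[of "\<lambda>k. c (r k) t" R] mem[OF that] by metis
  then obtain \<mu> s where \<mu>: "\<And>t. t \<in> {0..T} \<Longrightarrow> strict_mono (s t :: nat \<Rightarrow> nat)"
    "\<And>t. t \<in> {0..T} \<Longrightarrow> \<mu> t \<in> ball_measures R"
    "\<And>t. t \<in> {0..T} \<Longrightarrow> (\<lambda>k. wasserstein (c (r (s t k)) t) (\<mu> t)) \<longlonglongrightarrow> 0"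
    by metis
  have "(\<lambda>k. SUP t\<in>{0..T}. wasserstein (c (r k) t) (\<mu> t)) \<longlonglongrightarrow> 0"
  proof (rule ennreal_tendsto_0I)
    fix e :: real assume e: "e > 0"
    have "e / 5 > 0" using e by simp
    from cauchy[OF this] obtain N where
      N: "\<And>n m t. n \<ge> N \<Longrightarrow> m \<ge> N \<Longrightarrow> t \<in> {0..T} \<Longrightarrow> wasserstein (c (r n) t) (c (r m) t) \<le> ennreal (4 * (e / 5))"
      by blast
    have "wasserstein (c (r n) t) (\<mu> t) \<le> ennreal e" if n: "n \<ge> N" and t: "t \<in> {0..T}" for n t
    proof -
      have "\<forall>\<^sub>F k in sequentially. wasserstein (c (r (s t k)) t) (\<mu> t) < ennreal (e / 5) \<and> k \<ge> N"
        using e by (intro eventually_conj ennreal_tendsto_0D[OF \<mu>(3)[OF t]] eventually_ge_at_top) simp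
      then obtain k where k: "wasserstein (c (r (s t k)) t) (\<mu> t) < ennreal (e / 5)" "k \<ge> N"
        by (auto simp: eventually_sequentially)
      have "s t k \<ge> N" using seq_suble[OF \<mu>(1)[OF t], of k] k(2) by simp
      from wasserstein_triangle_real[OF N[OF n this t] less_imp_le[OF k(1)]] e
      show ?thesis by (simp add: field_simps)
    qed
    then show "\<forall>\<^sub>F k in sequentially. (SUP t\<in>{0..T}. wasserstein (c (r k) t) (\<mu> t)) \<le> ennreal e"
      unfolding eventually_sequentially by (intro exI[of _ N] allI impI SUP_least)
  qed
  then show ?thesis using that[of r \<mu>] r \<mu>(2) by blast
qed

section \<open>Supports\<close>

lemma closed_supp: "closed (supp \<mu>)"
proof -
  have "- supp \<mu> = \<Union>{U. open U \<and> emeasure \<mu> U = 0}"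
    by (auto simp: supp_def)
  moreover have "open (\<Union>{U. open U \<and> emeasure \<mu> U = 0})"
    by (rule open_Union) auto
  ultimately show ?thesis by (simp add: closed_def)
qed

text \<open>The complement of the support is a union of open null sets, and the Lindelof property
  reduces it to a countable union.\<close>

lemma AE_in_supp:
  fixes \<mu> :: "'a::second_countable_topology measure"
  assumes "\<mu> \<in> prob_measures"
  shows "AE x in \<mu>. x \<in> supp \<mu>"
proof -
  note p = prob_measuresD[OF assms]
  define F where "F = {U. open U \<and> emeasure \<mu> U = 0}"
  have eq: "- supp \<mu> = \<Union>F"
    by (auto simp: supp_def F_def)
  obtain F' where F': "F' \<subseteq> F" "countable F'" "\<Union>F' = \<Union>F"
    by (rule Lindelof[of F]) (auto simp: F_def)
  have "(\<Union>U\<in>F'. U) \<in> null_sets \<mu>"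
    using F' p(2) by (intro null_sets_UN') (auto simp: F_def null_sets_def)
  then have "- supp \<mu> \<in> null_sets \<mu>"
    using F'(3) eq by simp
  then show ?thesis
    by (rule AE_I') auto
qed

text \<open>(H1) is stated with real suprema, whose value on the empty set is unspecified;
  nonemptiness lets a pointwise bound pass to the supremum.\<close>

lemma supp_nonempty:
  fixes \<mu> :: "'a::second_countable_topology measure"
  assumes "\<mu> \<in> prob_measures"
  shows "supp \<mu> \<noteq> {}"
proof
  assume "supp \<mu> = {}"
  then have "AE x in \<mu>. False" using AE_in_supp[OF assms] by simp
  then show False
    using prob_space.prob_space prob_measuresD[OF assms] by (metis prob_space.AE_False)
qed

lemma ball_measures_supp:
  fixes \<mu> :: "'a::euclidean_space measure"
  assumes "\<mu> \<in> ball_measures R"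
  shows "supp \<mu> \<subseteq> cball 0 R" "\<mu> \<in> prob_measures_c"
proof -
  note p = ball_measuresD[OF assms]
  have "open (- cball 0 R :: 'a set)" by auto
  moreover have "emeasure \<mu> (- cball 0 R) = 0"
  proof -
    have "AE x in \<mu>. x \<notin> - cball 0 R" using p(2) by (rule AE_mp) auto
    then have "emeasure \<mu> {x \<in> space \<mu>. \<not> x \<notin> - cball 0 R} = 0"
      using p by (subst (asm) AE_iff_measurable[OF _ refl]) (auto simp: Compl_eq_Diff_UNIV[symmetric])
    then show ?thesis using p(5) by (simp add: Compl_eq)
  qed
  ultimately show "supp \<mu> \<subseteq> cball 0 R"
    unfolding supp_def by (metis (no_types, lifting) ComplI less_irrefl mem_Collect_eq subsetI)
  then have "compact (supp \<mu>)"
    using closed_supp bounded_cball bounded_subset compact_eq_bounded_closed by metis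
  then show "\<mu> \<in> prob_measures_c" using p by (simp add: prob_measures_c_def)
qed

lemma prob_measures_c_ball:
  fixes \<mu> :: "'a::euclidean_space measure"
  assumes "\<mu> \<in> prob_measures_c"
  obtains R where "R \<ge> 0" "\<mu> \<in> ball_measures R"
proof -
  have \<mu>: "\<mu> \<in> prob_measures" and c: "compact (supp \<mu>)" using assms by (auto simp: prob_measures_c_def)
  then obtain R where R: "\<And>x. x \<in> supp \<mu> \<Longrightarrow> norm x \<le> R" "R > 0"
    using compact_imp_bounded bounded_pos by metis
  have "AE x in \<mu>. norm x \<le> R" using AE_in_supp[OF \<mu>] by (rule AE_mp) (use R in auto)
  then show ?thesis using \<mu> R that[of R] by (simp add: ball_measures_def)
qed

section \<open>Lipschitz probability vector fields\<close>

text \<open>The growth constant \<open>C\<close> is a parameter because radii and rates are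
  expressed through it. The constant of (H3) stays under its quantifier, since it depends on a
  radius chosen later.\<close>

locale lipschitz_pvf =
  fixes V :: "'d::finite pvf" and C :: real
  assumes pvf: "is_pvf V"
    and compact_supp: "\<forall>\<mu>\<in>prob_measures_c. V \<mu> \<in> prob_measures_c"
    and C_pos: "C > 0"
    and growth: "\<forall>\<mu>\<in>prob_measures_c. (SUP (x, v)\<in>supp (V \<mu>). norm v) \<le> C * (1 + (SUP x\<in>supp \<mu>. norm x))"
    and lipschitz: "H3 V"
begin

lemma V_props:
  assumes "\<mu> \<in> prob_measures"
  shows "prob_space (V \<mu>)" "sets (V \<mu>) = sets borel" "space (V \<mu>) = UNIV" "distr (V \<mu>) borel fst = \<mu>"
    "fst \<in> borel_measurable (V \<mu>)" "snd \<in> borel_measurable (V \<mu>)"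
proof -
  have "V \<mu> \<in> prob_measures" "distr (V \<mu>) borel fst = \<mu>"
    using pvf assms by (auto simp: is_pvf_def)
  with prob_measuresD[of "V \<mu>"] borel_measurable_fst_snd[of "V \<mu>"]
  show "prob_space (V \<mu>)" "sets (V \<mu>) = sets borel" "space (V \<mu>) = UNIV" "distr (V \<mu>) borel fst = \<mu>"
    "fst \<in> borel_measurable (V \<mu>)" "snd \<in> borel_measurable (V \<mu>)" by auto
qed

lemma V_AE_velocity:
  assumes \<mu>: "\<mu> \<in> ball_measures R"
  shows "AE p in V \<mu>. norm (snd p) \<le> C * (1 + R)"
proof -
  note b = ball_measures_supp[OF \<mu>] and p = ball_measuresD[OF \<mu>]
  have V: "V \<mu> \<in> prob_measures" "compact (supp (V \<mu>))"
    using compact_supp b(2) by (auto simp: prob_measures_c_def)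
  have "(SUP x\<in>supp \<mu>. norm x) \<le> R"
    using b(1) supp_nonempty[OF p(1)] by (intro cSUP_least) auto
  then have le: "(SUP (x, v)\<in>supp (V \<mu>). norm v) \<le> C * (1 + R)"
    using growth b(2) C_pos by (meson add_left_mono mult_left_mono less_imp_le order_trans)
  \<comment> \<open>A real supremum bounds its members only if the set is bounded above; compactness
    of the support of \<open>V \<mu>\<close> provides this.\<close>
  have "compact ((\<lambda>(x, v). norm v) ` supp (V \<mu>))"
    using V(2) by (intro compact_continuous_image) (auto simp: split_beta' intro!: continuous_intros)
  then have bdd: "bdd_above ((\<lambda>(x, v). norm v) ` supp (V \<mu>))"
    by (intro bounded_imp_bdd_above compact_imp_bounded)
  have "norm (snd q) \<le> C * (1 + R)" if "q \<in> supp (V \<mu>)" for q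
    using cSUP_upper[OF that bdd] le by (simp add: split_beta)
  with AE_in_supp[OF V(1)] show ?thesis by (rule_tac AE_mp) auto
qed

lemma V_AE_position:
  assumes \<mu>: "\<mu> \<in> ball_measures R"
  shows "AE p in V \<mu>. norm (fst p) \<le> R"
proof -
  note p = ball_measuresD[OF \<mu>] and v = V_props[OF ball_measuresD(1)[OF \<mu>]]
  have "AE x in distr (V \<mu>) borel fst. norm x \<le> R" unfolding v(4) by (rule p(2))
  then show ?thesis by (rule AE_distrD[OF v(5)])
qed

text \<open>The position marginal of an admissible plan is optimal, so its cost is the Wasserstein
  distance itself; only the velocity cost, an infimum over such plans, needs the slack
  \<open>e\<close>.\<close>

lemma V_plan:
  assumes "R > 0"
  obtains L where "L > 0"
    "\<And>\<mu> \<nu> w e. \<lbrakk>\<mu> \<in> ball_measures R; \<nu> \<in> ball_measures R; wasserstein \<mu> \<nu> \<le> ennreal w; 0 \<le> w; 0 < e\<rbrakk> \<Longrightarrow>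
      \<exists>P\<in>plans (V \<mu>) (V \<nu>). (\<integral>\<^sup>+p. ennreal (dist (fst (fst p)) (fst (snd p))) \<partial>P) \<le> ennreal w \<and>
        (\<integral>\<^sup>+p. ennreal (dist (snd (fst p)) (snd (snd p))) \<partial>P) \<le> ennreal (L * w + e)"
proof -
  \<comment> \<open>(H3) speaks of open balls and \<open>ball_measures\<close> of closed ones, so it
    is applied at radius \<open>R + 1\<close>.\<close>
  have "R + 1 > 0" using assms by simp
  with lipschitz obtain L where L: "L > 0" "\<forall>\<mu>\<in>prob_measures_c. \<forall>\<nu>\<in>prob_measures_c.
     supp \<mu> \<subseteq> ball 0 (R + 1) \<and> supp \<nu> \<subseteq> ball 0 (R + 1) \<longrightarrow>
     fibre_wasserstein (V \<mu>) (V \<nu>) \<le> ennreal L * wasserstein \<mu> \<nu>"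
    unfolding H3_def by meson
  show ?thesis
  proof (rule that[OF L(1)])
    fix \<mu> \<nu> :: "(real ^ 'd) measure" and w e :: real
    assume \<mu>: "\<mu> \<in> ball_measures R" and \<nu>: "\<nu> \<in> ball_measures R" and w: "wasserstein \<mu> \<nu> \<le> ennreal w" "0 \<le> w" and e: "0 < e"
    note v\<mu> = V_props[OF ball_measuresD(1)[OF \<mu>]] and v\<nu> = V_props[OF ball_measuresD(1)[OF \<nu>]]
    have "cball 0 R \<subseteq> ball (0::real^'d) (R + 1)" by auto
    then have "fibre_wasserstein (V \<mu>) (V \<nu>) \<le> ennreal L * wasserstein \<mu> \<nu>"
      using ball_measures_supp[OF \<mu>] ball_measures_supp[OF \<nu>] by (intro L(2)[rule_format]) auto
    also have "\<dots> \<le> ennreal L * ennreal w"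
      using w by (intro mult_left_mono) auto
    also have "\<dots> = ennreal (L * w)"
      using L(1) w by (simp add: ennreal_mult)
    also have "\<dots> < ennreal (L * w + e)"
      using L(1) w e by (intro ennreal_lessI) (auto intro: add_nonneg_pos)
    finally obtain P where P: "P \<in> plans (V \<mu>) (V \<nu>)"
      and opt: "distr P borel (\<lambda>((x, v), (y, w)). (x, y)) \<in> optimal_plans \<mu> \<nu>"
      and cost: "(\<integral>\<^sup>+ ((x, v), (y, w)). ennreal (norm (v - w)) \<partial>P) < ennreal (L * w + e)"
      unfolding fibre_wasserstein_def INF_less_iff v\<mu>(4) v\<nu>(4) by auto
    note p = plansD[OF P]
    have m: "(\<lambda>((x, v), (y, w)). (x, y)) \<in> measurable P (borel :: ((real^'d) \<times> (real^'d)) measure)"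
      unfolding measurable_cong_sets[OF p(2) refl] by (simp add: split_beta' borel_prod[symmetric])
    have m': "(\<lambda>q. ennreal (dist (fst q) (snd q))) \<in> borel_measurable (borel :: ((real^'d) \<times> (real^'d)) measure)"
      by (simp add: borel_prod[symmetric])
    have "(\<integral>\<^sup>+p. ennreal (dist (fst (fst p)) (fst (snd p))) \<partial>P) = wasserstein \<mu> \<nu>"
      using opt nn_integral_distr[OF m, of "\<lambda>q. ennreal (dist (fst q) (snd q))"] m' by (simp add: optimal_plans_def transport_cost_nn_integral split_beta')
    with w P cost show "\<exists>P\<in>plans (V \<mu>) (V \<nu>). (\<integral>\<^sup>+p. ennreal (dist (fst (fst p)) (fst (snd p))) \<partial>P) \<le> ennreal w \<and>
        (\<integral>\<^sup>+p. ennreal (dist (snd (fst p)) (snd (snd p))) \<partial>P) \<le> ennreal (L * w + e)"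
      by (intro bexI[of _ P]) (auto simp: split_beta' dist_norm)
  qed
qed

end

section \<open>Test functions\<close>

lemma has_derivative_grad:
  fixes f :: "real ^ 'd::finite \<Rightarrow> real"
  assumes "f differentiable (at x)"
  shows "(f has_derivative (\<lambda>h. grad f x \<bullet> h)) (at x)"
proof -
  have d: "(f has_derivative frechet_derivative f (at x)) (at x)"
    using assms frechet_derivative_works by blast
  then interpret bounded_linear "frechet_derivative f (at x)" by (rule has_derivative_bounded_linear)
  have "frechet_derivative f (at x) h = grad f x \<bullet> h" for h
  proof -
    have "frechet_derivative f (at x) h = frechet_derivative f (at x) (\<Sum>i\<in>UNIV. h $ i *\<^sub>R axis i 1)"
      by (simp add: basis_expansion[of h, unfolded scalar_mult_eq_scaleR])
    also have "\<dots> = grad f x \<bullet> h"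
      by (simp add: sum scaleR grad_def partial_deriv_def inner_vec_def mult.commute)
    finally show ?thesis .
  qed
  then have "frechet_derivative f (at x) = (\<lambda>h. grad f x \<bullet> h)" by blast
  with d show ?thesis by simp
qed

text \<open>Differentiation does not enlarge the support; this is applied to \<open>f\<close> and
  again to its partial derivatives.\<close>

lemma partial_deriv_outside_support:
  fixes f :: "real ^ 'd::finite \<Rightarrow> real"
  assumes "closed K" "\<And>y. y \<notin> K \<Longrightarrow> f y = 0" "x \<notin> K"
  shows "partial_deriv i f x = 0"
proof -
  have "(f has_derivative (\<lambda>_. 0)) (at x)"
    by (rule has_derivative_transform_within_open[of "\<lambda>_. 0" _ x UNIV "- K"])
      (use assms in \<open>auto intro: derivative_intros\<close>)
  then show ?thesis
    unfolding partial_deriv_def by (metis frechet_derivative_at)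
qed

lemma continuous_compact_support_bounded:
  fixes g :: "'a::topological_space \<Rightarrow> real"
  assumes "continuous_on UNIV g" "compact K" "\<And>y. y \<notin> K \<Longrightarrow> g y = 0"
  obtains B where "B \<ge> 0" "\<And>x. \<bar>g x\<bar> \<le> B"
proof -
  have "compact (g ` K)"
    using assms(1,2) by (intro compact_continuous_image continuous_on_subset[OF assms(1)]) auto
  then obtain B where B: "B > 0" "\<And>y. y \<in> g ` K \<Longrightarrow> norm y \<le> B"
    using compact_imp_bounded bounded_pos by metis
  have "\<bar>g x\<bar> \<le> B" for x
    using B assms(3)[of x] by (cases "x \<in> K") auto
  with B that show ?thesis by (meson less_imp_le)
qed

lemma norm_grad_le:
  fixes f :: "real ^ 'd::finite \<Rightarrow> real"
  assumes "\<And>i. \<bar>partial_deriv i f x\<bar> \<le> B"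
  shows "norm (grad f x) \<le> real CARD('d) * B"
proof -
  have "norm (grad f x) \<le> (\<Sum>i\<in>UNIV. \<bar>grad f x $ i\<bar>)" by (rule norm_le_l1_cart)
  also have "\<dots> \<le> (\<Sum>i\<in>(UNIV::'d set). B)" using assms by (intro sum_mono) (simp add: grad_def)
  finally show ?thesis by simp
qed

lemma inner_onorm_le: "onorm (\<lambda>h. g \<bullet> h) \<le> norm g"
  by (intro onorm_bound) (auto simp: Cauchy_Schwarz_ineq2)

lemma Lipschitz_of_norm_grad_le:
  fixes f :: "real ^ 'd::finite \<Rightarrow> real"
  assumes "f differentiable_on UNIV" "\<And>x. norm (grad f x) \<le> K"
  shows "\<bar>f x - f y\<bar> \<le> K * dist x y"
proof -
  have "norm (f x - f y) \<le> K * norm (x - y)"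
  proof (rule differentiable_bound)
    show "(f has_derivative (\<lambda>h. grad f x \<bullet> h)) (at x within UNIV)" for x
      using assms(1) by (intro has_derivative_grad) (auto simp: differentiable_on_def)
    show "onorm (\<lambda>h. grad f x \<bullet> h) \<le> K" for x
      using inner_onorm_le[of "grad f x"] assms(2)[of x] by linarith
  qed auto
  then show ?thesis by (simp add: dist_norm)
qed

text \<open>Compact support turns continuity of the derivatives up to second order into global
  bounds. A single \<open>K\<close> serves all estimates so that later proofs carry one
  constant.\<close>

lemma test_function_bounds:
  fixes f :: "real ^ 'd::finite \<Rightarrow> real"
  assumes f: "f \<in> test_functions"
  obtains B K where "\<And>x. \<bar>f x\<bar> \<le> B" "K \<ge> 0" "\<And>x. norm (grad f x) \<le> K"
    "\<And>x y. norm (grad f x - grad f y) \<le> K * dist x y" "\<And>x y. \<bar>f x - f y\<bar> \<le> K * dist x y"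
    "\<And>x h. \<bar>f (x + h) - f x - grad f x \<bullet> h\<bar> \<le> K * (norm h)\<^sup>2"
proof -
  have "C_k (Suc (Suc 0)) f" using f by (simp add: test_functions_def del: C_k.simps)
  then have d0: "f differentiable_on UNIV" and d1: "\<And>i. partial_deriv i f differentiable_on UNIV"
    and c2: "\<And>i j. continuous_on UNIV (partial_deriv j (partial_deriv i f))" by auto
  define S where "S = closure {x. f x \<noteq> 0}"
  have S: "compact S" "closed S" "\<And>y. y \<notin> S \<Longrightarrow> f y = 0"
    using f closure_subset[of "{x. f x \<noteq> 0}"] by (auto simp: S_def test_functions_def)
  have S1: "partial_deriv i f y = 0" if "y \<notin> S" for i y
    using S that by (intro partial_deriv_outside_support) auto
  have S2: "partial_deriv j (partial_deriv i f) y = 0" if "y \<notin> S" for i j y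
    using S S1 that by (intro partial_deriv_outside_support) auto
  obtain B where B: "\<And>x. \<bar>f x\<bar> \<le> B"
    using continuous_compact_support_bounded[OF differentiable_imp_continuous_on[OF d0] S(1,3)] by blast
  have "\<exists>B\<ge>0. \<forall>x. \<bar>partial_deriv i f x\<bar> \<le> B" for i
    using continuous_compact_support_bounded[OF differentiable_imp_continuous_on[OF d1] S(1) S1] by blast
  then obtain B1 where B1: "\<And>i. 0 \<le> B1 i" "\<And>i x. \<bar>partial_deriv i f x\<bar> \<le> B1 i" by metis
  have "\<exists>B\<ge>0. \<forall>x. \<bar>partial_deriv j (partial_deriv i f) x\<bar> \<le> B" for i j
    using continuous_compact_support_bounded[OF c2 S(1) S2] by blast
  note ex = this
  define B2 where "B2 i j = (SOME B. 0 \<le> B \<and> (\<forall>x. \<bar>partial_deriv j (partial_deriv i f) x\<bar> \<le> B))" for i j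
  have B2: "0 \<le> B2 i j" "\<bar>partial_deriv j (partial_deriv i f) x\<bar> \<le> B2 i j" for i j x
    using someI_ex[OF ex[of j i]] unfolding B2_def by auto
  define n where "n = real CARD('d)"
  have n: "1 \<le> n" unfolding n_def by simp
  define M1 where "M1 = (\<Sum>i\<in>UNIV. B1 i)"
  define M2 where "M2 = (\<Sum>i\<in>UNIV. \<Sum>j\<in>UNIV. B2 i j)"
  have le1: "B1 i \<le> M1" for i
    unfolding M1_def by (rule member_le_sum) (auto simp: B1)
  have le2: "B2 i j \<le> M2" for i j
  proof -
    have "B2 i j \<le> (\<Sum>j\<in>UNIV. B2 i j)" by (rule member_le_sum) (auto simp: B2)
    also have "\<dots> \<le> M2"
      unfolding M2_def by (rule member_le_sum[of i _ "\<lambda>i. \<Sum>j\<in>UNIV. B2 i j"]) (auto simp: B2 sum_nonneg)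
    finally show ?thesis .
  qed
  have M: "0 \<le> M1" "0 \<le> M2" unfolding M1_def M2_def by (auto intro!: sum_nonneg simp: B1 B2)
  \<comment> \<open>\<open>n * M1\<close> bounds the gradient through its coordinates;
    \<open>n * (n * M2)\<close> bounds its Lipschitz constant, where passing from coordinates to
    norms is paid for twice.\<close>
  define K where "K = n * M1 + n * (n * M2)"
  have K: "n * M1 \<le> K" "n * (n * M2) \<le> K" "0 \<le> K"
    using n M by (auto simp: K_def)
  have g: "norm (grad f x) \<le> K" for x
    using norm_grad_le[of f x M1] order_trans[OF B1(2) le1] K(1) unfolding n_def by fastforce
  have gl: "norm (grad f x - grad f y) \<le> K * dist x y" for x y
  proof -
    have "\<bar>partial_deriv i f x - partial_deriv i f y\<bar> \<le> (n * M2) * dist x y" for i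
      using order_trans[OF B2(2) le2] unfolding n_def
      by (intro Lipschitz_of_norm_grad_le[OF d1] norm_grad_le) auto
    then have "(\<Sum>i\<in>UNIV. \<bar>(grad f x - grad f y) $ i\<bar>) \<le> (\<Sum>i\<in>(UNIV::'d set). (n * M2) * dist x y)"
      by (intro sum_mono) (simp add: grad_def)
    also have "\<dots> = n * (n * M2) * dist x y" by (simp add: n_def)
    also have "\<dots> \<le> K * dist x y" using K(2) by (rule mult_right_mono) simp
    finally show ?thesis using norm_le_l1_cart[of "grad f x - grad f y"] by linarith
  qed
  have taylor: "\<bar>f (x + h) - f x - grad f x \<bullet> h\<bar> \<le> K * (norm h)\<^sup>2" for x h
  proof -
    \<comment> \<open>With the linear part at \<open>x\<close> removed, the gradient at
      \<open>y\<close> is \<open>grad f y - grad f x\<close>, of norm at most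
      \<open>K * norm h\<close> on the ball; the mean value inequality then gives the quadratic
      remainder.\<close>
    define r where "r y = f y - grad f x \<bullet> y" for y
    have "norm (r (x + h) - r x) \<le> (K * norm h) * norm ((x + h) - x)"
    proof (rule differentiable_bound[of "cball x (norm h)"])
      show "(r has_derivative (\<lambda>k. (grad f y - grad f x) \<bullet> k)) (at y within cball x (norm h))" for y
        unfolding r_def inner_diff_left using d0
        by (auto intro!: derivative_intros has_derivative_at_withinI[OF has_derivative_grad] simp: differentiable_on_def)
      show "onorm (\<lambda>k. (grad f y - grad f x) \<bullet> k) \<le> K * norm h" if "y \<in> cball x (norm h)" for y
      proof -
        have "norm (grad f y - grad f x) \<le> K * dist y x" by (rule gl)
        also have "\<dots> \<le> K * norm h" using that K(3) by (intro mult_left_mono) (auto simp: dist_commute)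
        finally show ?thesis using inner_onorm_le[of "grad f y - grad f x"] by linarith
      qed
    qed (auto simp: dist_norm)
    then show ?thesis by (simp add: r_def inner_add_right power2_eq_square mult.assoc algebra_simps)
  qed
  show ?thesis
    using that[OF B K(3) g gl Lipschitz_of_norm_grad_le[OF d0 g] taylor] .
qed

lemma continuous_on_grad:
  assumes "f \<in> test_functions"
  shows "continuous_on UNIV (grad f)"
proof -
  obtain B K where "K \<ge> 0" "\<And>x y. norm (grad f x - grad f y) \<le> K * dist x y"
    using test_function_bounds[OF assms] by metis
  then show ?thesis
    by (intro lipschitz_on_continuous_on[of K] lipschitz_onI) (auto simp: dist_norm)
qed

context lipschitz_pvf
begin

definition drift :: "(real ^ 'd \<Rightarrow> real) \<Rightarrow> (real ^ 'd) measure \<Rightarrow> real" where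
  "drift f \<mu> = (\<integral>(x, v). grad f x \<bullet> v \<partial>V \<mu>)"

lemma drift_integrable:
  assumes f: "f \<in> test_functions" and \<mu>: "\<mu> \<in> ball_measures R"
  shows "integrable (V \<mu>) (\<lambda>(x, v). grad f x \<bullet> v)"
proof -
  note v = V_props[OF ball_measuresD(1)[OF \<mu>]]
  obtain B K where K: "K \<ge> 0" "\<And>x. norm (grad f x) \<le> K"
    using test_function_bounds[OF f] by metis
  interpret prob_space "V \<mu>" by (rule v)
  note [measurable] = v(5,6) borel_measurable_continuous_onI[OF continuous_on_grad[OF f]]
  have "AE p in V \<mu>. norm (grad f (fst p) \<bullet> snd p) \<le> K * (C * (1 + R))"
  proof (rule AE_mp[OF V_AE_velocity[OF \<mu>]], rule AE_I2, rule impI)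
    fix p :: "(real ^ 'd) \<times> (real ^ 'd)" assume p: "norm (snd p) \<le> C * (1 + R)"
    have "norm (grad f (fst p) \<bullet> snd p) \<le> norm (grad f (fst p)) * norm (snd p)"
      by (simp add: Cauchy_Schwarz_ineq2)
    also have "\<dots> \<le> K * (C * (1 + R))" using K p by (intro mult_mono) auto
    finally show "norm (grad f (fst p) \<bullet> snd p) \<le> K * (C * (1 + R))" .
  qed
  then show ?thesis
    unfolding split_beta' by (intro integrable_const_bound) auto
qed

text \<open>The integrand is a product of \<open>grad f x\<close> and \<open>v\<close>: a change of
  velocity costs \<open>K\<close>, and a change of position costs \<open>K\<close> times a bound for
  the speed, which is why the statement is confined to a ball.\<close>

lemma drift_lipschitz:
  assumes f: "f \<in> test_functions" and R: "R > 0"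
  obtains K where "K \<ge> 0" "\<And>\<mu> \<nu> w. \<lbrakk>\<mu> \<in> ball_measures R; \<nu> \<in> ball_measures R; wasserstein \<mu> \<nu> \<le> ennreal w; 0 \<le> w\<rbrakk>
      \<Longrightarrow> \<bar>drift f \<mu> - drift f \<nu>\<bar> \<le> K * w"
proof -
  obtain B K where K: "K \<ge> 0" "\<And>x. norm (grad f x) \<le> K" "\<And>x y. norm (grad f x - grad f y) \<le> K * dist x y"
    using test_function_bounds[OF f] by metis
  obtain L where L: "L > 0" "\<And>\<mu> \<nu> w e. \<lbrakk>\<mu> \<in> ball_measures R; \<nu> \<in> ball_measures R; wasserstein \<mu> \<nu> \<le> ennreal w; 0 \<le> w; 0 < e\<rbrakk> \<Longrightarrow>
      \<exists>P\<in>plans (V \<mu>) (V \<nu>). (\<integral>\<^sup>+p. ennreal (dist (fst (fst p)) (fst (snd p))) \<partial>P) \<le> ennreal w \<and>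
        (\<integral>\<^sup>+p. ennreal (dist (snd (fst p)) (snd (snd p))) \<partial>P) \<le> ennreal (L * w + e)"
    using V_plan[OF R] by blast
  define D where "D = C * (1 + R)"
  have D: "D \<ge> 0" using R C_pos by (simp add: D_def)
  define G where "G p = grad f (fst p) \<bullet> snd p" for p :: "(real ^ 'd) \<times> (real ^ 'd)"
  have drift: "drift f \<mu> = integral\<^sup>L (V \<mu>) G" for \<mu>
    by (simp add: drift_def G_def[abs_def] split_beta')
  note [measurable] = borel_measurable_continuous_onI[OF continuous_on_grad[OF f]]
  have bound: "\<bar>drift f \<mu> - drift f \<nu>\<bar> \<le> K * (L * w + e) + K * D * w"
    if \<mu>: "\<mu> \<in> ball_measures R" and \<nu>: "\<nu> \<in> ball_measures R" and w: "wasserstein \<mu> \<nu> \<le> ennreal w" "0 \<le> w" and e: "e > 0"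
    for \<mu> \<nu> :: "(real ^ 'd) measure" and w e :: real
  proof -
    note v\<mu> = V_props[OF ball_measuresD(1)[OF \<mu>]] and v\<nu> = V_props[OF ball_measuresD(1)[OF \<nu>]]
    obtain P where P: "P \<in> plans (V \<mu>) (V \<nu>)"
      and c1: "(\<integral>\<^sup>+p. ennreal (dist (fst (fst p)) (fst (snd p))) \<partial>P) \<le> ennreal w"
      and c2: "(\<integral>\<^sup>+p. ennreal (dist (snd (fst p)) (snd (snd p))) \<partial>P) \<le> ennreal (L * w + e)"
      using L(2)[OF \<mu> \<nu> w e] by blast
    note p = plansD[OF P]
    note m = borel_measurable_fst_snd[OF p(2)]
    have [measurable]: "(\<lambda>q. fst (fst q)) \<in> borel_measurable P" "(\<lambda>q. snd (fst q)) \<in> borel_measurable P"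
       "(\<lambda>q. fst (snd q)) \<in> borel_measurable P" "(\<lambda>q. snd (snd q)) \<in> borel_measurable P"
      using measurable_compose[OF m(1)] measurable_compose[OF m(2)]
        borel_measurable_fst_snd[where ?'a="real^'d" and ?'b="real^'d" and \<pi>=borel] by blast+
    have i\<mu>: "integrable (distr P borel fst) G" and i\<nu>: "integrable (distr P borel snd) G"
      using drift_integrable[OF f \<mu>] drift_integrable[OF f \<nu>] by (simp_all add: p G_def[abs_def] split_beta')
    have i: "integrable P (\<lambda>q. G (fst q))" "integrable P (\<lambda>q. G (snd q))"
      using integrable_distr[OF m(1) i\<mu>] integrable_distr[OF m(2) i\<nu>] by auto
    have mG: "G \<in> borel_measurable borel"
      unfolding G_def[abs_def] by (simp add: borel_prod[symmetric])
    have eq: "drift f \<mu> - drift f \<nu> = (\<integral>q. G (fst q) - G (snd q) \<partial>P)"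
      using i integral_distr[OF m(1) mG] integral_distr[OF m(2) mG] by (simp add: p drift)
    \<comment> \<open>The splitting used below leaves only the velocity belonging to
      \<open>\<nu>\<close> undifferenced, so it is this one that is bounded.\<close>
    have "AE q in distr P borel snd. norm (snd q) \<le> D"
      unfolding p(5) D_def by (rule V_AE_velocity[OF \<nu>])
    then have ae: "AE q in P. norm (snd (snd q)) \<le> D"
      by (rule AE_distrD[OF m(2)])
    have "\<bar>\<integral>q. G (fst q) - G (snd q) \<partial>P\<bar> \<le> K * (L * w + e) + K * D * w"
    proof (rule abs_integral_le_nn_integral)
      have "(\<integral>\<^sup>+q. ennreal \<bar>G (fst q) - G (snd q)\<bar> \<partial>P)
        \<le> (\<integral>\<^sup>+q. ennreal K * ennreal (dist (snd (fst q)) (snd (snd q)))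
            + ennreal (K * D) * ennreal (dist (fst (fst q)) (fst (snd q))) \<partial>P)"
      proof (rule nn_integral_mono_AE, rule AE_mp[OF ae], rule AE_I2, rule impI)
        fix q :: "((real ^ 'd) \<times> (real ^ 'd)) \<times> ((real ^ 'd) \<times> (real ^ 'd))"
        assume q: "norm (snd (snd q)) \<le> D"
        have "G (fst q) - G (snd q) = grad f (fst (fst q)) \<bullet> (snd (fst q) - snd (snd q))
           + (grad f (fst (fst q)) - grad f (fst (snd q))) \<bullet> snd (snd q)"
          by (simp add: G_def inner_diff_left inner_diff_right)
        also have "\<bar>\<dots>\<bar> \<le> norm (grad f (fst (fst q))) * norm (snd (fst q) - snd (snd q))
           + norm (grad f (fst (fst q)) - grad f (fst (snd q))) * norm (snd (snd q))"
          by (intro order_trans[OF abs_triangle_ineq] add_mono Cauchy_Schwarz_ineq2)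
        also have "\<dots> \<le> K * dist (snd (fst q)) (snd (snd q)) + (K * dist (fst (fst q)) (fst (snd q))) * D"
          using K q by (intro add_mono mult_mono) (auto simp: dist_norm)
        finally have "ennreal \<bar>G (fst q) - G (snd q)\<bar> \<le> ennreal (K * dist (snd (fst q)) (snd (snd q)) + (K * dist (fst (fst q)) (fst (snd q))) * D)"
          by (rule ennreal_leI)
        also have "\<dots> = ennreal K * ennreal (dist (snd (fst q)) (snd (snd q)))
            + ennreal (K * D) * ennreal (dist (fst (fst q)) (fst (snd q)))"
          using K(1) D by (simp add: ennreal_plus ennreal_mult mult.assoc mult.commute mult.left_commute)
        finally show "ennreal \<bar>G (fst q) - G (snd q)\<bar> \<le> ennreal K * ennreal (dist (snd (fst q)) (snd (snd q)))
            + ennreal (K * D) * ennreal (dist (fst (fst q)) (fst (snd q)))" .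
      qed
      also have "\<dots> = ennreal K * (\<integral>\<^sup>+q. ennreal (dist (snd (fst q)) (snd (snd q))) \<partial>P)
            + ennreal (K * D) * (\<integral>\<^sup>+q. ennreal (dist (fst (fst q)) (fst (snd q))) \<partial>P)"
        by (simp add: nn_integral_add nn_integral_cmult)
      also have "\<dots> \<le> ennreal K * ennreal (L * w + e) + ennreal (K * D) * ennreal w"
        by (intro add_mono mult_left_mono c1 c2) auto
      also have "\<dots> = ennreal (K * (L * w + e) + K * D * w)"
        using K(1) D L(1) w e by (simp add: ennreal_mult ennreal_plus)
      finally show "(\<integral>\<^sup>+q. ennreal \<bar>G (fst q) - G (snd q)\<bar> \<partial>P) \<le> ennreal (K * (L * w + e) + K * D * w)" .
    qed (use i K(1) D L(1) w e in auto)
    then show ?thesis by (simp add: eq)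
  qed
  show ?thesis
  proof (rule that)
    show "0 \<le> K * L + K * D" using K(1) L(1) D by simp
    fix \<mu> \<nu> :: "(real ^ 'd) measure" and w :: real
    assume *: "\<mu> \<in> ball_measures R" "\<nu> \<in> ball_measures R" "wasserstein \<mu> \<nu> \<le> ennreal w" "0 \<le> w"
    show "\<bar>drift f \<mu> - drift f \<nu>\<bar> \<le> (K * L + K * D) * w"
    proof (rule field_le_epsilon)
      fix e :: real assume e: "e > 0"
      then have "e / (K + 1) > 0" using K(1) by simp
      from bound[OF * this] have "\<bar>drift f \<mu> - drift f \<nu>\<bar> \<le> (K * L + K * D) * w + K * (e / (K + 1))"
        by (simp add: algebra_simps)
      moreover have "K * (e / (K + 1)) \<le> e" using K(1) e by (simp add: field_simps)
      ultimately show "\<bar>drift f \<mu> - drift f \<nu>\<bar> \<le> (K * L + K * D) * w + e" by linarith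
    qed
  qed
qed

end

section \<open>One step of the schemes\<close>

text \<open>Covers all times and not just the nodes: full steps \<open>s = \<Delta>\<close> reach
  the nodes, one partial step the rest. Time intervals are open on the left, as in
  \<open>scheme_recursion\<close>.\<close>

lemma time_step_induct [consumes 2, case_names zero step]:
  fixes t :: real
  assumes "\<Delta> > 0" "t \<ge> 0" and zero: "P 0"
    and step: "\<And>k s. 0 < s \<Longrightarrow> s \<le> \<Delta> \<Longrightarrow> P (real k * \<Delta>) \<Longrightarrow> P (real k * \<Delta> + s)"
  shows "P t"
proof -
  have node: "P (real k * \<Delta>)" for k
  proof (induction k)
    case (Suc k)
    from step[OF \<open>\<Delta> > 0\<close> order.refl this] show ?case by (simp add: algebra_simps)
  qed (simp add: zero)
  show ?thesis
  proof (cases "t = 0")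
    case False
    define k where "k = nat (\<lceil>t / \<Delta>\<rceil> - 1)"
    have "t / \<Delta> > 0" using False assms by simp
    then have "real k < t / \<Delta>" "t / \<Delta> \<le> real k + 1"
      unfolding k_def by linarith+
    then have "0 < t - real k * \<Delta>" "t - real k * \<Delta> \<le> \<Delta>"
      using \<open>\<Delta> > 0\<close> by (simp_all add: field_simps)
    from step[OF this node[of k]] show ?thesis by simp
  qed (simp add: zero)
qed

context lipschitz_pvf
begin

text \<open>\<open>\<rho>\<close> abstracts the rounding of velocities: the identity gives the
  Lagrangian step and \<open>grid_floor\<close> the lattice step, so both schemes share their
  estimates.\<close>

lemma measurable_rounded_step:
  fixes \<rho> :: "real ^ 'd \<Rightarrow> real ^ 'd"
  assumes "\<mu> \<in> prob_measures" "\<rho> \<in> borel_measurable borel"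
  shows "(\<lambda>p. fst p + s *\<^sub>R \<rho> (snd p)) \<in> borel_measurable (V \<mu>)"
proof -
  note [measurable] = V_props(5,6)[OF assms(1)] assms(2)
  show ?thesis by measurable
qed

lemmas measurable_step = measurable_rounded_step[of _ "\<lambda>v. v", simplified]

lemma lagrangian_step_eq: "lagrangian_step V s \<mu> = distr (V \<mu>) borel (\<lambda>p. fst p + s *\<^sub>R snd p)"
  by (simp add: lagrangian_step_def split_beta')

lemma lagrangian_step_0: "\<mu> \<in> prob_measures \<Longrightarrow> lagrangian_step V 0 \<mu> = \<mu>"
  by (simp add: lagrangian_step_eq V_props)

lemma rounded_step_ball_measures:
  assumes \<mu>: "\<mu> \<in> ball_measures R" and s: "0 \<le> s"
    and \<rho>: "\<rho> \<in> borel_measurable borel" "\<And>v. norm (\<rho> v - v) \<le> \<eta>"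
  shows "distr (V \<mu>) borel (\<lambda>p. fst p + s *\<^sub>R \<rho> (snd p)) \<in> ball_measures (R + s * (C * (1 + R) + \<eta>))"
proof (rule distr_in_ball_measures)
  note v = V_props[OF ball_measuresD(1)[OF \<mu>]]
  show "prob_space (V \<mu>)" by (rule v)
  show "(\<lambda>p. fst p + s *\<^sub>R \<rho> (snd p)) \<in> borel_measurable (V \<mu>)"
    by (rule measurable_rounded_step[OF ball_measuresD(1)[OF \<mu>] \<rho>(1)])
  show "AE p in V \<mu>. norm (fst p + s *\<^sub>R \<rho> (snd p)) \<le> R + s * (C * (1 + R) + \<eta>)"
    using V_AE_velocity[OF \<mu>] V_AE_position[OF \<mu>]
  proof eventually_elim
    case (elim p)
    have "norm (\<rho> (snd p)) \<le> norm (snd p) + norm (\<rho> (snd p) - snd p)"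
      by (metis add.commute diff_add_cancel norm_triangle_ineq)
    also have "\<dots> \<le> C * (1 + R) + \<eta>" using elim(1) \<rho>(2) by (rule add_mono)
    finally have "s * norm (\<rho> (snd p)) \<le> s * (C * (1 + R) + \<eta>)" using s by (rule mult_left_mono)
    moreover have "norm (fst p + s *\<^sub>R \<rho> (snd p)) \<le> norm (fst p) + s * norm (\<rho> (snd p))"
      using norm_triangle_ineq[of "fst p" "s *\<^sub>R \<rho> (snd p)"] s by simp
    ultimately show ?case using elim(2) by linarith
  qed
qed

lemma lagrangian_step_ball_measures:
  "\<mu> \<in> ball_measures R \<Longrightarrow> 0 \<le> s \<Longrightarrow> lagrangian_step V s \<mu> \<in> ball_measures (R + s * (C * (1 + R)))"
  using rounded_step_ball_measures[of \<mu> R s "\<lambda>v. v" 0] by (simp add: lagrangian_step_eq)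

text \<open>Both states are images of the same measure \<open>V \<mu>\<close>, so each particle is
  coupled with itself and only its speed enters.\<close>

lemma lagrangian_step_time_lipschitz:
  assumes \<mu>: "\<mu> \<in> ball_measures R"
  shows "wasserstein (lagrangian_step V s \<mu>) (lagrangian_step V u \<mu>) \<le> ennreal (C * (1 + R) * \<bar>s - u\<bar>)"
proof -
  note p = ball_measuresD(1)[OF \<mu>]
  note v = V_props[OF p]
  interpret prob_space "V \<mu>" by (rule v)
  have "wasserstein (lagrangian_step V s \<mu>) (lagrangian_step V u \<mu>)
      \<le> (\<integral>\<^sup>+p. ennreal (dist (fst p + s *\<^sub>R snd p) (fst p + u *\<^sub>R snd p)) \<partial>V \<mu>)"
    unfolding lagrangian_step_eq by (rule wasserstein_coupling_le[OF v(1) measurable_step[OF p] measurable_step[OF p]])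
  also have "\<dots> \<le> (\<integral>\<^sup>+p. ennreal (C * (1 + R) * \<bar>s - u\<bar>) \<partial>V \<mu>)"
  proof (rule nn_integral_mono_AE)
    show "AE p in V \<mu>. ennreal (dist (fst p + s *\<^sub>R snd p) (fst p + u *\<^sub>R snd p)) \<le> ennreal (C * (1 + R) * \<bar>s - u\<bar>)"
      using V_AE_velocity[OF \<mu>]
    proof eventually_elim
      case (elim p)
      have "dist (fst p + s *\<^sub>R snd p) (fst p + u *\<^sub>R snd p) = norm ((s - u) *\<^sub>R snd p)"
        by (simp add: dist_norm scaleR_diff_left)
      then show ?case using elim by (intro ennreal_leI) (simp add: mult.commute[of _ "\<bar>s - u\<bar>"] mult_left_mono)
    qed
  qed
  also have "\<dots> = ennreal (C * (1 + R) * \<bar>s - u\<bar>)" by (simp add: emeasure_space_1)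
  finally show ?thesis .
qed

text \<open>Taylor expansion under the integral over \<open>V \<mu>\<close>: the first two terms are
  the integral against \<open>\<mu>\<close> and the drift. The remainder is quadratic in
  \<open>s\<close>, so its sum over all steps vanishes with the step size.\<close>

lemma lagrangian_step_consistent:
  assumes f: "f \<in> test_functions"
  obtains K where "K \<ge> 0" "\<And>\<mu> R s. \<mu> \<in> ball_measures R \<Longrightarrow>
    \<bar>integral\<^sup>L (lagrangian_step V s \<mu>) f - integral\<^sup>L \<mu> f - s * drift f \<mu>\<bar> \<le> K * (s * (C * (1 + R)))\<^sup>2"
proof -
  obtain B K where B: "\<And>x. \<bar>f x\<bar> \<le> B" and K: "K \<ge> 0" "\<And>x h. \<bar>f (x + h) - f x - grad f x \<bullet> h\<bar> \<le> K * (norm h)\<^sup>2"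
      "\<And>x y. \<bar>f x - f y\<bar> \<le> K * dist x y"
    using test_function_bounds[OF f] by metis
  have "continuous_on UNIV f"
    using K by (intro lipschitz_on_continuous_on[of K] lipschitz_onI) (auto simp: dist_real_def)
  then have mf [measurable]: "f \<in> borel_measurable borel"
    by (rule borel_measurable_continuous_onI)
  show ?thesis
  proof (rule that[OF K(1)])
    fix \<mu> :: "(real ^ 'd) measure" and R s :: real
    assume \<mu>: "\<mu> \<in> ball_measures R"
    note p = ball_measuresD(1)[OF \<mu>]
    note v = V_props[OF p]
    interpret prob_space "V \<mu>" by (rule v)
    note [measurable] = v(5,6)
    have i: "integrable (V \<mu>) (\<lambda>p. f (fst p + s *\<^sub>R snd p))" "integrable (V \<mu>) (\<lambda>p. f (fst p))"
      by (intro integrable_bounded[of _ B] B; measurable)+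
    have ig: "integrable (V \<mu>) (\<lambda>p. s * (grad f (fst p) \<bullet> snd p))"
      using drift_integrable[OF f \<mu>] by (intro integrable_mult_right) (simp add: split_beta')
    have e1: "integral\<^sup>L (lagrangian_step V s \<mu>) f = (\<integral>p. f (fst p + s *\<^sub>R snd p) \<partial>V \<mu>)"
      unfolding lagrangian_step_eq by (rule integral_distr[OF measurable_step[OF p] mf])
    have e2: "integral\<^sup>L \<mu> f = (\<integral>p. f (fst p) \<partial>V \<mu>)"
      using integral_distr[OF v(5) mf] by (simp add: v(4))
    have e3: "s * drift f \<mu> = (\<integral>p. s * (grad f (fst p) \<bullet> snd p) \<partial>V \<mu>)"
      by (simp add: drift_def split_beta')
    have "integral\<^sup>L (lagrangian_step V s \<mu>) f - integral\<^sup>L \<mu> f - s * drift f \<mu>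
       = (\<integral>p. f (fst p + s *\<^sub>R snd p) - f (fst p) - s * (grad f (fst p) \<bullet> snd p) \<partial>V \<mu>)"
      unfolding e1 e2 e3 using i ig by simp
    also have "\<bar>\<dots>\<bar> \<le> K * (s * (C * (1 + R)))\<^sup>2"
    proof (rule abs_integral_le_nn_integral)
      have "(\<integral>\<^sup>+p. ennreal \<bar>f (fst p + s *\<^sub>R snd p) - f (fst p) - s * (grad f (fst p) \<bullet> snd p)\<bar> \<partial>V \<mu>)
        \<le> (\<integral>\<^sup>+p. ennreal (K * (s * (C * (1 + R)))\<^sup>2) \<partial>V \<mu>)"
      proof (rule nn_integral_mono_AE)
        show "AE p in V \<mu>. ennreal \<bar>f (fst p + s *\<^sub>R snd p) - f (fst p) - s * (grad f (fst p) \<bullet> snd p)\<bar>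
          \<le> ennreal (K * (s * (C * (1 + R)))\<^sup>2)"
          using V_AE_velocity[OF \<mu>]
        proof eventually_elim
          case (elim p)
          have "(norm (s *\<^sub>R snd p))\<^sup>2 \<le> (\<bar>s\<bar> * (C * (1 + R)))\<^sup>2"
            using elim by (intro power_mono) (auto intro: mult_left_mono)
          also have "\<dots> = (s * (C * (1 + R)))\<^sup>2" by (simp add: power_mult_distrib)
          finally have "K * (norm (s *\<^sub>R snd p))\<^sup>2 \<le> K * (s * (C * (1 + R)))\<^sup>2"
            using K(1) by (rule mult_left_mono)
          with K(2)[of "fst p" "s *\<^sub>R snd p"] show ?case by (intro ennreal_leI) simp
        qed
      qed
      then show "(\<integral>\<^sup>+p. ennreal \<bar>f (fst p + s *\<^sub>R snd p) - f (fst p) - s * (grad f (fst p) \<bullet> snd p)\<bar> \<partial>V \<mu>)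
        \<le> ennreal (K * (s * (C * (1 + R)))\<^sup>2)" by (simp add: emeasure_space_1)
    qed (use i ig K(1) in auto)
    finally show "\<bar>integral\<^sup>L (lagrangian_step V s \<mu>) f - integral\<^sup>L \<mu> f - s * drift f \<mu>\<bar> \<le> K * (s * (C * (1 + R)))\<^sup>2" .
  qed
qed

text \<open>One plan from \<open>V_plan\<close> is pushed through both step maps: positions
  contribute \<open>w\<close>, velocities \<open>s * (L * w)\<close>, and rounding on one side
  \<open>s * \<eta>\<close>.\<close>

lemma step_comparison:
  assumes "R > 0"
  obtains L where "L > 0" "\<And>\<mu> \<nu> w s \<eta> \<rho>. \<lbrakk>\<mu> \<in> ball_measures R; \<nu> \<in> ball_measures R; wasserstein \<mu> \<nu> \<le> ennreal w; 0 \<le> w; 0 \<le> s;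
      \<rho> \<in> borel_measurable borel; \<And>v. norm (\<rho> v - v) \<le> \<eta>\<rbrakk> \<Longrightarrow>
      wasserstein (lagrangian_step V s \<mu>) (distr (V \<nu>) borel (\<lambda>p. fst p + s *\<^sub>R \<rho> (snd p))) \<le> ennreal (w + s * (L * w + \<eta>))"
proof -
  obtain L where L: "L > 0" "\<And>\<mu> \<nu> w e. \<lbrakk>\<mu> \<in> ball_measures R; \<nu> \<in> ball_measures R; wasserstein \<mu> \<nu> \<le> ennreal w; 0 \<le> w; 0 < e\<rbrakk> \<Longrightarrow>
      \<exists>P\<in>plans (V \<mu>) (V \<nu>). (\<integral>\<^sup>+p. ennreal (dist (fst (fst p)) (fst (snd p))) \<partial>P) \<le> ennreal w \<and>
        (\<integral>\<^sup>+p. ennreal (dist (snd (fst p)) (snd (snd p))) \<partial>P) \<le> ennreal (L * w + e)"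
    using V_plan[OF assms] by blast
  show ?thesis
  proof (rule that[OF L(1)])
    fix \<mu> \<nu> :: "(real ^ 'd) measure" and w s \<eta> :: real and \<rho> :: "real ^ 'd \<Rightarrow> real ^ 'd"
    assume \<mu>: "\<mu> \<in> ball_measures R" and \<nu>: "\<nu> \<in> ball_measures R" and w: "wasserstein \<mu> \<nu> \<le> ennreal w" "0 \<le> w"
      and s: "0 \<le> s" and \<rho>: "\<rho> \<in> borel_measurable borel" "\<And>v. norm (\<rho> v - v) \<le> \<eta>"
    have \<eta>: "0 \<le> \<eta>" using \<rho>(2)[of 0] norm_ge_zero order_trans by blast
    note m1 = measurable_step[OF ball_measuresD(1)[OF \<mu>], of s]
      and m2 = measurable_rounded_step[OF ball_measuresD(1)[OF \<nu>] \<rho>(1), of s]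
    show "wasserstein (lagrangian_step V s \<mu>) (distr (V \<nu>) borel (\<lambda>p. fst p + s *\<^sub>R \<rho> (snd p))) \<le> ennreal (w + s * (L * w + \<eta>))"
    proof (rule ennreal_le_epsilon)
      fix \<epsilon> :: real assume \<epsilon>: "\<epsilon> > 0"
      define e where "e = \<epsilon> / (s + 1)"
      have e: "e > 0" "s * e \<le> \<epsilon>" using \<epsilon> s by (auto simp: e_def field_simps)
      obtain P where P: "P \<in> plans (V \<mu>) (V \<nu>)"
        and c1: "(\<integral>\<^sup>+p. ennreal (dist (fst (fst p)) (fst (snd p))) \<partial>P) \<le> ennreal w"
        and c2: "(\<integral>\<^sup>+p. ennreal (dist (snd (fst p)) (snd (snd p))) \<partial>P) \<le> ennreal (L * w + e)"
        using L(2)[OF \<mu> \<nu> w e(1)] by blast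
      note p = plansD[OF P]
      interpret P: prob_space P by fact
      note m = borel_measurable_fst_snd[OF p(2)]
      have [measurable]: "(\<lambda>q. fst (fst q)) \<in> borel_measurable P" "(\<lambda>q. snd (fst q)) \<in> borel_measurable P"
         "(\<lambda>q. fst (snd q)) \<in> borel_measurable P" "(\<lambda>q. snd (snd q)) \<in> borel_measurable P"
        using measurable_compose[OF m(1)] measurable_compose[OF m(2)]
          borel_measurable_fst_snd[where ?'a="real^'d" and ?'b="real^'d" and \<pi>=borel] by blast+
      have g: "(\<lambda>p. fst p + s *\<^sub>R snd p) \<in> borel_measurable (borel :: ((real^'d) \<times> (real^'d)) measure)"
        "(\<lambda>p. fst p + s *\<^sub>R \<rho> (snd p)) \<in> borel_measurable (borel :: ((real^'d) \<times> (real^'d)) measure)"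
        using \<rho>(1) by (simp_all add: borel_prod[symmetric])
      have d1: "lagrangian_step V s \<mu> = distr P borel (\<lambda>q. fst (fst q) + s *\<^sub>R snd (fst q))"
        using distr_distr[OF g(1) m(1)] by (simp add: p lagrangian_step_eq comp_def)
      have d2: "distr (V \<nu>) borel (\<lambda>p. fst p + s *\<^sub>R \<rho> (snd p)) = distr P borel (\<lambda>q. fst (snd q) + s *\<^sub>R \<rho> (snd (snd q)))"
        using distr_distr[OF g(2) m(2)] by (simp add: p comp_def)
      have "wasserstein (lagrangian_step V s \<mu>) (distr (V \<nu>) borel (\<lambda>p. fst p + s *\<^sub>R \<rho> (snd p)))
        \<le> (\<integral>\<^sup>+q. ennreal (dist (fst (fst q) + s *\<^sub>R snd (fst q)) (fst (snd q) + s *\<^sub>R \<rho> (snd (snd q)))) \<partial>P)"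
        unfolding d1 d2
        by (rule wasserstein_coupling_le[OF p(1) measurable_compose[OF m(1) g(1)] measurable_compose[OF m(2) g(2)]])
      also have "\<dots> \<le> (\<integral>\<^sup>+q. (ennreal (dist (fst (fst q)) (fst (snd q))) + ennreal s * ennreal (dist (snd (fst q)) (snd (snd q)))) + ennreal (s * \<eta>) \<partial>P)"
      proof (rule nn_integral_mono)
        fix q :: "((real ^ 'd) \<times> (real ^ 'd)) \<times> ((real ^ 'd) \<times> (real ^ 'd))"
        have "(fst (fst q) + s *\<^sub>R snd (fst q)) - (fst (snd q) + s *\<^sub>R \<rho> (snd (snd q)))
          = (fst (fst q) - fst (snd q)) + s *\<^sub>R (snd (fst q) - snd (snd q)) - s *\<^sub>R (\<rho> (snd (snd q)) - snd (snd q))"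
          by (simp add: algebra_simps)
        then have "dist (fst (fst q) + s *\<^sub>R snd (fst q)) (fst (snd q) + s *\<^sub>R \<rho> (snd (snd q)))
          \<le> norm ((fst (fst q) - fst (snd q)) + s *\<^sub>R (snd (fst q) - snd (snd q))) + norm (s *\<^sub>R (\<rho> (snd (snd q)) - snd (snd q)))"
          unfolding dist_norm by (metis norm_triangle_ineq4)
        also have "\<dots> \<le> (norm (fst (fst q) - fst (snd q)) + norm (s *\<^sub>R (snd (fst q) - snd (snd q)))) + norm (s *\<^sub>R (\<rho> (snd (snd q)) - snd (snd q)))"
          by (intro add_right_mono norm_triangle_ineq)
        also have "\<dots> \<le> dist (fst (fst q)) (fst (snd q)) + s * dist (snd (fst q)) (snd (snd q)) + s * \<eta>"
          using s \<rho>(2)[of "snd (snd q)"] by (auto simp: dist_norm intro!: mult_left_mono)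
        finally have "ennreal (dist (fst (fst q) + s *\<^sub>R snd (fst q)) (fst (snd q) + s *\<^sub>R \<rho> (snd (snd q))))
          \<le> ennreal (dist (fst (fst q)) (fst (snd q)) + s * dist (snd (fst q)) (snd (snd q)) + s * \<eta>)"
          by (rule ennreal_leI)
        then show "ennreal (dist (fst (fst q) + s *\<^sub>R snd (fst q)) (fst (snd q) + s *\<^sub>R \<rho> (snd (snd q))))
          \<le> (ennreal (dist (fst (fst q)) (fst (snd q))) + ennreal s * ennreal (dist (snd (fst q)) (snd (snd q)))) + ennreal (s * \<eta>)"
          using s \<eta> by (simp add: ennreal_plus ennreal_mult)
      qed
      also have "\<dots> = (\<integral>\<^sup>+q. ennreal (dist (fst (fst q)) (fst (snd q))) \<partial>P)
        + ennreal s * (\<integral>\<^sup>+q. ennreal (dist (snd (fst q)) (snd (snd q))) \<partial>P) + ennreal (s * \<eta>)"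
        by (simp add: nn_integral_add nn_integral_cmult P.emeasure_space_1)
      also have "\<dots> \<le> ennreal w + ennreal s * ennreal (L * w + e) + ennreal (s * \<eta>)"
        by (intro add_mono mult_left_mono c1 c2) auto
      also have "\<dots> = ennreal (w + s * (L * w + \<eta>) + s * e)"
        using w(2) s L(1) e(1) \<eta> by (simp add: ennreal_plus[symmetric] ennreal_mult[symmetric] algebra_simps del: ennreal_plus)
      also have "\<dots> \<le> ennreal (w + s * (L * w + \<eta>) + \<epsilon>)"
        using e(2) by (intro ennreal_leI) simp
      also have "\<dots> = ennreal (w + s * (L * w + \<eta>)) + ennreal \<epsilon>"
        using w(2) s L(1) \<eta> \<epsilon> by (intro ennreal_plus) auto
      finally show "wasserstein (lagrangian_step V s \<mu>) (distr (V \<nu>) borel (\<lambda>p. fst p + s *\<^sub>R \<rho> (snd p)))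
        \<le> ennreal (w + s * (L * w + \<eta>)) + ennreal \<epsilon>" .
    qed
  qed
qed

end

section \<open>Limits of the semi-discrete Lagrangian scheme\<close>

locale pvf_cauchy_problem = lipschitz_pvf V C for V :: "'d::finite pvf" and C :: real +
  fixes T :: real and \<mu>\<^sub>0 :: "(real ^ 'd) measure" and R\<^sub>0 :: real
  assumes T_pos: "T > 0" and R0_nonneg: "R\<^sub>0 \<ge> 0" and initial: "\<mu>\<^sub>0 \<in> ball_measures R\<^sub>0"
begin

abbreviation lagr :: "nat \<Rightarrow> real \<Rightarrow> (real ^ 'd) measure" where
  "lagr \<equiv> lagrangian_scheme V T \<mu>\<^sub>0"

text \<open>The radius \<open>R\<close> is generous enough to confine the lattice approximate solutions as well:
  rounding positions and velocities adds at most \<open>T * CARD('d)\<close> and \<open>CARD('d)\<close> respectively.\<close>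

definition R :: real where
  "R = (1 + (R\<^sub>0 + T * CARD('d))) * exp ((C + CARD('d)) * T)"

text \<open>By \<open>V_AE_velocity\<close> this bounds the speed of every measure confined to
  radius \<open>R\<close>, and so the Lipschitz constant in time.\<close>

definition M :: real where
  "M = C * (1 + R)"

lemma R_pos: "R > 0" and M_pos: "M > 0"
proof -
  show "R > 0" unfolding R_def using R0_nonneg T_pos by (intro mult_pos_pos add_pos_nonneg) auto
  then show "M > 0" unfolding M_def using C_pos by simp
qed

lemma lagr_0: "lagr N 0 = \<mu>\<^sub>0"
  by (simp add: lagrangian_scheme_def scheme_0)

lemma lagr_step:
  assumes "N \<ge> 1" "0 < s" "s \<le> T / real N"
  shows "lagr N (real k * (T / real N) + s) = lagrangian_step V s (lagr N (real k * (T / real N)))"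
proof -
  define D where "D = T / real N"
  have "D > 0" "s \<le> D" using assms T_pos by (auto simp: D_def)
  then have "scheme (lagrangian_step V) D \<mu>\<^sub>0 (real k * D + s) = lagrangian_step V s (scheme (lagrangian_step V) D \<mu>\<^sub>0 (real k * D))"
    using assms(2) by (subst scheme_recursion[of D k]) (auto simp: distrib_right)
  then show ?thesis by (simp add: lagrangian_scheme_def D_def)
qed

text \<open>One step of the discrete Gronwall inequality, from \<open>1 + x \<le> exp x\<close>. It
  controls the radii of both schemes and the distance between them.\<close>

lemma exp_growth_step:
  fixes a A s t :: real
  assumes "0 \<le> a" "0 \<le> A" "0 \<le> s"
  shows "a * exp (A * t) * (1 + s * A) \<le> a * exp (A * (t + s))"
proof -
  have "a * exp (A * t) * (1 + s * A) \<le> a * exp (A * t) * exp (A * s)"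
    using exp_ge_add_one_self[of "A * s"] assms by (intro mult_left_mono) (auto simp: mult.commute)
  then show ?thesis by (simp add: distrib_left exp_add mult.assoc)
qed

lemma lagr_ball_measures:
  assumes N: "N \<ge> 1" and t: "0 \<le> t" "t \<le> T"
  shows "lagr N t \<in> ball_measures R"
proof -
  have D: "T / real N > 0" using N T_pos by simp
  \<comment> \<open>The quantity that grows geometrically is one plus the radius, which a step
    multiplies by \<open>1 + s * C\<close>; hence the final \<open>- 1\<close>.\<close>
  have "lagr N t \<in> ball_measures ((1 + R\<^sub>0) * exp (C * t) - 1)"
    using D t(1)
  proof (induction t rule: time_step_induct)
    case zero
    then show ?case using initial by (simp add: lagr_0)
  next
    case (step k s)
    let ?t = "real k * (T / real N)"
    have "lagr N (?t + s) \<in> ball_measures (((1 + R\<^sub>0) * exp (C * ?t) - 1) + s * (C * (1 + ((1 + R\<^sub>0) * exp (C * ?t) - 1))))"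
      unfolding lagr_step[OF N step(1,2)] using step by (intro lagrangian_step_ball_measures) auto
    then show ?case
      using exp_growth_step[of "1 + R\<^sub>0" C s ?t] R0_nonneg C_pos step(1)
      by (elim ball_measures_mono) (simp add: algebra_simps)
  qed
  moreover have "(1 + R\<^sub>0) * exp (C * t) - 1 \<le> R"
  proof -
    have "C * t \<le> (C + CARD('d)) * T"
      using t C_pos by (intro mult_mono) auto
    then have "(1 + R\<^sub>0) * exp (C * t) \<le> R"
      unfolding R_def using R0_nonneg T_pos by (intro mult_mono) auto
    then show ?thesis by simp
  qed
  ultimately show ?thesis by (rule ball_measures_mono)
qed

text \<open>Induction on the later time. If \<open>u\<close> lies in the current step, both states
  start from the same node; otherwise the node is inserted and the induction hypothesis covers the
  earlier part.\<close>

lemma lagr_lipschitz_aux: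
  assumes N: "N \<ge> 1" and t: "0 \<le> t"
  shows "t \<le> T \<longrightarrow> (\<forall>u. 0 \<le> u \<and> u \<le> t \<longrightarrow> wasserstein (lagr N u) (lagr N t) \<le> ennreal (M * (t - u)))"
proof -
  have D: "T / real N > 0" using N T_pos by simp
  show ?thesis using D t
  proof (induction t rule: time_step_induct)
    case zero
    show ?case using wasserstein_refl[OF ball_measuresD(1)[OF initial]] by (auto simp: lagr_0)
  next
    case (step k s)
    let ?t = "real k * (T / real N)"
    show ?case
    proof (intro impI allI)
      fix u assume le: "?t + s \<le> T" and u: "0 \<le> u \<and> u \<le> ?t + s"
      have t: "0 \<le> ?t" "?t \<le> T" using T_pos le step(1) by auto
      note m = lagr_ball_measures[OF N t]
      have lip: "wasserstein (lagrangian_step V a (lagr N ?t)) (lagrangian_step V s (lagr N ?t)) \<le> ennreal (M * (s - a))"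
        if "a \<le> s" for a
        using lagrangian_step_time_lipschitz[OF m, of a s] that by (simp add: M_def)
      show "wasserstein (lagr N u) (lagr N (?t + s)) \<le> ennreal (M * (?t + s - u))"
      proof (cases "u \<le> ?t")
        case True
        have "wasserstein (lagr N u) (lagr N ?t) \<le> ennreal (M * (?t - u))"
          using step(3) t(2) u True by blast
        moreover have "wasserstein (lagr N ?t) (lagr N (?t + s)) \<le> ennreal (M * s)"
          using lip[of 0] step(1) unfolding lagr_step[OF N step(1,2)]
          unfolding lagrangian_step_0[OF ball_measuresD(1)[OF m]] by simp
        ultimately have "wasserstein (lagr N u) (lagr N (?t + s)) \<le> ennreal (M * (?t - u) + M * s)"
          using True M_pos step(1) by (intro wasserstein_triangle_real) auto
        then show ?thesis by (simp add: algebra_simps)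
      next
        case False
        define a where "a = u - ?t"
        have a: "0 < a" "a \<le> s" "u = ?t + a" using False u by (auto simp: a_def)
        have u: "lagr N u = lagrangian_step V a (lagr N ?t)"
          unfolding a(3) using a step by (intro lagr_step[OF N]) auto
        have "?t + s - u = s - a" using a(3) by simp
        then show ?thesis
          unfolding u lagr_step[OF N step(1,2)] using lip[OF a(2)] by (simp only:)
      qed
    qed
  qed
qed

lemma lagr_lipschitz:
  assumes N: "N \<ge> 1" and "s \<in> {0..T}" "t \<in> {0..T}"
  shows "wasserstein (lagr N s) (lagr N t) \<le> ennreal (M * \<bar>s - t\<bar>)"
proof (cases "s \<le> t")
  case True
  then show ?thesis using lagr_lipschitz_aux[OF N, of t] assms by auto
next
  case False
  then show ?thesis using lagr_lipschitz_aux[OF N, of s] assms by (auto simp: wasserstein_sym[of "lagr N s"])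
qed

end

lemma abs_continuous_on_interval_lipschitz:
  assumes K: "0 \<le> K" and lip: "\<And>u v. \<lbrakk>a \<le> u; u \<le> v; v \<le> b\<rbrakk> \<Longrightarrow> \<bar>g v - g u\<bar> \<le> K * (v - u)"
  shows "abs_continuous_on_interval a b g"
  unfolding abs_continuous_on_interval_def
proof (intro allI impI)
  fix \<epsilon> :: real assume \<epsilon>: "\<epsilon> > 0"
  show "\<exists>\<delta>>0. \<forall>D. finite D \<and> (\<forall>(u, v)\<in>D. a \<le> u \<and> u \<le> v \<and> v \<le> b) \<and>
       pairwise (\<lambda>(u, v) (u', v'). {u<..<v} \<inter> {u'<..<v'} = {}) D \<and> (\<Sum>(u, v)\<in>D. v - u) < \<delta>
       \<longrightarrow> (\<Sum>(u, v)\<in>D. \<bar>g v - g u\<bar>) < \<epsilon>"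
  proof (intro exI[of _ "\<epsilon> / (K + 1)"] conjI allI impI)
    show "\<epsilon> / (K + 1) > 0" using \<epsilon> K by simp
    fix D :: "(real \<times> real) set"
    assume D: "finite D \<and> (\<forall>(u, v)\<in>D. a \<le> u \<and> u \<le> v \<and> v \<le> b) \<and>
       pairwise (\<lambda>(u, v) (u', v'). {u<..<v} \<inter> {u'<..<v'} = {}) D \<and> (\<Sum>(u, v)\<in>D. v - u) < \<epsilon> / (K + 1)"
    have "(\<Sum>(u, v)\<in>D. \<bar>g v - g u\<bar>) \<le> (\<Sum>(u, v)\<in>D. K * (v - u))"
      using D lip by (intro sum_mono) (auto simp: split_beta)
    also have "\<dots> = K * (\<Sum>(u, v)\<in>D. v - u)"
      by (simp add: sum_distrib_left split_beta)
    also have "\<dots> \<le> K * (\<epsilon> / (K + 1))"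
      using D K by (intro mult_left_mono) auto
    also have "\<dots> < \<epsilon>" using K \<epsilon> by (simp add: field_simps)
    finally show "(\<Sum>(u, v)\<in>D. \<bar>g v - g u\<bar>) < \<epsilon>" .
  qed
qed

section \<open>Passing to the limit in the equation\<close>

context pvf_cauchy_problem
begin

context
  fixes \<mu> :: "real \<Rightarrow> (real ^ 'd) measure"
  assumes approx: "\<And>e m. e > 0 \<Longrightarrow> \<exists>N\<ge>m. N \<ge> 1 \<and> (\<forall>t\<in>{0..T}. wasserstein (lagr N t) (\<mu> t) \<le> ennreal e)"
begin

text \<open>The context assumption speaks of uniformly close curves with arbitrarily large
  \<open>N\<close> instead of a fixed subsequence; accuracies \<open>1 / real (Suc i)\<close>
  recover a convergent sequence.\<close>

lemma limit_ball_measures: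
  assumes t: "t \<in> {0..T}"
  shows "\<mu> t \<in> ball_measures R"
proof -
  have "\<exists>N\<ge>1. wasserstein (lagr N t) (\<mu> t) \<le> ennreal (1 / real (Suc i))" for i
    using approx[of "1 / real (Suc i)" 0] t by auto
  then obtain N where N: "\<And>i. N i \<ge> 1" "\<And>i. wasserstein (lagr (N i) t) (\<mu> t) \<le> ennreal (1 / real (Suc i))"
    by metis
  show ?thesis
  proof (rule ball_measures_wasserstein_closed)
    show "lagr (N i) t \<in> ball_measures R" for i
      using lagr_ball_measures[OF N(1)] t by auto
    show "(\<lambda>i. wasserstein (lagr (N i) t) (\<mu> t)) \<longlonglongrightarrow> 0"
    proof (rule ennreal_tendsto_0I)
      fix e :: real assume e: "e > 0"
      have "\<forall>\<^sub>F i in sequentially. 1 / real (Suc i) < e"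
        using order_tendstoD(2)[OF LIMSEQ_inverse_real_of_nat e] by (simp add: inverse_eq_divide)
      then show "\<forall>\<^sub>F i in sequentially. wasserstein (lagr (N i) t) (\<mu> t) \<le> ennreal e"
        by (rule eventually_mono) (meson N(2) ennreal_leI less_imp_le order_trans)
    qed
  qed
qed

lemma limit_initial: "\<mu> 0 = \<mu>\<^sub>0"
proof -
  have "wasserstein \<mu>\<^sub>0 (\<mu> 0) \<le> 0 + ennreal e" if e: "e > 0" for e
  proof -
    obtain N where "\<forall>t\<in>{0..T}. wasserstein (lagr N t) (\<mu> t) \<le> ennreal e"
      using approx[OF e, of 0] by blast
    from bspec[OF this, of 0] show ?thesis using T_pos by (simp add: lagr_0)
  qed
  then have "wasserstein \<mu>\<^sub>0 (\<mu> 0) \<le> 0" by (rule ennreal_le_epsilon)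
  then have "wasserstein \<mu>\<^sub>0 (\<mu> 0) = 0" by simp
  then show ?thesis by (rule wasserstein_eq_0_imp_eq[symmetric])
qed

lemma limit_lipschitz:
  assumes s: "s \<in> {0..T}" and t: "t \<in> {0..T}"
  shows "wasserstein (\<mu> s) (\<mu> t) \<le> ennreal (M * \<bar>s - t\<bar>)"
proof (rule ennreal_le_epsilon)
  fix e :: real assume e: "e > 0"
  then obtain N where N: "N \<ge> 1" "\<And>t. t \<in> {0..T} \<Longrightarrow> wasserstein (lagr N t) (\<mu> t) \<le> ennreal (e / 2)"
    using approx[of "e / 2" 0] by auto
  have "wasserstein (\<mu> s) (lagr N t) \<le> ennreal (e / 2 + M * \<bar>s - t\<bar>)"
    using N(2)[OF s] lagr_lipschitz[OF N(1) s t] e M_pos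
    by (intro wasserstein_triangle_real) (auto simp: wasserstein_sym[of "\<mu> s"])
  from wasserstein_triangle_real[OF this N(2)[OF t]] e M_pos
  have "wasserstein (\<mu> s) (\<mu> t) \<le> ennreal (M * \<bar>s - t\<bar> + e)" by (simp add: algebra_simps)
  then show "wasserstein (\<mu> s) (\<mu> t) \<le> ennreal (M * \<bar>s - t\<bar>) + ennreal e"
    using e M_pos by (simp add: ennreal_plus)
qed

lemma drift_limit_lipschitz:
  assumes "f \<in> test_functions"
  obtains K where "K \<ge> 0" "\<And>s t. s \<in> {0..T} \<Longrightarrow> t \<in> {0..T} \<Longrightarrow> \<bar>drift f (\<mu> s) - drift f (\<mu> t)\<bar> \<le> K * \<bar>s - t\<bar>"
proof -
  obtain K where K: "K \<ge> 0" "\<And>\<mu> \<nu> w. \<lbrakk>\<mu> \<in> ball_measures R; \<nu> \<in> ball_measures R; wasserstein \<mu> \<nu> \<le> ennreal w; 0 \<le> w\<rbrakk>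
      \<Longrightarrow> \<bar>drift f \<mu> - drift f \<nu>\<bar> \<le> K * w"
    using drift_lipschitz[OF assms R_pos] by blast
  show ?thesis
  proof (rule that[of "K * M"])
    show "0 \<le> K * M" using K M_pos by simp
    fix s t assume st: "s \<in> {0..T}" "t \<in> {0..T}"
    have "0 \<le> M * \<bar>s - t\<bar>" using M_pos by simp
    from K(2)[OF limit_ball_measures[OF st(1)] limit_ball_measures[OF st(2)] limit_lipschitz[OF st] this]
    show "\<bar>drift f (\<mu> s) - drift f (\<mu> t)\<bar> \<le> K * M * \<bar>s - t\<bar>" by (simp add: mult.assoc)
  qed
qed

lemma drift_limit_continuous:
  assumes "f \<in> test_functions"
  shows "continuous_on {0..T} (\<lambda>t. drift f (\<mu> t))"
proof -
  obtain K where "K \<ge> 0" "\<And>s t. s \<in> {0..T} \<Longrightarrow> t \<in> {0..T} \<Longrightarrow> \<bar>drift f (\<mu> s) - drift f (\<mu> t)\<bar> \<le> K * \<bar>s - t\<bar>"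
    using drift_limit_lipschitz[OF assms] by blast
  then show ?thesis
    by (intro lipschitz_on_continuous_on[of K] lipschitz_onI) (auto simp: dist_real_def)
qed

text \<open>On one step both the scheme and \<open>H\<close> advance by
  \<open>s * drift f (\<mu> ?t)\<close> up to an error proportional to \<open>s * e\<close>. The
  drift at the scheme is compared with the drift at the known limit, so these errors add up without
  being amplified.\<close>

lemma limit_integral_equation:
  assumes f: "f \<in> test_functions" and t: "t \<in> {0..T}"
  shows "integral\<^sup>L (\<mu> t) f = integral\<^sup>L \<mu>\<^sub>0 f + integral {0..t} (\<lambda>s. drift f (\<mu> s))"
proof -
  define H where "H t = integral {0..t} (\<lambda>s. drift f (\<mu> s))" for t
  have dH: "(H has_real_derivative drift f (\<mu> u)) (at u within {0..T})" if "u \<in> {0..T}" for u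
    unfolding H_def by (rule integral_has_real_derivative[OF drift_limit_continuous[OF f] that])
  obtain KG where KG: "KG \<ge> 0" "\<And>s t. s \<in> {0..T} \<Longrightarrow> t \<in> {0..T} \<Longrightarrow> \<bar>drift f (\<mu> s) - drift f (\<mu> t)\<bar> \<le> KG * \<bar>s - t\<bar>"
    using drift_limit_lipschitz[OF f] by blast
  obtain KD where KD: "KD \<ge> 0" "\<And>\<mu> \<nu> w. \<lbrakk>\<mu> \<in> ball_measures R; \<nu> \<in> ball_measures R; wasserstein \<mu> \<nu> \<le> ennreal w; 0 \<le> w\<rbrakk>
      \<Longrightarrow> \<bar>drift f \<mu> - drift f \<nu>\<bar> \<le> KD * w"
    using drift_lipschitz[OF f R_pos] by blast
  obtain KC where KC: "KC \<ge> 0" "\<And>\<mu> R s. \<mu> \<in> ball_measures R \<Longrightarrow>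
    \<bar>integral\<^sup>L (lagrangian_step V s \<mu>) f - integral\<^sup>L \<mu> f - s * drift f \<mu>\<bar> \<le> KC * (s * (C * (1 + R)))\<^sup>2"
    using lagrangian_step_consistent[OF f] by blast
  obtain B KF where B: "\<And>x. \<bar>f x\<bar> \<le> B" and KF: "KF \<ge> 0" "\<And>x y. \<bar>f x - f y\<bar> \<le> KF * dist x y"
    using test_function_bounds[OF f] by metis
  \<comment> \<open>The increment of \<open>H\<close> is \<open>s\<close> times the drift at an
    intermediate time, and the drift is Lipschitz in time.\<close>
  have Hstep: "\<bar>H (a + s) - H a - s * drift f (\<mu> a)\<bar> \<le> KG * s * s" if a: "0 \<le> a" "a + s \<le> T" and s: "0 < s" for a s
  proof -
    have "\<exists>z\<in>{a<..<a+s}. H (a + s) - H a = drift f (\<mu> z) * (a + s - a)"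
    proof (rule mvt_simple)
      fix u assume u: "a \<le> u" "u \<le> a + s"
      then have "(H has_real_derivative drift f (\<mu> u)) (at u within {a..a+s})"
        using a by (intro DERIV_subset[OF dH]) auto
      then show "(H has_derivative (\<lambda>x. drift f (\<mu> u) * x)) (at u within {a..a+s})"
        by (simp add: has_field_derivative_def)
    qed (use s in simp)
    then obtain z where z: "z \<in> {a<..<a+s}" "H (a + s) - H a = s * drift f (\<mu> z)" by (auto simp: mult.commute)
    have "\<bar>H (a + s) - H a - s * drift f (\<mu> a)\<bar> = s * \<bar>drift f (\<mu> z) - drift f (\<mu> a)\<bar>"
      unfolding z(2) right_diff_distrib[symmetric] using s by (simp add: abs_mult)
    also have "\<dots> \<le> s * (KG * \<bar>z - a\<bar>)"
      using z(1) a s by (intro mult_left_mono KG(2)) auto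
    also have "\<dots> \<le> s * (KG * s)"
      using z(1) s KG(1) by (intro mult_left_mono) auto
    finally show ?thesis by (simp add: mult.commute mult.left_commute)
  qed
  \<comment> \<open>Three errors per unit of time: the Taylor remainder, the drift taken at the
    scheme instead of the limit, and the replacement of the integral by its left endpoint
    value.\<close>
  define Q where "Q = KC * M\<^sup>2 + KD + KG"
  have Q: "Q \<ge> 0" using KC(1) KD(1) KG(1) by (simp add: Q_def)
  have "\<bar>integral\<^sup>L (\<mu> t) f - (integral\<^sup>L \<mu>\<^sub>0 f + H t)\<bar> \<le> 0 + (T * Q + KF) * e" if e: "e > 0" for e
  proof -
    obtain m where m: "T / e < real m" using reals_Archimedean2 by blast
    obtain N where N: "N \<ge> m" "N \<ge> 1" "\<And>t. t \<in> {0..T} \<Longrightarrow> wasserstein (lagr N t) (\<mu> t) \<le> ennreal e"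
      using approx[OF e, of m] by blast
    have "T / e < real N" using m N(1) by linarith
    then have De: "T / real N \<le> e" using e N(2) by (simp add: field_simps)
    have D: "T / real N > 0" using N T_pos by simp
    have t0: "0 \<le> t" using t by simp
    have "t \<le> T \<longrightarrow> \<bar>integral\<^sup>L (lagr N t) f - (integral\<^sup>L \<mu>\<^sub>0 f + H t)\<bar> \<le> t * (Q * e)"
      using D t0
    proof (induction t rule: time_step_induct)
      case zero
      show ?case by (simp add: lagr_0 H_def)
    next
      case (step k s)
      let ?t = "real k * (T / real N)"
      show ?case
      proof
        assume le: "?t + s \<le> T"
        have t: "0 \<le> ?t" "?t \<le> T" using T_pos le step(1) by auto
        note m = lagr_ball_measures[OF N(2) t]
        have se: "s \<le> e" using step(2) De by linarith
        have 1: "\<bar>integral\<^sup>L (lagr N (?t + s)) f - integral\<^sup>L (lagr N ?t) f - s * drift f (lagr N ?t)\<bar> \<le> s * (KC * M\<^sup>2 * e)"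
        proof -
          have "\<bar>integral\<^sup>L (lagr N (?t + s)) f - integral\<^sup>L (lagr N ?t) f - s * drift f (lagr N ?t)\<bar> \<le> KC * (s * M)\<^sup>2"
            using KC(2)[OF m, of s] unfolding lagr_step[OF N(2) step(1,2)] by (simp add: M_def)
          also have "\<dots> = (s * (KC * M\<^sup>2)) * s" by (simp add: power2_eq_square)
          also have "\<dots> \<le> (s * (KC * M\<^sup>2)) * e" using se step(1) KC(1) by (intro mult_left_mono) auto
          finally show ?thesis by (simp add: mult.assoc)
        qed
        have 2: "\<bar>s * drift f (lagr N ?t) - s * drift f (\<mu> ?t)\<bar> \<le> s * (KD * e)"
        proof -
          have "\<bar>drift f (lagr N ?t) - drift f (\<mu> ?t)\<bar> \<le> KD * e"
            using t e by (intro KD(2) m limit_ball_measures N(3)) auto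
          then have "s * \<bar>drift f (lagr N ?t) - drift f (\<mu> ?t)\<bar> \<le> s * (KD * e)"
            using step(1) by (intro mult_left_mono) auto
          then show ?thesis using step(1) by (simp add: right_diff_distrib[symmetric] abs_mult)
        qed
        have 3: "\<bar>H (?t + s) - H ?t - s * drift f (\<mu> ?t)\<bar> \<le> s * (KG * e)"
        proof -
          have "(KG * s) * s \<le> (KG * s) * e" using se step(1) KG(1) by (intro mult_left_mono) auto
          then show ?thesis using Hstep[OF t(1) le step(1)] by (simp add: mult.commute mult.left_commute)
        qed
        have 4: "\<bar>integral\<^sup>L (lagr N ?t) f - (integral\<^sup>L \<mu>\<^sub>0 f + H ?t)\<bar> \<le> ?t * (Q * e)"
          using step(3) t by blast
        have "(?t + s) * (Q * e) = ?t * (Q * e) + s * (KC * M\<^sup>2 * e) + s * (KD * e) + s * (KG * e)"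
          by (simp add: Q_def algebra_simps)
        with 1 2 3 4 show "\<bar>integral\<^sup>L (lagr N (?t + s)) f - (integral\<^sup>L \<mu>\<^sub>0 f + H (?t + s))\<bar> \<le> (?t + s) * (Q * e)"
          by linarith
      qed
    qed
    moreover have "t * (Q * e) \<le> T * (Q * e)" using t Q e by (intro mult_right_mono) auto
    \<comment> \<open>Replacing the scheme by its limit in the left-hand side is done once, at the
      final time, and accounts for the term \<open>KF\<close>.\<close>
    moreover have "\<bar>integral\<^sup>L (lagr N t) f - integral\<^sup>L (\<mu> t) f\<bar> \<le> KF * e"
      using e by (intro wasserstein_integral_diff_le[OF N(3)[OF t] _ KF(2,1) B]) auto
    ultimately show ?thesis using t by (simp add: algebra_simps)
  qed
  note bound = this
  have "\<bar>integral\<^sup>L (\<mu> t) f - (integral\<^sup>L \<mu>\<^sub>0 f + H t)\<bar> \<le> 0"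
  proof (rule field_le_epsilon)
    fix e :: real assume e: "e > 0"
    define q where "q = T * Q + KF + 1"
    have q: "q > 0" "T * Q + KF \<le> q" using T_pos Q KF(1) by (auto simp: q_def add_nonneg_pos)
    have "(T * Q + KF) * (e / q) \<le> q * (e / q)" using q e by (intro mult_right_mono) auto
    with bound[of "e / q"] q e show "\<bar>integral\<^sup>L (\<mu> t) f - (integral\<^sup>L \<mu>\<^sub>0 f + H t)\<bar> \<le> 0 + e" by simp
  qed
  then show ?thesis by (simp add: H_def)
qed

theorem limit_is_solution: "is_solution V T \<mu>\<^sub>0 \<mu>"
  unfolding is_solution_def
proof (intro conjI ballI)
  fix t assume "t \<in> {0..T}"
  then show "\<mu> t \<in> prob_measures" using limit_ball_measures ball_measuresD(1) by blast
next
  show "\<mu> 0 = \<mu>\<^sub>0" by (rule limit_initial)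
next
  fix f :: "real ^ 'd \<Rightarrow> real" assume f: "f \<in> test_functions"
  show "AE t in lebesgue. t \<in> {0..T} \<longrightarrow> integrable (V (\<mu> t)) (\<lambda>(x, v). grad f x \<bullet> v)"
    using drift_integrable[OF f limit_ball_measures] by (intro AE_I2) auto
  have d: "(\<integral>(x, v). grad f x \<bullet> v \<partial>V (\<mu> t)) = drift f (\<mu> t)" for t by (simp add: drift_def)
  show "set_integrable lebesgue {0..T} (\<lambda>t. \<integral>(x, v). grad f x \<bullet> v \<partial>V (\<mu> t))"
    unfolding d using absolutely_integrable_continuous_real[OF drift_limit_continuous[OF f]] .
  obtain B K where B: "\<And>x. \<bar>f x\<bar> \<le> B" and K: "K \<ge> 0" "\<And>x y. \<bar>f x - f y\<bar> \<le> K * dist x y"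
    using test_function_bounds[OF f] by metis
  show "abs_continuous_on_interval 0 T (\<lambda>t. \<integral>x. f x \<partial>\<mu> t)"
  proof (rule abs_continuous_on_interval_lipschitz)
    show "0 \<le> K * M" using K(1) M_pos by simp
    fix u v assume "0 \<le> u" "u \<le> v" "v \<le> T"
    then show "\<bar>integral\<^sup>L (\<mu> v) f - integral\<^sup>L (\<mu> u) f\<bar> \<le> K * M * (v - u)"
      using wasserstein_integral_diff_le[OF limit_lipschitz[of v u], of f K B] B K M_pos by (simp add: mult.assoc)
  qed
  \<comment> \<open>The drift is continuous along the limit curve, so the fundamental theorem of
    calculus gives the derivative at every interior time.\<close>
  show "AE t in lebesgue. t \<in> {0<..<T} \<longrightarrow>
    ((\<lambda>t. \<integral>x. f x \<partial>\<mu> t) has_real_derivative (\<integral>(x, v). grad f x \<bullet> v \<partial>V (\<mu> t))) (at t)"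
    unfolding d
  proof (intro AE_I2 impI)
    fix t assume t: "t \<in> {0<..<T}"
    then have "((\<lambda>t. integral {0..t} (\<lambda>s. drift f (\<mu> s))) has_real_derivative drift f (\<mu> t)) (at t within {0..T})"
      by (intro integral_has_real_derivative drift_limit_continuous[OF f]) auto
    then have "((\<lambda>t. integral {0..t} (\<lambda>s. drift f (\<mu> s))) has_real_derivative drift f (\<mu> t)) (at t)"
      using t by (simp add: at_within_Icc_at)
    then have "((\<lambda>t. integral\<^sup>L \<mu>\<^sub>0 f + integral {0..t} (\<lambda>s. drift f (\<mu> s))) has_real_derivative drift f (\<mu> t)) (at t)"
      by (auto intro!: derivative_eq_intros)
    then show "((\<lambda>t. integral\<^sup>L (\<mu> t) f) has_real_derivative drift f (\<mu> t)) (at t)"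
      by (rule has_field_derivative_transform_within_open[where S="{0<..<T}"])
        (use t limit_integral_equation[OF f] in auto)
  qed
qed

end

end

section \<open>Lattice approximate solutions\<close>

text \<open>The lower corner of the half-open cell containing a point, defined on the whole space
  and thus also beyond the truncated grids.\<close>

definition grid_floor :: "real \<Rightarrow> real ^ 'd::finite \<Rightarrow> real ^ 'd" where
  "grid_floor h x = (\<chi> i. h * of_int \<lfloor>x $ i / h\<rfloor>)"

lemma grid_floor_measurable [measurable]: "(grid_floor h :: real ^ 'd::finite \<Rightarrow> real ^ 'd) \<in> borel_measurable borel"
proof -
  have "(\<lambda>x::real ^ 'd. grid_floor h x \<bullet> axis i 1) \<in> borel_measurable borel" for i
    unfolding grid_floor_def by (simp add: inner_axis)
  then show ?thesis
    by (subst borel_measurable_euclidean_space) (auto simp: Basis_vec_def)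
qed

lemma norm_grid_floor_diff_le:
  fixes x :: "real ^ 'd::finite"
  assumes "h > 0"
  shows "norm (grid_floor h x - x) \<le> real CARD('d) * h"
proof -
  have "\<bar>(grid_floor h x - x) $ i\<bar> \<le> h" for i
  proof -
    have "\<bar>of_int \<lfloor>x $ i / h\<rfloor> - x $ i / h\<bar> \<le> 1" by linarith
    then have "h * \<bar>of_int \<lfloor>x $ i / h\<rfloor> - x $ i / h\<bar> \<le> h * 1"
      using assms by (intro mult_left_mono) auto
    also have "h * \<bar>of_int \<lfloor>x $ i / h\<rfloor> - x $ i / h\<bar> = \<bar>h * (of_int \<lfloor>x $ i / h\<rfloor> - x $ i / h)\<bar>"
      using assms by (simp add: abs_mult)
    also have "h * (of_int \<lfloor>x $ i / h\<rfloor> - x $ i / h) = (grid_floor h x - x) $ i"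
      using assms by (simp add: grid_floor_def right_diff_distrib)
    finally show ?thesis by simp
  qed
  then have "(\<Sum>i\<in>UNIV. \<bar>(grid_floor h x - x) $ i\<bar>) \<le> (\<Sum>i\<in>(UNIV::'d set). h)"
    by (intro sum_mono) auto
  then show ?thesis using norm_le_l1_cart[of "grid_floor h x - x"] by simp
qed

lemma grid_floor_cell:
  assumes "h > 0" "x \<in> lattice_box h r" "y \<in> cell h x"
  shows "grid_floor h y = x"
  unfolding vec_eq_iff
proof
  fix i
  obtain z :: int where z: "x $ i = h * of_int z"
    using assms(2) by (auto simp: lattice_box_def)
  have "x $ i \<le> y $ i" "y $ i < x $ i + h" using assms(3) by (auto simp: cell_def)
  then have "of_int z \<le> y $ i / h" "y $ i / h < of_int z + 1"
    using assms(1) z by (simp_all add: le_divide_eq divide_less_eq mult.commute distrib_left)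
  then have "\<lfloor>y $ i / h\<rfloor> = z" by linarith
  then show "grid_floor h y $ i = x $ i" by (simp add: grid_floor_def z)
qed

lemma finite_lattice_box:
  assumes "h > 0"
  shows "finite (lattice_box h r :: (real ^ 'd::finite) set)"
proof -
  define B where "B = \<lceil>r / h\<rceil>"
  have "(lattice_box h r :: (real ^ 'd) set) \<subseteq> (\<lambda>g. \<chi> i. h * of_int (g i)) ` (PiE UNIV (\<lambda>_. {-B..B}))"
  proof
    fix x :: "real ^ 'd" assume x: "x \<in> lattice_box h r"
    then have "\<forall>i. \<exists>z::int. x $ i = h * of_int z" by (auto simp: lattice_box_def)
    then obtain g :: "'d \<Rightarrow> int" where g: "\<And>i. x $ i = h * of_int (g i)" by metis
    have "g i \<in> {-B..B}" for i
    proof -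
      have "\<bar>x $ i\<bar> \<le> r" using x by (auto simp: lattice_box_def)
      then have "h * \<bar>of_int (g i)\<bar> \<le> r" using assms by (simp add: g abs_mult)
      then have "\<bar>real_of_int (g i)\<bar> \<le> r / h" using assms by (simp add: le_divide_eq mult.commute)
      then have "\<bar>g i\<bar> \<le> B" unfolding B_def by linarith
      then show ?thesis by auto
    qed
    then show "x \<in> (\<lambda>g. \<chi> i. h * of_int (g i)) ` (PiE UNIV (\<lambda>_. {-B..B}))"
      using g by (intro image_eqI[of _ _ g]) (auto simp: vec_eq_iff)
  qed
  moreover have "finite (PiE (UNIV :: 'd set) (\<lambda>_. {-B..B}))"
    by (intro finite_PiE) auto
  ultimately show ?thesis using finite_surj by blast
qed

lemma borel_cell [measurable]: "cell h (x :: real ^ 'd::finite) \<in> sets borel"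
proof -
  have "cell h x = (\<Inter>i. {y. x $ i \<le> y $ i} \<inter> {y. y $ i < x $ i + h})"
    by (auto simp: cell_def)
  also have "\<dots> \<in> sets borel"
    by (intro sets.countable_INT'' sets.Int borel_closed borel_open closed_Collect_le open_Collect_less continuous_intros) auto
  finally show ?thesis .
qed

section \<open>Sums of Dirac masses as push-forwards\<close>

text \<open>Total mass 1 says that the cells cover almost every point. They are disjoint because
  \<open>r\<close> recovers the index from any point of a cell, so both sides give a Borel set the
  mass of the same cells.\<close>

lemma distr_point_measure_cells:
  fixes \<phi> :: "'g \<Rightarrow> 'c::topological_space"
  assumes M: "prob_space M" and G: "finite G"
    and K: "\<And>g. g \<in> G \<Longrightarrow> K g \<in> sets M" "\<And>g y. g \<in> G \<Longrightarrow> y \<in> K g \<Longrightarrow> r y = g"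
    and meas: "(\<lambda>y. \<phi> (r y)) \<in> borel_measurable M"
    and prob: "prob_space (distr (point_measure G (\<lambda>g. emeasure M (K g))) borel \<phi>)"
  shows "distr (point_measure G (\<lambda>g. emeasure M (K g))) borel \<phi> = distr M borel (\<lambda>y. \<phi> (r y))"
proof -
  interpret prob_space M by fact
  let ?P = "point_measure G (\<lambda>g. emeasure M (K g))"
  have m: "\<phi> \<in> borel_measurable ?P" by simp
  have sum: "emeasure M (\<Union>g\<in>G'. K g) = (\<Sum>g\<in>G'. emeasure M (K g))" if "G' \<subseteq> G" for G'
  proof (rule sum_emeasure[symmetric])
    show "disjoint_family_on K G'"
      unfolding disjoint_family_on_def
    proof (intro ballI impI equals0I)
      fix g g' y assume "g \<in> G'" "g' \<in> G'" "g \<noteq> g'" "y \<in> K g \<inter> K g'"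
      then show False using K(2)[of g y] K(2)[of g' y] that by auto
    qed
  qed (use that K(1) G finite_subset in auto)
  have "prob_space ?P" using prob_space_distrD[OF m prob] .
  then have "emeasure ?P G = 1" using prob_space.emeasure_space_1 by (fastforce simp: space_point_measure)
  then have "emeasure M (\<Union>g\<in>G. K g) = 1"
    using G by (simp add: sum emeasure_point_measure_finite)
  moreover have U: "(\<Union>g\<in>G. K g) \<in> sets M" using G K(1) by auto
  ultimately have ae: "AE y in M. y \<in> (\<Union>g\<in>G. K g)"
    using emeasure_eq_1_AE prob_space_axioms by (metis AE_in_set_eq_1 emeasure_eq_measure ennreal_eq_1)
  show ?thesis
  proof (rule measure_eqI)
    fix A assume "A \<in> sets (distr ?P borel \<phi>)"
    then have A: "A \<in> sets borel" by simp
    let ?G = "{g \<in> G. \<phi> g \<in> A}"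
    have "emeasure (distr ?P borel \<phi>) A = emeasure ?P ?G"
      using A by (simp add: emeasure_distr[OF m] space_point_measure vimage_def Int_def conj_commute)
    also have "\<dots> = (\<Sum>g\<in>?G. emeasure M (K g))"
      using G by (intro emeasure_point_measure_finite) auto
    also have "\<dots> = emeasure M (\<Union>g\<in>?G. K g)"
      by (rule sum[symmetric]) auto
    also have "\<dots> = emeasure M ((\<lambda>y. \<phi> (r y)) -` A \<inter> space M)"
    proof (rule emeasure_eq_AE)
      show "AE y in M. (y \<in> (\<Union>g\<in>?G. K g)) = (y \<in> (\<lambda>y. \<phi> (r y)) -` A \<inter> space M)"
        using ae AE_space by eventually_elim (use K(2) in auto)
      show "(\<Union>g\<in>?G. K g) \<in> sets M" using G K(1) by auto
      show "(\<lambda>y. \<phi> (r y)) -` A \<inter> space M \<in> sets M" using measurable_sets[OF meas A] .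
    qed
    also have "\<dots> = emeasure (distr M borel (\<lambda>y. \<phi> (r y))) A"
      using A by (simp add: emeasure_distr[OF meas])
    finally show "emeasure (distr ?P borel \<phi>) A = emeasure (distr M borel (\<lambda>y. \<phi> (r y))) A" .
  qed simp
qed

lemma las_initial_eq:
  fixes \<mu> :: "(real ^ 'd::finite) measure"
  assumes "T > 0" "N \<ge> 1" and \<mu>: "\<mu> \<in> prob_measures" and p: "las_initial T N \<mu> \<in> prob_measures"
  shows "las_initial T N \<mu> = distr \<mu> borel (grid_floor (T / (real N)\<^sup>2))"
proof -
  have h: "T / (real N)\<^sup>2 > 0" using assms by simp
  show ?thesis
    unfolding las_initial_def
  proof (rule distr_point_measure_cells)
    show "finite (las_space_grid T N :: (real ^ 'd) set)"
      unfolding las_space_grid_def by (rule finite_lattice_box[OF h])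
    show "grid_floor (T / (real N)\<^sup>2) y = g" if "g \<in> las_space_grid T N" "y \<in> cell (T / (real N)\<^sup>2) g" for g y :: "real ^ 'd"
      using grid_floor_cell[OF h] that unfolding las_space_grid_def by blast
    show "prob_space (distr (point_measure (las_space_grid T N) (\<lambda>x. emeasure \<mu> (cell (T / (real N)\<^sup>2) x))) borel (\<lambda>x. x))"
      using prob_measuresD(1)[OF p] by (simp add: las_initial_def)
  qed (use prob_measuresD[OF \<mu>] in \<open>auto simp: measurable_cong_sets[OF prob_measuresD(2)[OF \<mu>] refl]\<close>)
qed

context lipschitz_pvf
begin

text \<open>The cells are single positions times velocity cells. Full mass places almost every
  position on the grid, so a step keeps positions and rounds only velocities.\<close>

lemma las_step_eq:
  assumes "T > 0" "N \<ge> 1" and \<mu>: "\<mu> \<in> prob_measures" and p: "las_step V T N s \<mu> \<in> prob_measures"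
  shows "las_step V T N s \<mu> = distr (V \<mu>) borel (\<lambda>p. fst p + s *\<^sub>R grid_floor (1 / real N) (snd p))"
proof -
  have h: "T / (real N)\<^sup>2 > 0" "1 / real N > 0" using assms by auto
  note v = V_props[OF \<mu>]
  define K :: "(real ^ 'd) \<times> (real ^ 'd) \<Rightarrow> ((real ^ 'd) \<times> (real ^ 'd)) set"
    where "K g = {fst g} \<times> cell (1 / real N) (snd g)" for g
  define \<phi> :: "(real ^ 'd) \<times> (real ^ 'd) \<Rightarrow> real ^ 'd" where "\<phi> g = fst g + s *\<^sub>R snd g" for g
  have eq: "las_step V T N s \<mu> = distr (point_measure (las_space_grid T N \<times> las_velocity_grid N) (\<lambda>g. emeasure (V \<mu>) (K g))) borel \<phi>"
    by (simp add: las_step_def K_def[abs_def] \<phi>_def[abs_def] split_beta')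
  have "\<dots> = distr (V \<mu>) borel (\<lambda>y. \<phi> (fst y, grid_floor (1 / real N) (snd y)))"
  proof (rule distr_point_measure_cells)
    show "prob_space (V \<mu>)" by (rule v)
    show "finite (las_space_grid T N \<times> las_velocity_grid N :: ((real ^ 'd) \<times> (real ^ 'd)) set)"
      unfolding las_space_grid_def las_velocity_grid_def by (intro finite_cartesian_product finite_lattice_box h)
    show "K g \<in> sets (V \<mu>)" for g
      unfolding v(2) K_def borel_prod[symmetric] by (intro pair_measureI) auto
    show "(fst y, grid_floor (1 / real N) (snd y)) = g"
      if "g \<in> las_space_grid T N \<times> las_velocity_grid N" "y \<in> K g" for g y
      using that grid_floor_cell[OF h(2), of "snd g" "real N" "snd y"]
      by (auto simp: K_def las_velocity_grid_def)
    show "(\<lambda>y. \<phi> (fst y, grid_floor (1 / real N) (snd y))) \<in> borel_measurable (V \<mu>)"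
      using measurable_rounded_step[OF \<mu> grid_floor_measurable] by (simp add: \<phi>_def)
    show "prob_space (distr (point_measure (las_space_grid T N \<times> las_velocity_grid N) (\<lambda>g. emeasure (V \<mu>) (K g))) borel \<phi>)"
      using prob_measuresD(1)[OF p] eq by simp
  qed
  then show ?thesis by (simp add: eq \<phi>_def)
qed

end

context pvf_cauchy_problem
begin

lemma las_step:
  assumes "N \<ge> 1" "0 < s" "s \<le> T / real N"
  shows "las V T \<mu>\<^sub>0 N (real k * (T / real N) + s) = las_step V T N s (las V T \<mu>\<^sub>0 N (real k * (T / real N)))"
proof -
  define D where "D = T / real N"
  have "D > 0" "s \<le> D" using assms T_pos by (auto simp: D_def)
  then have "scheme (las_step V T N) D m (real k * D + s) = las_step V T N s (scheme (las_step V T N) D m (real k * D))" for m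
    using assms(2) by (subst scheme_recursion[of D k]) (auto simp: distrib_right)
  then show ?thesis by (simp add: las_def D_def)
qed

context
  fixes N :: nat
  assumes N: "N \<ge> 1" and prob: "\<forall>t\<in>{0..T}. las V T \<mu>\<^sub>0 N t \<in> prob_measures"
begin

lemma las_0: "las V T \<mu>\<^sub>0 N 0 = distr \<mu>\<^sub>0 borel (grid_floor (T / (real N)\<^sup>2))"
proof -
  have "las V T \<mu>\<^sub>0 N 0 = las_initial T N \<mu>\<^sub>0" by (simp add: las_def scheme_0)
  with las_initial_eq[OF T_pos N ball_measuresD(1)[OF initial]] bspec[OF prob, of 0] T_pos show ?thesis by simp
qed

lemma las_step_rounded:
  assumes "0 < s" "s \<le> T / real N" "real k * (T / real N) + s \<le> T"
  shows "las V T \<mu>\<^sub>0 N (real k * (T / real N) + s) =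
    distr (V (las V T \<mu>\<^sub>0 N (real k * (T / real N)))) borel (\<lambda>p. fst p + s *\<^sub>R grid_floor (1 / real N) (snd p))"
proof -
  let ?t = "real k * (T / real N)"
  have t: "0 \<le> ?t" using T_pos by simp
  have "?t \<in> {0..T}" "?t + s \<in> {0..T}" using t assms by auto
  from las_step_eq[OF T_pos N bspec[OF prob this(1)], of s] bspec[OF prob this(2)]
  show ?thesis unfolding las_step[OF N assms(1,2)] by blast
qed

lemma grid_widths: "T / (real N)\<^sup>2 > 0" "T / (real N)\<^sup>2 \<le> T / real N" "T / real N \<le> T" "1 / real N > 0" "1 / real N \<le> 1"
proof -
  show "T / (real N)\<^sup>2 \<le> T / real N"
    using N T_pos by (intro divide_left_mono) (auto simp: power2_eq_square)
qed (use N T_pos in \<open>auto simp: divide_le_eq\<close>)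

lemma las_ball_measures:
  assumes t: "0 \<le> t" "t \<le> T"
  shows "las V T \<mu>\<^sub>0 N t \<in> ball_measures R"
proof -
  have D: "T / real N > 0" using N T_pos by simp
  define d where "d = real CARD('d)"
  have d: "d > 0" unfolding d_def by simp
  define a where "a = 1 + (R\<^sub>0 + T * d)"
  have a: "a \<ge> 1" using R0_nonneg T_pos d by (simp add: a_def)
  have "t \<le> T \<longrightarrow> las V T \<mu>\<^sub>0 N t \<in> ball_measures (a * exp ((C + d) * t) - 1)"
    using D t(1)
  proof (induction t rule: time_step_induct)
    case zero
    have "las V T \<mu>\<^sub>0 N 0 \<in> ball_measures (R\<^sub>0 + T * d)"
      unfolding las_0
    proof (rule distr_in_ball_measures)
      show "prob_space \<mu>\<^sub>0" by (rule ball_measuresD[OF initial])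
      show "grid_floor (T / (real N)\<^sup>2) \<in> borel_measurable \<mu>\<^sub>0"
        by (simp add: measurable_cong_sets[OF ball_measuresD(4)[OF initial] refl])
      show "AE x in \<mu>\<^sub>0. norm (grid_floor (T / (real N)\<^sup>2) x) \<le> R\<^sub>0 + T * d"
        using ball_measuresD(2)[OF initial]
      proof eventually_elim
        case (elim x)
        have "norm (grid_floor (T / (real N)\<^sup>2) x) \<le> norm x + norm (grid_floor (T / (real N)\<^sup>2) x - x)"
          by (metis add.commute diff_add_cancel norm_triangle_ineq)
        moreover have "norm (grid_floor (T / (real N)\<^sup>2) x - x) \<le> d * (T / (real N)\<^sup>2)"
          unfolding d_def by (rule norm_grid_floor_diff_le[OF grid_widths(1)])
        moreover have "d * (T / (real N)\<^sup>2) \<le> d * T"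
          using grid_widths(2,3) d by (intro mult_left_mono) auto
        ultimately show ?case using elim by (simp add: mult.commute)
      qed
    qed
    then show ?case by (simp add: a_def)
  next
    case (step k s)
    let ?t = "real k * (T / real N)"
    define b where "b = a * exp ((C + d) * ?t)"
    show ?case
    proof
      assume le: "?t + s \<le> T"
      have t0: "0 \<le> ?t" using T_pos by simp
      have "0 \<le> (C + d) * ?t" using C_pos d T_pos by (intro mult_nonneg_nonneg) auto
      then have "1 \<le> exp ((C + d) * ?t)" by (simp only: one_le_exp_iff)
      then have b: "1 \<le> b" unfolding b_def using a by (metis mult_mono mult_1 order.trans zero_le_one)
      have mem: "las V T \<mu>\<^sub>0 N ?t \<in> ball_measures (b - 1)"
        using step(3) le step(1) by (simp add: b_def)
      have "las V T \<mu>\<^sub>0 N (?t + s) \<in> ball_measures ((b - 1) + s * (C * (1 + (b - 1)) + d * (1 / real N)))"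
        unfolding las_step_rounded[OF step(1,2) le]
        using step(1) norm_grid_floor_diff_le[OF grid_widths(4)] unfolding d_def
        by (intro rounded_step_ball_measures[OF mem]) auto
      moreover have "(b - 1) + s * (C * (1 + (b - 1)) + d * (1 / real N)) \<le> a * exp ((C + d) * (?t + s)) - 1"
      proof -
        \<comment> \<open>Since \<open>b \<ge> 1\<close>, the rounding error of the velocity is
          absorbed into proportional growth; this turns the rate \<open>C\<close> into
          \<open>C + d\<close>.\<close>
        have "d * (1 / real N) \<le> d * b"
          using grid_widths(5) b d by (intro mult_left_mono) auto
        then have "s * (C * b + d * (1 / real N)) \<le> s * (C * b + d * b)"
          using step(1) by (intro mult_left_mono) auto
        then have "b + s * (C * b + d * (1 / real N)) \<le> b * (1 + s * (C + d))"
          by (simp add: algebra_simps)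
        also have "\<dots> \<le> a * exp ((C + d) * (?t + s))"
          unfolding b_def using a C_pos d step(1) by (intro exp_growth_step) auto
        finally show ?thesis by simp
      qed
      ultimately show "las V T \<mu>\<^sub>0 N (?t + s) \<in> ball_measures (a * exp ((C + d) * (?t + s)) - 1)"
        by (rule ball_measures_mono)
    qed
  qed
  moreover have "a * exp ((C + d) * t) - 1 \<le> R"
  proof -
    have "(C + d) * t \<le> (C + d) * T"
      using t C_pos d by (intro mult_left_mono) auto
    then have "a * exp ((C + d) * t) \<le> a * exp ((C + d) * T)"
      using a by (intro mult_left_mono) auto
    then show ?thesis by (simp add: R_def a_def d_def)
  qed
  ultimately show ?thesis using t by (auto elim: ball_measures_mono)
qed

end

section \<open>Comparison of the two schemes\<close>

text \<open>Discrete Gronwall: the initial error \<open>w0\<close> and the rounding rate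
  \<open>\<eta>\<close> are amplified by at most \<open>exp (L * t)\<close>. \<open>L\<close>
  belongs to the radius \<open>R\<close>, which confines both schemes for every \<open>N\<close>, so
  \<open>K\<close> is independent of \<open>N\<close>.\<close>

lemma lagr_las_distance:
  obtains K where "K \<ge> 0" "\<And>N t. \<lbrakk>N \<ge> 1; \<forall>t\<in>{0..T}. las V T \<mu>\<^sub>0 N t \<in> prob_measures; t \<in> {0..T}\<rbrakk> \<Longrightarrow>
    wasserstein (lagr N t) (las V T \<mu>\<^sub>0 N t) \<le> ennreal (K / real N)"
proof -
  obtain L where L: "L > 0" "\<And>\<mu> \<nu> w s \<eta> \<rho>. \<lbrakk>\<mu> \<in> ball_measures R; \<nu> \<in> ball_measures R; wasserstein \<mu> \<nu> \<le> ennreal w; 0 \<le> w; 0 \<le> s;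
      \<rho> \<in> borel_measurable borel; \<And>v. norm (\<rho> v - v) \<le> \<eta>\<rbrakk> \<Longrightarrow>
      wasserstein (lagrangian_step V s \<mu>) (distr (V \<nu>) borel (\<lambda>p. fst p + s *\<^sub>R \<rho> (snd p))) \<le> ennreal (w + s * (L * w + \<eta>))"
    using step_comparison[OF R_pos] by blast
  define d where "d = real CARD('d)"
  have d: "d > 0" unfolding d_def by simp
  show ?thesis
  proof (rule that)
    show "0 \<le> 2 * d * T * exp (L * T)" using d T_pos by simp
    fix N t assume N: "N \<ge> 1" and prob: "\<forall>t\<in>{0..T}. las V T \<mu>\<^sub>0 N t \<in> prob_measures" and t: "t \<in> {0..T}"
    have D: "T / real N > 0" using N T_pos by simp
    note widths = grid_widths[OF N prob]
    define \<eta> where "\<eta> = d * (1 / real N)"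
    define w0 where "w0 = d * (T / (real N)\<^sup>2)"
    have \<eta>: "\<eta> \<ge> 0" and w0: "w0 \<ge> 0" using d T_pos by (auto simp: \<eta>_def w0_def)
    have t0: "0 \<le> t" using t by simp
    have "t \<le> T \<longrightarrow> wasserstein (lagr N t) (las V T \<mu>\<^sub>0 N t) \<le> ennreal ((w0 + t * \<eta>) * exp (L * t))"
      using D t0
    proof (induction t rule: time_step_induct)
      case zero
      note p = ball_measuresD[OF initial]
      interpret prob_space \<mu>\<^sub>0 by (rule p)
      have "wasserstein (distr \<mu>\<^sub>0 borel (\<lambda>x. x)) (distr \<mu>\<^sub>0 borel (grid_floor (T / (real N)\<^sup>2)))
        \<le> (\<integral>\<^sup>+x. ennreal (dist x (grid_floor (T / (real N)\<^sup>2) x)) \<partial>\<mu>\<^sub>0)"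
        using p(4) by (intro wasserstein_coupling_le p) (auto simp: measurable_cong_sets[OF p(4) refl])
      also have "\<dots> \<le> (\<integral>\<^sup>+x. ennreal w0 \<partial>\<mu>\<^sub>0)"
        using norm_grid_floor_diff_le[OF widths(1), where 'd='d]
        by (intro nn_integral_mono ennreal_leI) (simp add: dist_norm norm_minus_commute w0_def d_def)
      finally show ?case
        by (simp add: las_0[OF N prob] lagr_0 emeasure_space_1 distr_id2 p(4))
    next
      case (step k s)
      let ?t = "real k * (T / real N)"
      define w where "w = (w0 + ?t * \<eta>) * exp (L * ?t)"
      show ?case
      proof
        assume le: "?t + s \<le> T"
        have t: "0 \<le> ?t" "?t \<le> T" using T_pos le step(1) by auto
        have w: "w \<ge> 0" unfolding w_def using w0 \<eta> T_pos by (intro mult_nonneg_nonneg add_nonneg_nonneg) auto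
        have IH: "wasserstein (lagr N ?t) (las V T \<mu>\<^sub>0 N ?t) \<le> ennreal w" using step(3) t by (simp add: w_def)
        have "wasserstein (lagr N (?t + s)) (las V T \<mu>\<^sub>0 N (?t + s)) \<le> ennreal (w + s * (L * w + \<eta>))"
          unfolding las_step_rounded[OF N prob step(1,2) le] lagr_step[OF N step(1,2)]
          using step(1) norm_grid_floor_diff_le[OF widths(4)]
          by (intro L(2)[OF lagr_ball_measures[OF N t] las_ball_measures[OF N prob t] IH w]) (auto simp: \<eta>_def d_def)
        also have "\<dots> \<le> ennreal ((w0 + (?t + s) * \<eta>) * exp (L * (?t + s)))"
        proof (rule ennreal_leI)
          have "w * (1 + s * L) \<le> (w0 + ?t * \<eta>) * exp (L * (?t + s))"
            unfolding w_def using L(1) step(1)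
            by (intro exp_growth_step add_nonneg_nonneg[OF w0 mult_nonneg_nonneg[OF t(1) \<eta>]]) auto
          \<comment> \<open>The rounding error made in this step is multiplied by a factor at least
            1, so that it fits under the common exponential.\<close>
          moreover have "s * \<eta> * 1 \<le> s * \<eta> * exp (L * (?t + s))"
            using step(1) \<eta> L(1) t(1) by (intro mult_left_mono) auto
          ultimately show "w + s * (L * w + \<eta>) \<le> (w0 + (?t + s) * \<eta>) * exp (L * (?t + s))"
            by (simp add: distrib_left distrib_right mult.assoc mult.commute mult.left_commute)
        qed
        finally show "wasserstein (lagr N (?t + s)) (las V T \<mu>\<^sub>0 N (?t + s)) \<le> ennreal ((w0 + (?t + s) * \<eta>) * exp (L * (?t + s)))" .
      qed
    qed
    moreover have "(w0 + t * \<eta>) * exp (L * t) \<le> 2 * d * T * exp (L * T) / real N"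
    proof -
      \<comment> \<open>The initial rounding and the accumulated velocity rounding are each at most
        \<open>d * T / real N\<close>, which explains the factor 2.\<close>
      have "w0 \<le> d * (T / real N)" unfolding w0_def using widths(2) d by (intro mult_left_mono) auto
      moreover have "t * \<eta> \<le> T * \<eta>" using t \<eta> by (intro mult_right_mono) auto
      moreover have "d * (T / real N) + T * \<eta> = 2 * d * T / real N" by (simp add: \<eta>_def field_simps)
      ultimately have "w0 + t * \<eta> \<le> 2 * d * T / real N" by linarith
      moreover have "exp (L * t) \<le> exp (L * T)" using t L(1) by simp
      ultimately have "(w0 + t * \<eta>) * exp (L * t) \<le> 2 * d * T / real N * exp (L * T)"
        using d T_pos by (intro mult_mono) auto
      then show ?thesis by simp
    qed
    ultimately show "wasserstein (lagr N t) (las V T \<mu>\<^sub>0 N t) \<le> ennreal (2 * d * T * exp (L * T) / real N)"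
      using t by (auto intro: order_trans ennreal_leI)
  qed
qed

section \<open>Convergent subsequences and equality of the limits\<close>

lemma curves_converge_small:
  assumes n: "filterlim n at_top sequentially" and conv: "curves_converge T (\<lambda>k. c (n k)) \<mu>" and e: "e > 0"
  shows "\<forall>\<^sub>F k in sequentially. \<forall>t\<in>{0..T}. wasserstein (c (n k) t) (\<mu> t) \<le> ennreal e"
  using ennreal_tendsto_0D[OF conv[unfolded curves_converge_def] e]
proof eventually_elim
  case (elim k)
  then show ?case by (meson SUP_upper less_imp_le order_trans)
qed

lemma lagr_converges_subseq:
  obtains r \<mu> where "strict_mono r" "\<And>k. r k \<ge> 1" "curves_converge T (\<lambda>k. lagr (r k)) \<mu>"
proof -
  obtain r \<mu> where r: "strict_mono (r :: nat \<Rightarrow> nat)"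
    "(\<lambda>k. SUP t\<in>{0..T}. wasserstein (lagr (Suc (r k)) t) (\<mu> t)) \<longlonglongrightarrow> 0"
  \<comment> \<open>Indices are shifted by one to exclude the degenerate step
    \<open>T / 0 = 0\<close>.\<close>
  proof (rule wasserstein_equi_Lipschitz_subseq[of T M "\<lambda>n. lagr (Suc n)" R])
    show "lagr (Suc n) t \<in> ball_measures R" if "t \<in> {0..T}" for n t
      using that by (intro lagr_ball_measures) auto
    show "wasserstein (lagr (Suc n) s) (lagr (Suc n) t) \<le> ennreal (M * \<bar>s - t\<bar>)" if "s \<in> {0..T}" "t \<in> {0..T}" for n s t
      using that by (intro lagr_lipschitz) auto
  qed (use T_pos M_pos in auto)
  show ?thesis
    by (rule that[of "\<lambda>k. Suc (r k)" \<mu>]) (use r in \<open>auto simp: strict_mono_def curves_converge_def\<close>)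
qed

lemma lagr_limit_approx:
  assumes n: "filterlim n at_top sequentially" and conv: "curves_converge T (\<lambda>k. lagr (n k)) \<mu>" and e: "e > 0"
  shows "\<exists>N\<ge>m. N \<ge> 1 \<and> (\<forall>t\<in>{0..T}. wasserstein (lagr N t) (\<mu> t) \<le> ennreal e)"
proof -
  have "\<forall>\<^sub>F k in sequentially. n k \<ge> max m 1" using n unfolding filterlim_at_top by blast
  with curves_converge_small[OF n conv e]
  have "\<forall>\<^sub>F k in sequentially. n k \<ge> max m 1 \<and> (\<forall>t\<in>{0..T}. wasserstein (lagr (n k) t) (\<mu> t) \<le> ennreal e)"
    by eventually_elim auto
  then show ?thesis by (auto simp: eventually_sequentially)
qed

text \<open>Triangle inequality through both schemes at one common \<open>N\<close>, with
  \<open>e / 3\<close> for each of the two convergences and for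
  \<open>lagr_las_distance\<close>.\<close>

lemma lagr_las_same_limit:
  assumes n: "filterlim n at_top sequentially" and \<mu>: "curves_converge T (\<lambda>k. lagr (n k)) \<mu>"
    and \<nu>: "curves_converge T (\<lambda>k. las V T \<mu>\<^sub>0 (n k)) \<nu>" and t: "t \<in> {0..T}"
  shows "\<mu> t = \<nu> t"
proof -
  obtain K where K: "K \<ge> 0" "\<And>N t. \<lbrakk>N \<ge> 1; \<forall>t\<in>{0..T}. las V T \<mu>\<^sub>0 N t \<in> prob_measures; t \<in> {0..T}\<rbrakk> \<Longrightarrow>
    wasserstein (lagr N t) (las V T \<mu>\<^sub>0 N t) \<le> ennreal (K / real N)"
    using lagr_las_distance by blast
  have "wasserstein (\<mu> t) (\<nu> t) \<le> 0 + ennreal e" if e: "e > 0" for e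
  proof -
    have e3: "e / 3 > 0" using e by simp
    obtain m where m: "K / (e / 3) < real m" using reals_Archimedean2 by blast
    have "\<forall>\<^sub>F k in sequentially. n k \<ge> max m 1" using n unfolding filterlim_at_top by blast
    with curves_converge_small[OF n \<mu> e3] curves_converge_small[where c="las V T \<mu>\<^sub>0", OF n \<nu> e3]
    have "\<forall>\<^sub>F k in sequentially. n k \<ge> max m 1 \<and> (\<forall>t\<in>{0..T}. wasserstein (lagr (n k) t) (\<mu> t) \<le> ennreal (e / 3))
      \<and> (\<forall>t\<in>{0..T}. wasserstein (las V T \<mu>\<^sub>0 (n k) t) (\<nu> t) \<le> ennreal (e / 3))"
      by eventually_elim auto
    then obtain N where N: "N \<ge> m" "N \<ge> 1" and 1: "\<And>t. t \<in> {0..T} \<Longrightarrow> wasserstein (lagr N t) (\<mu> t) \<le> ennreal (e / 3)"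
      and 2: "\<And>t. t \<in> {0..T} \<Longrightarrow> wasserstein (las V T \<mu>\<^sub>0 N t) (\<nu> t) \<le> ennreal (e / 3)"
      by (auto simp: eventually_sequentially)
    \<comment> \<open>A finite distance to the limit exists only for probability measures, so at
      this \<open>N\<close> the lattice scheme has full mass throughout
      \<open>{0..T}\<close>.\<close>
    have prob: "\<forall>t\<in>{0..T}. las V T \<mu>\<^sub>0 N t \<in> prob_measures"
    proof
      fix t assume "t \<in> {0..T}"
      from 2[OF this] have "wasserstein (las V T \<mu>\<^sub>0 N t) (\<nu> t) < \<infinity>"
        by (rule le_less_trans) simp
      then show "las V T \<mu>\<^sub>0 N t \<in> prob_measures" by (rule wasserstein_finite_prob_measures)
    qed
    have "K / (e / 3) < real N" using m N(1) by linarith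
    then have "K / real N \<le> e / 3" using e N(2) by (simp add: field_simps)
    then have 3: "wasserstein (lagr N t) (las V T \<mu>\<^sub>0 N t) \<le> ennreal (e / 3)"
      using K(2)[OF N(2) prob t] ennreal_leI order_trans by blast
    have "wasserstein (\<mu> t) (lagr N t) \<le> ennreal (e / 3)"
      using 1[OF t] by (simp add: wasserstein_sym[of "\<mu> t"])
    from wasserstein_triangle_real[OF this 3] e3
    have "wasserstein (\<mu> t) (las V T \<mu>\<^sub>0 N t) \<le> ennreal (e / 3 + e / 3)" by simp
    from wasserstein_triangle_real[OF this 2[OF t]] e3 show ?thesis by simp
  qed
  then have "wasserstein (\<mu> t) (\<nu> t) \<le> 0" by (rule ennreal_le_epsilon)
  then have "wasserstein (\<mu> t) (\<nu> t) = 0" by simp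
  then show ?thesis by (rule wasserstein_eq_0_imp_eq)
qed

end

theorem theorem4p1:
  fixes V :: "'d::finite pvf" and T :: real and \<mu>\<^sub>0 :: "(real ^ 'd) measure"
  assumes "T > 0"
    and "is_pvf V"
    and "\<forall>\<mu>\<in>prob_measures_c. V \<mu> \<in> prob_measures_c"
    and "H1 V"
    and "H3 V"
    and "\<mu>\<^sub>0 \<in> prob_measures_c"
  shows "(\<exists>r \<mu>. strict_mono r \<and> (\<forall>k. r k \<ge> 1) \<and>
             curves_converge T (\<lambda>k. lagrangian_scheme V T \<mu>\<^sub>0 (r k)) \<mu> \<and>
             is_solution V T \<mu>\<^sub>0 \<mu>) \<and>
         (\<forall>n \<mu> \<nu>. filterlim n at_top sequentially \<and>
             curves_converge T (\<lambda>k. lagrangian_scheme V T \<mu>\<^sub>0 (n k)) \<mu> \<and>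
             curves_converge T (\<lambda>k. las V T \<mu>\<^sub>0 (n k)) \<nu> \<longrightarrow>
             (\<forall>t\<in>{0..T}. \<mu> t = \<nu> t) \<and> is_solution V T \<mu>\<^sub>0 \<mu> \<and> is_solution V T \<mu>\<^sub>0 \<nu>)"
proof -
  obtain C where C: "C > 0" "\<forall>\<mu>\<in>prob_measures_c. (SUP (x, v)\<in>supp (V \<mu>). norm v) \<le> C * (1 + (SUP x\<in>supp \<mu>. norm x))"
    using assms(4) unfolding H1_def by blast
  obtain R where R: "R \<ge> 0" "\<mu>\<^sub>0 \<in> ball_measures R"
    using prob_measures_c_ball[OF assms(6)] .
  interpret pvf_cauchy_problem V C T \<mu>\<^sub>0 R
    using assms C R by unfold_locales
  show ?thesis
  proof (intro conjI allI impI)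
    obtain r \<mu> where r: "strict_mono r" "\<And>k. r k \<ge> 1" "curves_converge T (\<lambda>k. lagr (r k)) \<mu>"
      using lagr_converges_subseq by blast
    have "is_solution V T \<mu>\<^sub>0 \<mu>"
      by (rule limit_is_solution, rule lagr_limit_approx[OF filterlim_subseq[OF r(1)] r(3)])
    with r show "\<exists>r \<mu>. strict_mono r \<and> (\<forall>k. r k \<ge> 1) \<and> curves_converge T (\<lambda>k. lagr (r k)) \<mu> \<and> is_solution V T \<mu>\<^sub>0 \<mu>"
      by blast
  next
    fix n :: "nat \<Rightarrow> nat" and \<mu> \<nu>
    assume "filterlim n at_top sequentially \<and> curves_converge T (\<lambda>k. lagr (n k)) \<mu> \<and>
      curves_converge T (\<lambda>k. las V T \<mu>\<^sub>0 (n k)) \<nu>"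
    then have n: "filterlim n at_top sequentially" and \<mu>: "curves_converge T (\<lambda>k. lagr (n k)) \<mu>"
      and \<nu>: "curves_converge T (\<lambda>k. las V T \<mu>\<^sub>0 (n k)) \<nu>" by blast+
    show eq: "\<forall>t\<in>{0..T}. \<mu> t = \<nu> t"
      using lagr_las_same_limit[OF n \<mu> \<nu>] by blast
    show "is_solution V T \<mu>\<^sub>0 \<mu>"
      by (rule limit_is_solution, rule lagr_limit_approx[OF n \<mu>])
    \<comment> \<open>The curves agree only on \<open>{0..T}\<close> and may differ outside, so
      instead of substituting \<open>\<nu>\<close> for \<open>\<mu>\<close> the approximation
      property is transferred and the limit theorem applied again.\<close>
    have "\<exists>N\<ge>m. N \<ge> 1 \<and> (\<forall>t\<in>{0..T}. wasserstein (lagr N t) (\<nu> t) \<le> ennreal e)" if "e > 0" for e m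
      using lagr_limit_approx[OF n \<mu> that] eq by auto
    then show "is_solution V T \<mu>\<^sub>0 \<nu>"
      by (rule limit_is_solution)
  qed
qed

end
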